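(* Let $\mathcal{T}=\{\mathcal{T}_s\}_{s\in\mathcal{S}}$ be a finite collection of GLS IFSs with digit set $\mathcal{D}$, let $\alpha=(\alpha_d)_{d\in\mathcal{D}}$ be a frequency vector such that for each $s\in\mathcal{S}$ there exists $b\in\mathcal{B}_s$ with $\alpha_{(s,b)}>0$, and let $\omega\in\Omega_{\mathcal{T}}(\alpha)$. Assume that the limit $$\lim_{n\to+\infty}\frac{\log n}{\log N_{s,n}}$$ exists for all $s\in\mathcal{S}_{\mathbb{N}}$. Then $$\dim_H F_{\mathcal{T},\omega}(\alpha)=\max\{\eta_{\mathcal{T}},\beta_{\mathcal{T}}(\alpha)\}.$$ Furthermore, if $\sum_{d\in\mathcal{D}}\alpha_d\log N_d=+\infty$, then $\dim_H F_{\mathcal{T},\omega}(\alpha)=\eta_{\mathcal{T}}$.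
   Context: $\mathbb{N}=\{1,2,\dots\}$, $|U|$ denotes the diameter of $U\subseteq\mathbb{R}$, and $\dim_H$ is Hausdorff dimension. $\mathcal{S}$ is a finite set. For each $s\in\mathcal{S}$, $\mathcal{T}_s=\{f_{s,b}:[0,1]\to[0,1]\}_{b\in\mathcal{B}_s}$ is a GLS IFS, meaning: the index set $\mathcal{B}_s$ is countable, and is taken to be $\{1,2,\dots,B_s\}$ for some $B_s\in\mathbb{N}$ if it is finite and $\mathbb{N}$ otherwise; each $f_{s,b}$ is an affine contraction, with contraction ratio $N_{s,b}^{-1}=|f_{s,b}([0,1])|\in(0,1)$; $\mathcal{T}_s$ satisfies the open set condition, the intervals $f_{s,b}([0,1])$, $b\in\mathcal{B}_s$, having pairwise disjoint interiors; and $\sum_{b\in\mathcal{B}_s}|f_{s,b}([0,1])|=1$. The indices are ordered so that $N_{s,b}\le N_{s,b'}$ whenever $b<b'$ in $\mathcal{B}_s$. Put $\mathcal{S}_{\mathbb{N}}=\{s\in\mathcal{S}:\mathcal{B}_s=\mathbb{N}\}$. The digit set is $\mathcal{D}=\{(s,b):s\in\mathcal{S},\,b\in\mathcal{B}_s\}$; for $d=(s,b)$ write $N_d=N_{s,b}$. For $m\in\mathbb{N}$ put $\mathcal{D}_m=\{(s,b)\in\mathcal{D}:b\le m\}$. A frequency vector $\alpha=(\alpha_d)_{d\in\mathcal{D}}$ is a probability vector: $\alpha_d\ge0$, $\sum_{d\in\mathcal{D}}\alpha_d=1$. Put $\alpha_s=\sum_{b\in\mathcal{B}_s}\alpha_{(s,b)}$.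 Convention: $0\log0=0$. For $\omega=(\omega_n)_{n\in\mathbb{N}}\in\mathcal{S}^{\mathbb{N}}$ let $\mathcal{B}_\omega^{\mathbb{N}}=\{(b_n)_{n\in\mathbb{N}}: b_k\in\mathcal{B}_{\omega_k}\ \forall k\in\mathbb{N}\}$ and let $\pi_\omega:\mathcal{B}_\omega^{\mathbb{N}}\to[0,1]$ map $(b_n)_{n\in\mathbb{N}}$ to the unique point of $\bigcap_{n\in\mathbb{N}} f_{\omega_1,b_1}\circ\cdots\circ f_{\omega_n,b_n}([0,1])$. Set $$E_\omega(\alpha)=\left\{(b_n)_{n\in\mathbb{N}}\in\mathcal{B}_\omega^{\mathbb{N}}:\lim_{n\to+\infty}\frac{\#\{1\le k\le n:(\omega_k,b_k)=d\}}{n}=\alpha_d\ \text{ for all } d\in\mathcal{D}\right\},$$ $F_{\mathcal{T},\omega}(\alpha)=\pi_\omega(E_\omega(\alpha))$ and $\Omega_{\mathcal{T}}(\alpha)=\{\omega\in\mathcal{S}^{\mathbb{N}}:F_{\mathcal{T},\omega}(\alpha)\neq\emptyset\}$. The exponent of convergence of $\mathcal{T}_s$ is $\eta(\mathcal{T}_s)=\inf\{t\ge0:\sum_{b\in\mathcal{B}_s}N_{s,b}^{-t}<+\infty\}\in[0,1]$, and $\eta_{\mathcal{T}}=\max\{\eta(\mathcal{T}_s):s\in\mathcal{S}\}$. The fibre dimension is $$\beta_{\mathcal{T}}(\alpha)=\liminf_{m\to+\infty}\frac{\sum_{s\in\mathcal{S}}\alpha_s\log\alpha_s-\sum_{d\in\mathcal{D}_m}\alpha_d\log\alpha_d}{\sum_{d\in\mathcal{D}_m}\alpha_d\log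 N_d}.$$ *)

theory Defs
  imports "HOL-Analysis.Analysis"
begin

section \<open>Hausdorff dimension\<close>

text \<open>The summand \<open>|U|^t\<close>, with the conventions \<open>|{}|^t = 0\<close> and \<open>|U|^0 = 1\<close> for nonempty \<open>U\<close>
  (\<open>0 powr 0 = 0\<close> would not give the latter for singletons).\<close>

definition diam_pow :: "real \<Rightarrow> 'a::metric_space set \<Rightarrow> ennreal" where
  "diam_pow t U = (if U = {} then 0 else if t = 0 then 1 else ennreal (diameter U powr t))"

text \<open>Boundedness is required because \<^const>\<open>diameter\<close> is only meaningful for bounded sets.\<close>

definition delta_covers :: "real \<Rightarrow> 'a::metric_space set \<Rightarrow> (nat \<Rightarrow> 'a set) set" where
  "delta_covers \<delta> A = {U. A \<subseteq> (\<Union>i. U i) \<and> (\<forall>i. bounded (U i) \<and> diameter (U i) \<le> \<delta>)}"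

definition hausdorff_measure :: "real \<Rightarrow> 'a::metric_space set \<Rightarrow> ennreal" where
  "hausdorff_measure t A = (SUP \<delta>\<in>{0<..}. INF U\<in>delta_covers \<delta> A. \<Sum>i. diam_pow t (U i))"

definition hausdorff_dim :: "'a::metric_space set \<Rightarrow> ereal" where
  "hausdorff_dim A = (INF t\<in>{t. 0 \<le> t \<and> hausdorff_measure t A = 0}. ereal t)"

section \<open>Collections of GLS iterated function systems\<close>

text \<open>An IFS is given by its index set \<open>B\<close> and its maps \<open>g b\<close>, of which only the restrictions to
  \<open>[0,1]\<close> for \<open>b \<in> B\<close> matter. Disjointness of the interiors of the images of \<open>[0,1]\<close> is the open
  set condition, with open set \<open>(0,1)\<close>.\<close>

definition GLS_IFS :: "nat set \<Rightarrow> (nat \<Rightarrow> real \<Rightarrow> real) \<Rightarrow> bool" where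
  "GLS_IFS B g \<longleftrightarrow>
     ((\<exists>m\<ge>1. B = {1..m}) \<or> B = {1..}) \<and>
     (\<forall>b\<in>B. g b ` {0..1} \<subseteq> {0..1}) \<and>
     (\<forall>b\<in>B. \<exists>r c. 0 < \<bar>r\<bar> \<and> \<bar>r\<bar> < 1 \<and> (\<forall>x\<in>{0..1}. g b x = r * x + c)) \<and>
     disjoint_family_on (\<lambda>b. interior (g b ` {0..1})) B \<and>
     ((\<lambda>b. diameter (g b ` {0..1})) has_sum 1) B"

text \<open>\<open>inv_ratio f s b\<close> is \<open>N\<^bsub>s,b\<^esub>\<close>.\<close>

definition inv_ratio :: "('s \<Rightarrow> nat \<Rightarrow> real \<Rightarrow> real) \<Rightarrow> 's \<Rightarrow> nat \<Rightarrow> real" where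
  "inv_ratio f s b = inverse (diameter (f s b ` {0..1}))"

definition GLS_collection :: "'s set \<Rightarrow> ('s \<Rightarrow> nat set) \<Rightarrow> ('s \<Rightarrow> nat \<Rightarrow> real \<Rightarrow> real) \<Rightarrow> bool" where
  "GLS_collection S B f \<longleftrightarrow>
     finite S \<and> (\<forall>s\<in>S. GLS_IFS (B s) (f s) \<and> mono_on (B s) (inv_ratio f s))"

definition digits :: "'s set \<Rightarrow> ('s \<Rightarrow> nat set) \<Rightarrow> ('s \<times> nat) set" where
  "digits S B = Sigma S B"

definition digits_upto :: "'s set \<Rightarrow> ('s \<Rightarrow> nat set) \<Rightarrow> nat \<Rightarrow> ('s \<times> nat) set" where
  "digits_upto S B m = {(s, b) \<in> digits S B. b \<le> m}"

definition frequency_vector :: "'s set \<Rightarrow> ('s \<Rightarrow> nat set) \<Rightarrow> ('s \<times> nat \<Rightarrow> real) \<Rightarrow> bool" where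
  "frequency_vector S B \<alpha> \<longleftrightarrow> (\<forall>d\<in>digits S B. 0 \<le> \<alpha> d) \<and> (\<alpha> has_sum 1) (digits S B)"

definition marginal :: "('s \<Rightarrow> nat set) \<Rightarrow> ('s \<times> nat \<Rightarrow> real) \<Rightarrow> 's \<Rightarrow> real" where
  "marginal B \<alpha> s = (\<Sum>\<^sub>\<infinity>b\<in>B s. \<alpha> (s, b))"

section \<open>Coding maps and frequency sets\<close>

text \<open>Sequences indexed by \<open>{1, 2, \<dots>}\<close> are shifted to start at \<open>0\<close>: \<open>\<omega> k\<close> and \<open>b k\<close>
  are the \<open>(k+1)\<close>-st terms. The digits themselves are not shifted.\<close>

definition index_seqs :: "('s \<Rightarrow> nat set) \<Rightarrow> (nat \<Rightarrow> 's) \<Rightarrow> (nat \<Rightarrow> nat) set" where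
  "index_seqs B \<omega> = {b. \<forall>k. b k \<in> B (\<omega> k)}"

primrec comp_maps ::
  "('s \<Rightarrow> nat \<Rightarrow> real \<Rightarrow> real) \<Rightarrow> (nat \<Rightarrow> 's) \<Rightarrow> (nat \<Rightarrow> nat) \<Rightarrow> nat \<Rightarrow> real \<Rightarrow> real" where
  "comp_maps f \<omega> b 0 = id"
| "comp_maps f \<omega> b (Suc n) = comp_maps f \<omega> b n \<circ> f (\<omega> n) (b n)"

definition coding :: "('s \<Rightarrow> nat \<Rightarrow> real \<Rightarrow> real) \<Rightarrow> (nat \<Rightarrow> 's) \<Rightarrow> (nat \<Rightarrow> nat) \<Rightarrow> real" where
  "coding f \<omega> b = (THE x. x \<in> (\<Inter>n\<in>{1..}. comp_maps f \<omega> b n ` {0..1}))"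

definition freq_seqs ::
  "'s set \<Rightarrow> ('s \<Rightarrow> nat set) \<Rightarrow> (nat \<Rightarrow> 's) \<Rightarrow> ('s \<times> nat \<Rightarrow> real) \<Rightarrow> (nat \<Rightarrow> nat) set" where
  "freq_seqs S B \<omega> \<alpha> =
     {b \<in> index_seqs B \<omega>. \<forall>d\<in>digits S B.
        (\<lambda>n. real (card {k. k < n \<and> (\<omega> k, b k) = d}) / real n) \<longlonglongrightarrow> \<alpha> d}"

definition freq_set ::
  "'s set \<Rightarrow> ('s \<Rightarrow> nat set) \<Rightarrow> ('s \<Rightarrow> nat \<Rightarrow> real \<Rightarrow> real) \<Rightarrow> (nat \<Rightarrow> 's) \<Rightarrow>
   ('s \<times> nat \<Rightarrow> real) \<Rightarrow> real set" where
  "freq_set S B f \<omega> \<alpha> = coding f \<omega> ` freq_seqs S B \<omega> \<alpha>"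

definition admissible_seqs ::
  "'s set \<Rightarrow> ('s \<Rightarrow> nat set) \<Rightarrow> ('s \<Rightarrow> nat \<Rightarrow> real \<Rightarrow> real) \<Rightarrow> ('s \<times> nat \<Rightarrow> real) \<Rightarrow> (nat \<Rightarrow> 's) set" where
  "admissible_seqs S B f \<alpha> = {\<omega>. (\<forall>k. \<omega> k \<in> S) \<and> freq_set S B f \<omega> \<alpha> \<noteq> {}}"

section \<open>Exponent of convergence and fibre dimension\<close>

definition conv_exponent :: "('s \<Rightarrow> nat set) \<Rightarrow> ('s \<Rightarrow> nat \<Rightarrow> real \<Rightarrow> real) \<Rightarrow> 's \<Rightarrow> real" where
  "conv_exponent B f s = Inf {t. 0 \<le> t \<and> (\<lambda>b. inv_ratio f s b powr (- t)) summable_on B s}"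

definition max_conv_exponent ::
  "'s set \<Rightarrow> ('s \<Rightarrow> nat set) \<Rightarrow> ('s \<Rightarrow> nat \<Rightarrow> real \<Rightarrow> real) \<Rightarrow> real" where
  "max_conv_exponent S B f = Max (conv_exponent B f ` S)"

text \<open>The convention \<open>0 log 0 = 0\<close> holds automatically. The denominator is positive for all large
  \<open>m\<close>, so division by zero does not affect the lower limit.\<close>

definition fibre_dim ::
  "'s set \<Rightarrow> ('s \<Rightarrow> nat set) \<Rightarrow> ('s \<Rightarrow> nat \<Rightarrow> real \<Rightarrow> real) \<Rightarrow> ('s \<times> nat \<Rightarrow> real) \<Rightarrow> ereal" where
  "fibre_dim S B f \<alpha> = liminf (\<lambda>m. ereal
     (((\<Sum>s\<in>S. marginal B \<alpha> s * ln (marginal B \<alpha> s))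
         - (\<Sum>d\<in>digits_upto S B m. \<alpha> d * ln (\<alpha> d)))
       / (\<Sum>(s, b)\<in>digits_upto S B m. \<alpha> (s, b) * ln (inv_ratio f s b))))"

end

(*
  Upper bound: for t above both quantities, weigh digits by a sub-probability vector q that is close
  to the conditional frequencies on finitely many digits and proportional to N powr -t on the rest.
  Along a sequence with frequencies alpha, the product of N powr -t is exponentially smaller than
  the product of q, so the natural covers by cylinders have arbitrarily small t-sums.

  Lower bound: a mass distribution principle for product measures on digit sequences, under the
  condition that each digit is small compared with the cylinder preceding it. It is applied to two
  modifications of one sequence with the right frequencies whose digits grow slowly. Drawing large
  digits uniformly at a sparse set of positions gives the exponent of convergence; redrawing all
  digits up to a fixed bound from the conditional frequencies gives the fibre dimension when the
  Lyapunov exponent is finite. When it is infinite, the fibre dimension is at most the exponent.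
*)
theory Submission
  imports Defs "HOL-Probability.Probability" "HOL-Real_Asymp.Real_Asymp"
begin

section \<open>Geometry of the cylinders\<close>

text \<open>The fibre \<open>\<omega>\<close> is fixed, and what is known of its frequencies is that
  some sequence realises \<open>\<alpha>\<close> over it. Only the digits given the symbols can be
  chosen, so the relevant entropy is conditional on the symbol, and each random construction
  modifies a given sequence of \<open>E\<close>. The obstacle is that frequencies do not control
  rare large digits: they determine limits of averages only for functions that are constant off a
  finite set of digits, while \<open>ln N\<close> may be unbounded. In the upper bound, the weight
  proportional to \<open>N powr -t\<close> on rare digits makes the quotient of
  \<open>N powr -t\<close> by \<open>q\<close> such a function; the need for this weight to be
  summable is what brings in the exponent of convergence. In the lower bound, the same obstacle
  forces the slow reference sequence. The limits of \<open>ln n / ln N\<close> enter only in the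
  lower bound by the exponent: for each \<open>t\<close> below it they give \<open>N powr t\<close>
  at most a constant times the index, along the whole index set and not only along a subsequence, so
  every dyadic block of digits is usable.\<close>

lemma affine_image_unit_interval:
  fixes r c :: real
  assumes "r \<noteq> 0"
  shows "(\<lambda>x. r * x + c) ` {0..1} = {min c (r + c)..max c (r + c)}"
    and "(\<lambda>x. r * x + c) ` {0<..<1} = {min c (r + c)<..<max c (r + c)}"
proof -
  show "(\<lambda>x. r * x + c) ` {0..1} = {min c (r + c)..max c (r + c)}"
  proof (intro equalityI subsetI)
    fix y assume "y \<in> {min c (r + c)..max c (r + c)}"
    then have "(y - c) / r \<in> {0..1}" "y = r * ((y - c) / r) + c"
      using assms by (auto simp: min_def max_def divide_simps split: if_splits)
    then show "y \<in> (\<lambda>x. r * x + c) ` {0..1}" by blast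
  next
    fix y assume "y \<in> (\<lambda>x. r * x + c) ` {0..1}"
    then obtain x where "0 \<le> x" "x \<le> 1" "y = r * x + c" by auto
    then show "y \<in> {min c (r + c)..max c (r + c)}"
      using mult_left_le[of x r] mult_left_le[of x "-r"]
      by (cases "r > 0") (auto simp: min_def max_def mult_nonneg_nonneg mult_nonpos_nonneg)
  qed
  show "(\<lambda>x. r * x + c) ` {0<..<1} = {min c (r + c)<..<max c (r + c)}"
  proof (intro equalityI subsetI)
    fix y assume "y \<in> {min c (r + c)<..<max c (r + c)}"
    then have "(y - c) / r \<in> {0<..<1}" "y = r * ((y - c) / r) + c"
      using assms by (auto simp: min_def max_def divide_simps split: if_splits)
    then show "y \<in> (\<lambda>x. r * x + c) ` {0<..<1}" by blast
  next
    fix y assume "y \<in> (\<lambda>x. r * x + c) ` {0<..<1}"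
    then obtain x where x: "0 < x" "x < 1" "y = r * x + c" by auto
    show "y \<in> {min c (r + c)<..<max c (r + c)}"
    proof (cases "r > 0")
      case True
      then have "0 < r * x" "r * x < r * 1" using x by (auto simp del: mult_1_right)
      then show ?thesis using True x by (auto simp: min_def max_def)
    next
      case False
      then have "r < 0" using assms by auto
      then have "r * x < 0" "r * 1 < r * x"
        using x by (auto simp: mult_neg_pos simp del: mult_1_right)
      then show ?thesis using \<open>r < 0\<close> x by (auto simp: min_def max_def)
    qed
  qed
qed

locale gls_fibre =
  fixes S :: "'s set" and B :: "'s \<Rightarrow> nat set" and f :: "'s \<Rightarrow> nat \<Rightarrow> real \<Rightarrow> real"
    and \<omega> :: "nat \<Rightarrow> 's"
  assumes GLS: "GLS_collection S B f" and omega_in: "\<omega> k \<in> S"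
begin

abbreviation N :: "'s \<Rightarrow> nat \<Rightarrow> real" where "N \<equiv> inv_ratio f"

lemma finite_S: "finite S"
  using GLS by (simp add: GLS_collection_def)

lemma S_nonempty: "S \<noteq> {}"
  using omega_in by blast

lemma GLS_IFS: "s \<in> S \<Longrightarrow> GLS_IFS (B s) (f s)"
  using GLS by (simp add: GLS_collection_def)

lemma B_cases: "s \<in> S \<Longrightarrow> (\<exists>m\<ge>1. B s = {1..m}) \<or> B s = {1..}"
  using GLS_IFS by (simp add: GLS_IFS_def)

lemma one_in_B: "s \<in> S \<Longrightarrow> 1 \<in> B s"
  by (drule B_cases) (elim disjE exE conjE; simp)

lemma B_ge_1: "s \<in> S \<Longrightarrow> b \<in> B s \<Longrightarrow> 1 \<le> b"
  by (drule B_cases) (elim disjE exE conjE; simp)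

lemma branch_affine:
  assumes "s \<in> S" "b \<in> B s"
  obtains r c where "0 < \<bar>r\<bar>" "\<bar>r\<bar> < 1" "\<And>x. x \<in> {0..1} \<Longrightarrow> f s b x = r * x + c"
    "\<bar>r\<bar> = inverse (N s b)"
proof -
  obtain r c where rc: "0 < \<bar>r\<bar>" "\<bar>r\<bar> < 1" "\<And>x. x \<in> {0..1} \<Longrightarrow> f s b x = r * x + c"
    using GLS_IFS[OF assms(1)] assms(2) unfolding GLS_IFS_def by blast
  have "f s b ` {0..1} = (\<lambda>x. r * x + c) ` {0..1}"
    using rc(3) by (intro image_cong) auto
  also have "\<dots> = {min c (r + c)..max c (r + c)}"
    using rc(1) by (intro affine_image_unit_interval) auto
  finally have "diameter (f s b ` {0..1}) = \<bar>r\<bar>"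
    by (auto simp: min_def max_def)
  then show thesis
    by (intro that[OF rc]) (simp_all add: inv_ratio_def)
qed

lemma N_gt_1: assumes "s \<in> S" "b \<in> B s" shows "1 < N s b"
proof -
  obtain r where "0 < \<bar>r\<bar>" "\<bar>r\<bar> < 1" "\<bar>r\<bar> = inverse (N s b)"
    using branch_affine[OF assms] by metis
  then show ?thesis
    by (metis inverse_inverse_eq one_less_inverse)
qed

lemma N_pos: "s \<in> S \<Longrightarrow> b \<in> B s \<Longrightarrow> 0 < N s b"
  using N_gt_1 by fastforce

lemma ln_N_pos: "s \<in> S \<Longrightarrow> b \<in> B s \<Longrightarrow> 0 < ln (N s b)"
  by (intro ln_gt_zero N_gt_1)

lemma N_mono: "s \<in> S \<Longrightarrow> b \<in> B s \<Longrightarrow> b' \<in> B s \<Longrightarrow> b \<le> b' \<Longrightarrow> N s b \<le> N s b'"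
  using GLS by (auto simp: GLS_collection_def mono_on_def)

lemma has_sum_inverse_N: "s \<in> S \<Longrightarrow> ((\<lambda>b. inverse (N s b)) has_sum 1) (B s)"
  using GLS_IFS[of s] by (simp add: GLS_IFS_def inv_ratio_def)

lemma B_interval: "s \<in> S \<Longrightarrow> b \<in> B s \<Longrightarrow> 1 \<le> c \<Longrightarrow> c \<le> b \<Longrightarrow> c \<in> B s"
  by (drule B_cases) (elim disjE exE conjE; simp)

text \<open>The \<open>b\<close> largest ratios sum to at most \<open>1\<close>.\<close>

lemma N_ge: assumes "s \<in> S" "b \<in> B s" shows "real b \<le> N s b"
proof -
  have sub: "{1..b} \<subseteq> B s" using B_interval[OF assms] by auto
  have "real b * inverse (N s b) = (\<Sum>c\<in>{1..b}. inverse (N s b))" by simp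
  also have "\<dots> \<le> (\<Sum>c\<in>{1..b}. inverse (N s c))"
    using sub assms by (intro sum_mono le_imp_inverse_le N_mono N_pos) auto
  also have "\<dots> \<le> 1"
    using sub has_sum_inverse_N[OF assms(1)] N_pos[OF assms(1)]
    by (intro has_sum_mono2[of _ "{1..b}" _ "B s" 1] has_sum_finite) (auto simp: less_imp_le)
  finally show ?thesis using N_pos[OF assms] by (simp add: field_simps)
qed

text \<open>A uniform contraction ratio: indices are ordered by decreasing ratio, so
  \<open>b = 1\<close> is the worst index of each system, and finiteness of \<open>S\<close> keeps
  the maximum below 1.\<close>

definition max_ratio :: real where "max_ratio = Max ((\<lambda>s. inverse (N s 1)) ` S)"

lemma max_ratio_bounds: "0 < max_ratio" "max_ratio < 1"
proof -
  have "max_ratio \<in> (\<lambda>s. inverse (N s 1)) ` S"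
    unfolding max_ratio_def using finite_S S_nonempty by (intro Max_in) auto
  then obtain s where s: "s \<in> S" "max_ratio = inverse (N s 1)" by blast
  then show "0 < max_ratio" "max_ratio < 1"
    using N_gt_1[OF s(1) one_in_B[OF s(1)]] by (simp_all add: inverse_less_1_iff)
qed

lemma inverse_N_le: assumes "s \<in> S" "b \<in> B s" shows "inverse (N s b) \<le> max_ratio"
proof -
  have "inverse (N s b) \<le> inverse (N s 1)"
    using assms by (intro le_imp_inverse_le N_mono N_pos one_in_B B_ge_1)
  also have "\<dots> \<le> max_ratio"
    unfolding max_ratio_def using finite_S assms by auto
  finally show ?thesis .
qed

section \<open>Cylinders: affine form, nesting, disjointness and the coding map\<close>

abbreviation cyl :: "(nat \<Rightarrow> nat) \<Rightarrow> nat \<Rightarrow> real set" where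
  "cyl b n \<equiv> comp_maps f \<omega> b n ` {0..1}"

definition len :: "(nat \<Rightarrow> nat) \<Rightarrow> nat \<Rightarrow> real" where
  "len b n = (\<Prod>k<n. inverse (N (\<omega> k) (b k)))"

text \<open>Finite words are represented by functions of which only the first \<open>n\<close>
  values matter. This covers both prefixes of infinite sequences and lists, through
  \<open>(!) u\<close>.\<close>

definition admissible_upto :: "(nat \<Rightarrow> nat) \<Rightarrow> nat \<Rightarrow> bool" where
  "admissible_upto b n \<longleftrightarrow> (\<forall>k<n. b k \<in> B (\<omega> k))"

lemma admissible_upto_mono: "admissible_upto b n \<Longrightarrow> m \<le> n \<Longrightarrow> admissible_upto b m"
  by (auto simp: admissible_upto_def)

lemma index_seqs_admissible: "b \<in> index_seqs B \<omega> \<Longrightarrow> admissible_upto b n"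
  by (auto simp: admissible_upto_def index_seqs_def)

lemma len_0 [simp]: "len b 0 = 1"
  by (simp add: len_def)

lemma len_Suc: "len b (Suc n) = len b n * inverse (N (\<omega> n) (b n))"
  by (simp add: len_def)

lemma len_pos: "admissible_upto b n \<Longrightarrow> 0 < len b n"
  unfolding len_def admissible_upto_def by (intro prod_pos) (auto intro: N_pos omega_in)

lemma len_le: assumes "admissible_upto b n" shows "len b n \<le> max_ratio ^ n"
proof -
  have "len b n \<le> (\<Prod>k<n. max_ratio)"
    unfolding len_def
  proof (intro prod_mono conjI)
    fix k assume "k \<in> {..<n}"
    then have "b k \<in> B (\<omega> k)" using assms by (simp add: admissible_upto_def)
    then show "0 \<le> inverse (N (\<omega> k) (b k))" "inverse (N (\<omega> k) (b k)) \<le> max_ratio"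
      using N_pos[OF omega_in] inverse_N_le[OF omega_in] by (auto intro: less_imp_le)
  qed
  then show ?thesis by simp
qed

lemma comp_maps_cong: "(\<And>k. k < n \<Longrightarrow> b k = b' k) \<Longrightarrow> comp_maps f \<omega> b n = comp_maps f \<omega> b' n"
  by (induction n) auto

lemma len_cong: "(\<And>k. k < n \<Longrightarrow> b k = b' k) \<Longrightarrow> len b n = len b' n"
  unfolding len_def by (intro prod.cong) auto

lemma branch_maps_to: "s \<in> S \<Longrightarrow> b \<in> B s \<Longrightarrow> f s b ` {0..1} \<subseteq> {0..1}"
  using GLS_IFS[of s] by (auto simp: GLS_IFS_def)

lemma branch_open_image:
  assumes "s \<in> S" "b \<in> B s"
  shows "f s b ` {0<..<1} \<subseteq> {0<..<1}" "f s b ` {0<..<1} = interior (f s b ` {0..1})"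
proof -
  obtain r c where rc: "0 < \<bar>r\<bar>" "\<bar>r\<bar> < 1" "\<And>x. x \<in> {0..1} \<Longrightarrow> f s b x = r * x + c"
    using branch_affine[OF assms] by metis
  have 1: "f s b ` {0..1} = (\<lambda>x. r * x + c) ` {0..1}" "f s b ` {0<..<1} = (\<lambda>x. r * x + c) ` {0<..<1}"
    using rc(3) by (auto intro!: image_cong)
  have r: "r \<noteq> 0" using rc by auto
  show 2: "f s b ` {0<..<1} = interior (f s b ` {0..1})"
    unfolding 1 affine_image_unit_interval[OF r] by simp
  show "f s b ` {0<..<1} \<subseteq> {0<..<1}"
    unfolding 2 using interior_mono[OF branch_maps_to[OF assms]] by simp
qed

text \<open>Slopes multiply under composition. Branches may reverse orientation, so only the
  absolute value of the slope is tracked.\<close>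

lemma comp_maps_affine:
  assumes "admissible_upto b n"
  shows "\<exists>r c. \<bar>r\<bar> = len b n \<and> (\<forall>x\<in>{0..1}. comp_maps f \<omega> b n x = r * x + c)"
  using assms
proof (induction n)
  case 0
  show ?case by (intro exI[of _ 1] exI[of _ 0]) auto
next
  case (Suc n)
  then obtain r c where rc: "\<bar>r\<bar> = len b n" "\<forall>x\<in>{0..1}. comp_maps f \<omega> b n x = r * x + c"
    using admissible_upto_mono[of b "Suc n" n] by auto
  have bn: "\<omega> n \<in> S" "b n \<in> B (\<omega> n)"
    using Suc.prems omega_in by (auto simp: admissible_upto_def)
  obtain r' c' where rc': "\<And>x. x \<in> {0..1} \<Longrightarrow> f (\<omega> n) (b n) x = r' * x + c'" "\<bar>r'\<bar> = inverse (N (\<omega> n) (b n))"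
    using branch_affine[OF bn] by metis
  have "comp_maps f \<omega> b (Suc n) x = r * r' * x + (r * c' + c)" if "x \<in> {0..1}" for x
  proof -
    have "f (\<omega> n) (b n) x \<in> {0..1}" using branch_maps_to[OF bn] that by blast
    then show ?thesis using rc(2) rc'(1)[OF that] by (simp add: algebra_simps)
  qed
  then show ?case
    using rc(1) rc'(2) by (intro exI[of _ "r * r'"] exI[of _ "r * c' + c"]) (auto simp: abs_mult len_Suc)
qed

lemma cyl_interval:
  assumes "admissible_upto b n"
  obtains a where "cyl b n = {a..a + len b n}" "comp_maps f \<omega> b n ` {0<..<1} = {a<..<a + len b n}"
proof -
  obtain r c where rc: "\<bar>r\<bar> = len b n" "\<forall>x\<in>{0..1}. comp_maps f \<omega> b n x = r * x + c"
    using comp_maps_affine[OF assms] by blast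
  have r: "r \<noteq> 0" using rc(1) len_pos[OF assms] by auto
  have 1: "cyl b n = (\<lambda>x. r * x + c) ` {0..1}"
      "comp_maps f \<omega> b n ` {0<..<1} = (\<lambda>x. r * x + c) ` {0<..<1}"
    using rc(2) by (auto intro!: image_cong)
  have 2: "max c (r + c) = min c (r + c) + len b n"
    using rc(1) by auto
  show thesis
    by (rule that[of "min c (r + c)"]) (simp_all add: 1 affine_image_unit_interval[OF r] 2)
qed

lemma inj_on_comp_maps:
  assumes "admissible_upto b n"
  shows "inj_on (comp_maps f \<omega> b n) {0..1}"
proof -
  obtain r c where rc: "\<bar>r\<bar> = len b n" "\<forall>x\<in>{0..1}. comp_maps f \<omega> b n x = r * x + c"
    using comp_maps_affine[OF assms] by blast
  then show ?thesis using len_pos[OF assms] by (auto simp: inj_on_def)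
qed

lemma cyl_Suc_subset:
  assumes "admissible_upto b (Suc n)"
  shows "cyl b (Suc n) \<subseteq> cyl b n" "comp_maps f \<omega> b (Suc n) ` {0<..<1} \<subseteq> comp_maps f \<omega> b n ` {0<..<1}"
proof -
  have bn: "\<omega> n \<in> S" "b n \<in> B (\<omega> n)"
    using assms omega_in by (auto simp: admissible_upto_def)
  show "cyl b (Suc n) \<subseteq> cyl b n"
    using image_mono[OF branch_maps_to[OF bn], of "comp_maps f \<omega> b n"] by (simp add: image_comp)
  show "comp_maps f \<omega> b (Suc n) ` {0<..<1} \<subseteq> comp_maps f \<omega> b n ` {0<..<1}"
    using image_mono[OF branch_open_image(1)[OF bn], of "comp_maps f \<omega> b n"] by (simp add: image_comp)
qed

lemma cyl_antimono:
  assumes "admissible_upto b n" "m \<le> n"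
  shows "cyl b n \<subseteq> cyl b m \<and> comp_maps f \<omega> b n ` {0<..<1} \<subseteq> comp_maps f \<omega> b m ` {0<..<1}"
  using assms(2,1)
proof (induction n rule: dec_induct)
  case base
  then show ?case by simp
next
  case (step n)
  have "admissible_upto b n" using step.prems by (rule admissible_upto_mono) simp
  from step.IH[OF this] cyl_Suc_subset[OF step.prems] show ?case
    by (meson order_trans)
qed

text \<open>At the first disagreement \<open>j\<close> the branches have disjoint open images; the
  map of the common prefix is injective and preserves this, and deeper cylinders are nested inside.
  Closed cylinders could share an endpoint, hence the open ones.\<close>

lemma open_cyl_disjoint:
  assumes b: "admissible_upto b n" "admissible_upto b' n'" and k: "k < n" "k < n'" "b k \<noteq> b' k"
  shows "comp_maps f \<omega> b n ` {0<..<1} \<inter> comp_maps f \<omega> b' n' ` {0<..<1} = {}"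
proof -
  define j where "j = (LEAST k. b k \<noteq> b' k)"
  have j: "b j \<noteq> b' j" unfolding j_def using k(3) by (rule LeastI)
  have "j \<le> k" unfolding j_def using k(3) by (rule Least_le)
  have eq: "b i = b' i" if "i < j" for i
    using not_less_Least[of i "\<lambda>k. b k \<noteq> b' k"] that by (auto simp: j_def)
  have jn: "Suc j \<le> n" "Suc j \<le> n'" using k \<open>j \<le> k\<close> by auto
  have w: "\<omega> j \<in> S" "b j \<in> B (\<omega> j)" "b' j \<in> B (\<omega> j)"
    using b jn omega_in by (auto simp: admissible_upto_def)
  have "disjoint_family_on (\<lambda>b. interior (f (\<omega> j) b ` {0..1})) (B (\<omega> j))"
    using GLS_IFS[OF w(1)] by (simp add: GLS_IFS_def)
  then have "f (\<omega> j) (b j) ` {0<..<1} \<inter> f (\<omega> j) (b' j) ` {0<..<1} = {}"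
    using w j branch_open_image(2)[OF w(1)] by (auto simp: disjoint_family_on_def)
  moreover have "f (\<omega> j) (b j) ` {0<..<1} \<subseteq> {0..1}" "f (\<omega> j) (b' j) ` {0<..<1} \<subseteq> {0..1}"
    using branch_open_image(1)[OF w(1)] w by fastforce+
  moreover have "inj_on (comp_maps f \<omega> b j) {0..1}"
    using inj_on_comp_maps admissible_upto_mono[OF b(1)] jn by simp
  ultimately have "comp_maps f \<omega> b j ` f (\<omega> j) (b j) ` {0<..<1} \<inter> comp_maps f \<omega> b j ` f (\<omega> j) (b' j) ` {0<..<1} = {}"
    by (metis inj_on_image_Int image_empty)
  moreover have "comp_maps f \<omega> b' j = comp_maps f \<omega> b j"
    using eq by (intro comp_maps_cong) auto
  ultimately have "comp_maps f \<omega> b (Suc j) ` {0<..<1} \<inter> comp_maps f \<omega> b' (Suc j) ` {0<..<1} = {}"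
    by (simp add: image_comp)
  then show ?thesis
    using cyl_antimono[OF b(1) jn(1)] cyl_antimono[OF b(2) jn(2)] by blast
qed

lemma len_tendsto_0: assumes "b \<in> index_seqs B \<omega>" shows "len b \<longlonglongrightarrow> 0"
proof (rule Lim_null_comparison)
  have "norm (len b n) \<le> max_ratio ^ n" for n
    using len_pos[of b n] len_le[of b n] index_seqs_admissible[OF assms, of n] by simp
  then show "\<forall>\<^sub>F n in sequentially. norm (len b n) \<le> max_ratio ^ n"
    by simp
  show "(\<lambda>n. max_ratio ^ n) \<longlonglongrightarrow> 0"
    using max_ratio_bounds by (simp add: LIMSEQ_power_zero)
qed

text \<open>Nested compact intervals have a common point, and it is unique because the lengths tend
  to 0, so the definite description in \<open>coding\<close> is meaningful.\<close>

lemma coding_in_cyl: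
  assumes "b \<in> index_seqs B \<omega>"
  shows "coding f \<omega> b \<in> cyl b n"
proof -
  note adm = index_seqs_admissible[OF assms]
  have ex: "\<exists>x. \<forall>n. x \<in> cyl b n"
  proof -
    have "(\<Inter>n. cyl b n) \<noteq> {}"
    proof (rule compact_nest)
      show "compact (cyl b n)" for n
        using cyl_interval[OF adm] by (metis compact_Icc)
      show "cyl b n \<noteq> {}" for n by simp
      show "cyl b n \<subseteq> cyl b m" if "m \<le> n" for m n
        using cyl_antimono[OF adm that] by blast
    qed
    then show ?thesis by blast
  qed
  then obtain x where x: "\<And>n. x \<in> cyl b n" by blast
  have "coding f \<omega> b = x"
    unfolding coding_def
  proof (rule the_equality)
    show "x \<in> (\<Inter>n\<in>{1..}. cyl b n)" using x by blast
    fix y assume y: "y \<in> (\<Inter>n\<in>{1..}. cyl b n)"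
    have "\<bar>y - x\<bar> \<le> len b n" if "n \<ge> 1" for n
    proof -
      obtain a where "cyl b n = {a..a + len b n}" using cyl_interval[OF adm] by metis
      moreover have "x \<in> cyl b n" "y \<in> cyl b n" using x y that by blast+
      ultimately show ?thesis by auto
    qed
    then have "\<bar>y - x\<bar> \<le> 0"
      by (intro LIMSEQ_le_const[OF len_tendsto_0[OF assms]]) auto
    then show "y = x" by simp
  qed
  then show ?thesis using x by simp
qed

end

section \<open>Mass distribution for product measures\<close>

context gls_fibre
begin

abbreviation product_law :: "(nat \<Rightarrow> nat pmf) \<Rightarrow> (nat \<Rightarrow> nat) measure" where
  "product_law p \<equiv> PiM UNIV (\<lambda>k. measure_pmf (p k))"

definition cyl_mass :: "(nat \<Rightarrow> nat pmf) \<Rightarrow> (nat \<Rightarrow> nat) \<Rightarrow> nat \<Rightarrow> real" where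
  "cyl_mass p b n = (\<Prod>k<n. pmf (p k) (b k))"

lemma product_prob_space_pmf: "product_prob_space (\<lambda>k. measure_pmf (p k))"
  by unfold_locales

lemma prob_space_product_law: "prob_space (product_law p)"
  by (intro prob_space_PiM measure_pmf.prob_space_axioms)

lemma space_product_law [simp]: "space (product_law p) = UNIV"
  by (simp add: space_PiM PiE_def extensional_def)

lemma measurable_coordinate [measurable]: "(\<lambda>b. b k) \<in> measurable (product_law p) (count_space UNIV)"
proof -
  have "(\<lambda>b. b k) \<in> measurable (product_law p) (measure_pmf (p k))"
    by (rule measurable_component_singleton) simp
  then show ?thesis by simp
qed

lemma sets_word_cylinder: "{c. \<forall>k<n. c k = u k} \<in> sets (product_law p)"
proof -
  have "{c \<in> space (product_law p). \<forall>k<n. c k = u k} \<in> sets (product_law p)"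
    by measurable
  then show ?thesis by simp
qed

lemma emeasure_word_cylinder:
  "emeasure (product_law p) {c. \<forall>k<n. c k = u k} = ennreal (cyl_mass p u n)"
proof -
  interpret product_prob_space "\<lambda>k. measure_pmf (p k)" UNIV
    by (rule product_prob_space_pmf)
  have "emeasure (product_law p) {c \<in> space (product_law p). \<forall>k\<in>{..<n}. c k \<in> {u k}}
      = (\<Prod>k\<in>{..<n}. emeasure (measure_pmf (p k)) {u k})"
    by (intro emeasure_PiM_Collect) auto
  also have "\<dots> = ennreal (cyl_mass p u n)"
    by (simp add: emeasure_pmf_single cyl_mass_def prod_ennreal)
  finally show ?thesis by (simp add: Ball_def)
qed

lemma AE_in_support: "AE b in product_law p. \<forall>k. b k \<in> set_pmf (p k)"
proof -
  have "AE b in product_law p. b k \<in> set_pmf (p k)" for k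
    by (intro AE_PiM_component) (auto simp: AE_measure_pmf intro: measure_pmf.prob_space_axioms)
  then show ?thesis by (simp add: AE_all_countable)
qed

text \<open>The constant \<open>C\<close> turns inequalities that hold eventually into inequalities
  at every level; as \<open>C\<close> grows these sets exhaust almost all sequences, as in Egorov's
  theorem. The last inequality says that a cylinder is not much shorter than its parent.\<close>

definition regular_seqs :: "(nat \<Rightarrow> nat pmf) \<Rightarrow> real \<Rightarrow> real \<Rightarrow> real \<Rightarrow> (nat \<Rightarrow> nat) set" where
  "regular_seqs p t \<epsilon> C = {b. (\<forall>k. b k \<in> set_pmf (p k)) \<and>
     (\<forall>n. cyl_mass p b n \<le> C * len b n powr t \<and> len b n powr \<epsilon> * N (\<omega> n) (b n) \<le> C)}"

lemma sets_regular_seqs: "regular_seqs p t \<epsilon> C \<in> sets (product_law p)"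
proof -
  have m: "(\<lambda>b. cyl_mass p b n) \<in> borel_measurable (product_law p)"
    "(\<lambda>b. len b n) \<in> borel_measurable (product_law p)"
    "(\<lambda>b. N (\<omega> n) (b n)) \<in> borel_measurable (product_law p)" for n
    unfolding cyl_mass_def len_def by measurable
  have 1: "{b \<in> space (product_law p). b k \<in> set_pmf (p k)} \<in> sets (product_law p)" for k
    by measurable
  have 2: "{b \<in> space (product_law p). cyl_mass p b n \<le> C * len b n powr t} \<in> sets (product_law p)"
    "{b \<in> space (product_law p). len b n powr \<epsilon> * N (\<omega> n) (b n) \<le> C} \<in> sets (product_law p)" for n
    by (intro borel_measurable_le borel_measurable_times powr_real_measurable m measurable_const; simp)+
  have "{b \<in> space (product_law p). (\<forall>k. b k \<in> set_pmf (p k)) \<and>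
     (\<forall>n. cyl_mass p b n \<le> C * len b n powr t \<and> len b n powr \<epsilon> * N (\<omega> n) (b n) \<le> C)}
     \<in> sets (product_law p)"
    by (intro sets.sets_Collect_conj sets.sets_Collect_countable_All 1 2)
  then show ?thesis by (simp add: regular_seqs_def)
qed

text \<open>The words cut where \<open>len\<close> first drops below \<open>r\<close> give essentially disjoint intervals, all close
  to \<open>U\<close> and none much shorter than \<open>r\<close>, so that there are few of them.\<close>

lemma regular_cover:
  assumes supp: "\<And>k. set_pmf (p k) \<subseteq> B (\<omega> k)" and C: "0 < C" and t: "0 < t" "0 < \<epsilon>"
    and U: "bounded U" "diameter U \<le> r" and r: "0 < r" "r < 1"
  shows "\<exists>V\<in>sets (product_law p). {b \<in> regular_seqs p t \<epsilon> C. coding f \<omega> b \<in> U} \<subseteq> V \<and>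
    emeasure (product_law p) V \<le> ennreal (4 * C\<^sup>2 * r powr (t - \<epsilon>))"
proof -
  \<comment> \<open>As \<open>U\<close> is arbitrary, \<open>G\<close> need not be measurable. The
    estimate is therefore carried by a measurable superset, a finite union of word
    cylinders.\<close>
  define G where "G = {b \<in> regular_seqs p t \<epsilon> C. coding f \<omega> b \<in> U}"
  define st where "st b = (LEAST n. len b n \<le> r)" for b
  define w where "w b = map b [0..<st b]" for b
  have G_idx: "b \<in> index_seqs B \<omega>" if "b \<in> G" for b
    using that supp by (auto simp: G_def regular_seqs_def index_seqs_def)
  note adm = index_seqs_admissible[OF G_idx]
  have st_le: "len b (st b) \<le> r" if "b \<in> G" for b
  proof -
    have "\<forall>\<^sub>F n in sequentially. len b n < r"
      using order_tendstoD(2)[OF len_tendsto_0[OF G_idx[OF that]] r(1)] .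
    then obtain n where "len b n < r" by (auto simp: eventually_sequentially)
    then show ?thesis unfolding st_def by (intro LeastI[of "\<lambda>n. len b n \<le> r" n]) simp
  qed
  have st_less: "r < len b n" if "n < st b" for b n
    using not_less_Least[OF that[unfolded st_def]] by simp
  have st_pos: "0 < st b" if "b \<in> G" for b
    using st_le[OF that] r by (cases "st b") auto
  \<comment> \<open>One level before the cut the cylinder is still longer than \<open>r\<close>, and
    regularity bounds the last ratio from below by
    \<open>len b m powr \<epsilon> / C\<close>.\<close>
  have len_ge: "r powr (1 + \<epsilon>) / C \<le> len b (st b)" if "b \<in> G" for b
  proof -
    have "0 < st b" using st_pos[OF that] .
    then obtain m where m: "st b = Suc m" by (cases "st b") auto
    have rm: "r < len b m" using st_less[of m b] m by simp
    have Np: "0 < N (\<omega> m) (b m)"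
      using N_pos[OF omega_in] G_idx[OF that] by (simp add: index_seqs_def)
    have "len b m powr \<epsilon> * N (\<omega> m) (b m) \<le> C"
      using that by (simp add: G_def regular_seqs_def)
    then have "len b m powr \<epsilon> / C \<le> inverse (N (\<omega> m) (b m))"
      using Np C by (simp add: field_simps)
    then have "len b m * (len b m powr \<epsilon> / C) \<le> len b (st b)"
      unfolding m len_Suc using rm r by (intro mult_left_mono) auto
    moreover have "r powr (1 + \<epsilon>) / C \<le> len b m * (len b m powr \<epsilon> / C)"
    proof -
      have "r powr (1 + \<epsilon>) \<le> len b m powr (1 + \<epsilon>)"
        using rm r t by (intro powr_mono2) auto
      also have "\<dots> = len b m * len b m powr \<epsilon>"
        using rm r by (simp add: powr_add)
      finally show ?thesis using C by (simp add: divide_right_mono)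
    qed
    ultimately show ?thesis by linarith
  qed
  \<comment> \<open>The cutting level depends only on the prefix read so far, so no cut word is a
    proper prefix of another.\<close>
  have w_eq: "w b = w b'" if "b \<in> G" "b' \<in> G" "st b \<le> st b'" "\<forall>k<st b. b k = b' k" for b b'
  proof -
    have "len b' (st b) = len b (st b)" using that(4) by (intro len_cong) simp
    then have "len b' (st b) \<le> r" using st_le[OF that(1)] by simp
    then have "\<not> st b < st b'" using st_less[of "st b" b'] by auto
    then have "st b = st b'" using that(3) by simp
    then show ?thesis using that(4) by (simp add: w_def)
  qed
  have disj: "comp_maps f \<omega> b (st b) ` {0<..<1} \<inter> comp_maps f \<omega> b' (st b') ` {0<..<1} = {}"
    if "b \<in> G" "b' \<in> G" "w b \<noteq> w b'" for b b'
  proof -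
    have "\<exists>k. k < st b \<and> k < st b' \<and> b k \<noteq> b' k"
    proof (cases "st b \<le> st b'")
      case True
      then show ?thesis using w_eq[OF that(1,2) True] that(3) by fastforce
    next
      case False
      then show ?thesis using w_eq[OF that(2,1)] that(3) by fastforce
    qed
    then show ?thesis using open_cyl_disjoint[OF adm[OF that(1)] adm[OF that(2)]] by blast
  qed
  define rep where "rep u = (SOME b. b \<in> G \<and> w b = u)" for u
  have rep: "rep u \<in> G \<and> w (rep u) = u" if "u \<in> w ` G" for u
    unfolding rep_def using that by (intro someI_ex[of "\<lambda>b. b \<in> G \<and> w b = u"]) auto
  \<comment> \<open>Each cut interval has length at most \<open>r\<close> and contains a point of
    \<open>U\<close>, which is within \<open>r\<close> of \<open>x0\<close>. So the disjoint open
    intervals all fit into an interval of length \<open>4 * r\<close>, and their lengths are bounded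
    below by \<open>len_ge\<close>.\<close>
  have card_le: "real (card W) * (r powr (1 + \<epsilon>) / C) \<le> 4 * r" if W: "finite W" "W \<subseteq> w ` G" for W
  proof (cases "W = {}")
    case True then show ?thesis using r by simp
  next
    case False
    then obtain b0 where b0: "b0 \<in> G" using W by blast
    define x0 where "x0 = coding f \<omega> b0"
    have x0: "x0 \<in> U" using b0 by (simp add: x0_def G_def)
    define Op where "Op u = comp_maps f \<omega> (rep u) (st (rep u)) ` {0<..<1}" for u
    have Op: "Op u \<subseteq> {x0 - 2 * r..x0 + 2 * r} \<and> Op u \<in> sets lborel \<and>
        emeasure lborel (Op u) = ennreal (len (rep u) (st (rep u)))" if "u \<in> W" for u
    proof -
      have g: "rep u \<in> G" using rep that W by blast
      obtain a where a: "cyl (rep u) (st (rep u)) = {a..a + len (rep u) (st (rep u))}"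
        "Op u = {a<..<a + len (rep u) (st (rep u))}"
        unfolding Op_def using cyl_interval[OF adm[OF g]] by metis
      have c: "coding f \<omega> (rep u) \<in> {a..a + len (rep u) (st (rep u))}"
        using coding_in_cyl[OF G_idx[OF g], of "st (rep u)"] a(1) by simp
      have "coding f \<omega> (rep u) \<in> U" using g by (simp add: G_def)
      then have "dist x0 (coding f \<omega> (rep u)) \<le> r"
        using diameter_bounded_bound[OF U(1) x0] U(2) by fastforce
      then show ?thesis
        using a(2) c st_le[OF g] len_pos[OF adm[OF g], of "st (rep u)"] by (auto simp: dist_real_def)
    qed
    have "ennreal (real (card W) * (r powr (1 + \<epsilon>) / C)) = ennreal (\<Sum>u\<in>W. r powr (1 + \<epsilon>) / C)"
      by simp
    also have "\<dots> \<le> ennreal (\<Sum>u\<in>W. len (rep u) (st (rep u)))"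
      using len_ge rep W by (intro ennreal_leI sum_mono) blast
    also have "\<dots> = (\<Sum>u\<in>W. ennreal (len (rep u) (st (rep u))))"
      using rep W len_pos[OF adm] by (intro sum_ennreal[symmetric]) (meson less_imp_le subsetD)
    also have "\<dots> = (\<Sum>u\<in>W. emeasure lborel (Op u))"
      using Op by (intro sum.cong) auto
    also have "\<dots> = emeasure lborel (\<Union>u\<in>W. Op u)"
    proof (rule sum_emeasure)
      show "disjoint_family_on Op W"
        unfolding disjoint_family_on_def Op_def using disj rep W by (metis subsetD)
    qed (use Op W in auto)
    also have "\<dots> \<le> emeasure lborel {x0 - 2 * r..x0 + 2 * r}"
      using Op by (intro emeasure_mono) auto
    also have "\<dots> = ennreal (4 * r)" using r by simp
    finally show ?thesis using r by (simp add: ennreal_le_iff)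
  qed
  have card_le': "real (card W) \<le> 4 * C * r powr (- \<epsilon>)" if W: "finite W" "W \<subseteq> w ` G" for W
  proof -
    have "real (card W) * r powr (1 + \<epsilon>) \<le> 4 * r * C"
      using card_le[OF W] C by (simp add: field_simps)
    then have "real (card W) * r powr (1 + \<epsilon>) * r powr (- (1 + \<epsilon>)) \<le> 4 * r * C * r powr (- (1 + \<epsilon>))"
      by (intro mult_right_mono) auto
    then have "real (card W) * (r powr (1 + \<epsilon>) * r powr (- (1 + \<epsilon>))) \<le> 4 * C * (r * r powr (- (1 + \<epsilon>)))"
      by (simp only: mult_ac)
    moreover have "r powr (1 + \<epsilon>) * r powr (- (1 + \<epsilon>)) = 1"
      using r by (simp flip: powr_add)
    moreover have "r * r powr (- (1 + \<epsilon>)) = r powr (- \<epsilon>)"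
      using r by (simp add: powr_mult_base)
    ultimately show ?thesis by simp
  qed
  \<comment> \<open>The bound \<open>card_le'\<close> is the same for all finite subsets, so an
    infinite set would contain a finite one that is too large.\<close>
  have fin: "finite (w ` G)"
  proof (rule ccontr)
    assume "infinite (w ` G)"
    then obtain W where W: "W \<subseteq> w ` G" "finite W" "card W = nat \<lceil>4 * C * r powr (- \<epsilon>)\<rceil> + 1"
      using infinite_arbitrarily_large by blast
    show False using card_le'[OF W(2,1)] W(3) by linarith
  qed
  define Z where "Z u = {c. \<forall>k<length u. c k = u ! k}" for u :: "nat list"
  have sZ: "Z u \<in> sets (product_law p)" for u
    unfolding Z_def by (rule sets_word_cylinder)
  have "G \<subseteq> (\<Union>u\<in>w ` G. Z u)" by (auto simp: Z_def w_def)
  moreover have "emeasure (product_law p) (\<Union>u\<in>w ` G. Z u) \<le> ennreal (4 * C\<^sup>2 * r powr (t - \<epsilon>))"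
  proof -
    have "emeasure (product_law p) (\<Union>u\<in>w ` G. Z u) \<le> (\<Sum>u\<in>w ` G. emeasure (product_law p) (Z u))"
      using fin sZ by (intro emeasure_subadditive_finite) auto
    also have "\<dots> \<le> (\<Sum>u\<in>w ` G. ennreal (C * r powr t))"
    proof (intro sum_mono)
      fix u assume "u \<in> w ` G"
      then obtain b where b: "b \<in> G" "u = w b" by blast
      have "emeasure (product_law p) (Z u) = ennreal (cyl_mass p b (st b))"
        unfolding Z_def emeasure_word_cylinder using b(2)
        by (intro arg_cong[of _ _ ennreal]) (auto simp: w_def cyl_mass_def)
      also have "cyl_mass p b (st b) \<le> C * len b (st b) powr t"
        using b by (simp add: G_def regular_seqs_def)
      also have "\<dots> \<le> C * r powr t"
        using C t st_le[OF b(1)] len_pos[OF adm[OF b(1)], of "st b"]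
        by (intro mult_left_mono powr_mono2) auto
      finally show "emeasure (product_law p) (Z u) \<le> ennreal (C * r powr t)"
        by (simp add: ennreal_leI)
    qed
    also have "\<dots> = ennreal (real (card (w ` G)) * (C * r powr t))"
      using C by (simp add: ennreal_mult ennreal_of_nat_eq_real_of_nat)
    also have "\<dots> \<le> ennreal ((4 * C * r powr (- \<epsilon>)) * (C * r powr t))"
      using C card_le'[OF fin] by (intro ennreal_leI mult_right_mono) auto
    also have "(4 * C * r powr (- \<epsilon>)) * (C * r powr t) = 4 * C\<^sup>2 * r powr (t - \<epsilon>)"
      by (simp add: power2_eq_square powr_diff powr_minus field_simps)
    finally show ?thesis .
  qed
  moreover have "(\<Union>u\<in>w ` G. Z u) \<in> sets (product_law p)"
    by (intro sets.finite_UN fin sZ)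
  ultimately show ?thesis unfolding G_def by blast
qed

text \<open>For positive diameter below 1 the larger exponent \<open>t - \<epsilon>\<close> gives
  the smaller power. Sets of diameter 0 may have \<open>diam_pow\<close> equal to 0, so they must be
  shown to carry no mass, by letting \<open>r\<close> tend to 0 in
  \<open>regular_cover\<close>.\<close>

lemma regular_cover_diam_pow:
  assumes supp: "\<And>k. set_pmf (p k) \<subseteq> B (\<omega> k)" and C: "0 < C" and t: "0 < t" "0 < \<epsilon>"
    and U: "bounded U" "diameter U < 1" and \<tau>: "0 \<le> \<tau>" "\<tau> < t - \<epsilon>"
  shows "\<exists>V\<in>sets (product_law p). {b \<in> regular_seqs p t \<epsilon> C. coding f \<omega> b \<in> U} \<subseteq> V \<and>
    emeasure (product_law p) V \<le> ennreal (4 * C\<^sup>2) * diam_pow \<tau> U"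
proof -
  consider "U = {}" | "U \<noteq> {}" "diameter U > 0" | "diameter U = 0"
    using diameter_ge_0[OF U(1)] by linarith
  then show ?thesis
  proof cases
    case 1
    then show ?thesis by (intro bexI[of _ "{}"]) auto
  next
    case 2
    obtain V where V: "V \<in> sets (product_law p)" "{b \<in> regular_seqs p t \<epsilon> C. coding f \<omega> b \<in> U} \<subseteq> V"
      "emeasure (product_law p) V \<le> ennreal (4 * C\<^sup>2 * diameter U powr (t - \<epsilon>))"
      using regular_cover[OF supp C t U(1) order_refl 2(2) U(2)] by blast
    have "diameter U powr (t - \<epsilon>) \<le> diameter U powr \<tau>"
      using 2 U \<tau> by (intro powr_mono') auto
    moreover have "diam_pow \<tau> U = ennreal (diameter U powr \<tau>)"
      using 2 by (simp add: diam_pow_def)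
    ultimately have "ennreal (4 * C\<^sup>2 * diameter U powr (t - \<epsilon>)) \<le> ennreal (4 * C\<^sup>2) * diam_pow \<tau> U"
      by (simp flip: ennreal_mult add: ennreal_leI mult_left_mono)
    then show ?thesis using V order_trans by blast
  next
    case 3
    \<comment> \<open>The radius must lie strictly between 0 and 1, hence
      \<open>j + 2\<close>.\<close>
    have "\<forall>j. \<exists>V\<in>sets (product_law p). {b \<in> regular_seqs p t \<epsilon> C. coding f \<omega> b \<in> U} \<subseteq> V \<and>
      emeasure (product_law p) V \<le> ennreal (4 * C\<^sup>2 * (1 / real (j + 2)) powr (t - \<epsilon>))"
      using 3 by (intro allI regular_cover[OF supp C t U(1)]) auto
    from choice[OF this[unfolded Bex_def]] obtain V where V: "\<And>j. V j \<in> sets (product_law p)"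
      "\<And>j. {b \<in> regular_seqs p t \<epsilon> C. coding f \<omega> b \<in> U} \<subseteq> V j"
      "\<And>j. emeasure (product_law p) (V j) \<le> ennreal (4 * C\<^sup>2 * (1 / real (j + 2)) powr (t - \<epsilon>))"
      by blast
    have "emeasure (product_law p) (\<Inter>j. V j) \<le> ennreal 0"
    proof (rule LIMSEQ_le_const)
      have "(\<lambda>j. inverse (real (Suc (Suc j)))) \<longlonglongrightarrow> 0"
        using LIMSEQ_inverse_real_of_nat by (rule LIMSEQ_Suc)
      then have "(\<lambda>j. 1 / real (j + 2)) \<longlonglongrightarrow> 0"
        by (simp add: inverse_eq_divide add.commute)
      then have "(\<lambda>j. 4 * C\<^sup>2 * (1 / real (j + 2)) powr (t - \<epsilon>)) \<longlonglongrightarrow> 4 * C\<^sup>2 * (0 powr (t - \<epsilon>))"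
        using \<tau> by (intro tendsto_intros tendsto_powr') auto
      then show "(\<lambda>j. ennreal (4 * C\<^sup>2 * (1 / real (j + 2)) powr (t - \<epsilon>))) \<longlonglongrightarrow> ennreal 0"
        by (intro tendsto_ennrealI) simp
      have "emeasure (product_law p) (\<Inter>j. V j) \<le> ennreal (4 * C\<^sup>2 * (1 / real (j + 2)) powr (t - \<epsilon>))" for j
        using V(3)[of j] emeasure_mono[of "\<Inter>j. V j" "V j" "product_law p"] V(1)
        by (meson INT_lower UNIV_I order_trans)
      then show "\<exists>M. \<forall>j\<ge>M. emeasure (product_law p) (\<Inter>j. V j) \<le> ennreal (4 * C\<^sup>2 * (1 / real (j + 2)) powr (t - \<epsilon>))"
        by blast
    qed
    then have "emeasure (product_law p) (\<Inter>j. V j) \<le> ennreal (4 * C\<^sup>2) * diam_pow \<tau> U"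
      by simp
    moreover have "(\<Inter>j. V j) \<in> sets (product_law p)"
      using V(1) by (intro sets.countable_INT) auto
    ultimately show ?thesis using V(2) by (intro bexI[of _ "\<Inter>j. V j"]) auto
  qed
qed

text \<open>If the measure at an exponent \<open>\<tau> < t - \<epsilon>\<close> vanished, a cover
  with a tiny sum would give measurable sets of small total mass containing almost all of a regular
  set of positive mass. The covers are pulled back to sequences, so no measure on the line is formed
  and measurability of \<open>coding\<close> is not an issue.\<close>

theorem mass_distribution:
  assumes supp: "\<And>k. set_pmf (p k) \<subseteq> B (\<omega> k)" and t: "0 < t" "0 < \<epsilon>"
    and AE: "AE b in product_law p. coding f \<omega> b \<in> F \<and>
       (\<forall>\<^sub>F n in sequentially. cyl_mass p b n \<le> len b n powr t \<and> len b n powr \<epsilon> * N (\<omega> n) (b n) \<le> 1)"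
  shows "ereal (t - \<epsilon>) \<le> hausdorff_dim F"
  unfolding hausdorff_dim_def
proof (rule INF_greatest)
  fix \<tau> assume "\<tau> \<in> {\<tau>. 0 \<le> \<tau> \<and> hausdorff_measure \<tau> F = 0}"
  then have \<tau>: "0 \<le> \<tau>" and H: "hausdorff_measure \<tau> F = 0" by auto
  show "ereal (t - \<epsilon>) \<le> ereal \<tau>"
  proof (rule ccontr)
    assume "\<not> ereal (t - \<epsilon>) \<le> ereal \<tau>"
    then have \<tau>t: "\<tau> < t - \<epsilon>" by simp
    interpret prob_space "product_law p" by (rule prob_space_product_law)
    have AE1: "AE b in product_law p. \<exists>c::nat. b \<in> regular_seqs p t \<epsilon> (real c + 1)"
      using AE AE_in_support
    proof eventually_elim
      case (elim b)
      then have b: "b \<in> index_seqs B \<omega>" using supp by (auto simp: index_seqs_def)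
      note pos = len_pos[OF index_seqs_admissible[OF b]]
      obtain n0 where n0: "\<And>n. n \<ge> n0 \<Longrightarrow> cyl_mass p b n \<le> len b n powr t \<and> len b n powr \<epsilon> * N (\<omega> n) (b n) \<le> 1"
        using elim by (auto simp: eventually_sequentially)
      \<comment> \<open>Both ratios are nonnegative, so their sum over the finitely many exceptional
        levels bounds each of them; the \<open>+ 1\<close> in \<open>real c + 1\<close> serves the
        remaining levels.\<close>
      define x where "x n = cyl_mass p b n / len b n powr t + len b n powr \<epsilon> * N (\<omega> n) (b n)" for n
      have x1: "0 \<le> cyl_mass p b n / len b n powr t" "0 \<le> len b n powr \<epsilon> * N (\<omega> n) (b n)" for n
        using N_pos[OF omega_in, of "b n" n] b
        by (auto simp: cyl_mass_def index_seqs_def intro!: prod_nonneg mult_nonneg_nonneg divide_nonneg_nonneg)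
      then have x0: "0 \<le> x n" for n by (simp add: x_def)
      obtain c :: nat where c: "(\<Sum>n<n0. x n) \<le> real c" using real_arch_simple by blast
      have "cyl_mass p b n \<le> (real c + 1) * len b n powr t \<and> len b n powr \<epsilon> * N (\<omega> n) (b n) \<le> real c + 1" for n
      proof (cases "n < n0")
        case True
        then have "x n \<le> (\<Sum>n<n0. x n)" using x0 by (intro member_le_sum) auto
        then have "x n \<le> real c + 1" using c by simp
        then have "cyl_mass p b n / len b n powr t \<le> real c + 1" "len b n powr \<epsilon> * N (\<omega> n) (b n) \<le> real c + 1"
          using x1[of n] by (auto simp: x_def)
        then show ?thesis using pos[of n] by (simp add: divide_le_eq)
      next
        case False
        then have "cyl_mass p b n \<le> 1 * len b n powr t" "len b n powr \<epsilon> * N (\<omega> n) (b n) \<le> 1" using n0[of n] by auto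
        moreover have "1 * len b n powr t \<le> (real c + 1) * len b n powr t"
          by (intro mult_right_mono) auto
        ultimately show ?thesis by linarith
      qed
      then show ?case using elim by (auto simp: regular_seqs_def)
    qed
    \<comment> \<open>Countably many null sets cannot cover almost every sequence.\<close>
    have "\<exists>c::nat. emeasure (product_law p) (regular_seqs p t \<epsilon> (real c + 1)) \<noteq> 0"
    proof (rule ccontr)
      assume "\<not> ?thesis"
      then have "AE b in product_law p. b \<notin> regular_seqs p t \<epsilon> (real c + 1)" for c :: nat
        using sets_regular_seqs by (intro AE_not_in) (simp add: null_sets_def)
      then have "AE b in product_law p. \<forall>c::nat. b \<notin> regular_seqs p t \<epsilon> (real c + 1)"
        by (simp add: AE_all_countable)
      with AE1 have "AE b in product_law p. False" by eventually_elim auto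
      then show False by simp
    qed
    then obtain c :: nat where c: "emeasure (product_law p) (regular_seqs p t \<epsilon> (real c + 1)) \<noteq> 0" by blast
    define C where "C = real c + 1"
    have C: "0 < C" by (simp add: C_def)
    define K where "K = 4 * C\<^sup>2"
    have K: "0 < K" using C by (simp add: K_def)
    define m where "m = measure (product_law p) (regular_seqs p t \<epsilon> C)"
    have m: "emeasure (product_law p) (regular_seqs p t \<epsilon> C) = ennreal m"
      by (simp add: m_def emeasure_eq_measure)
    have m_pos: "0 < m" using c m C_def by (metis ennreal_0 measure_nonneg m_def order_le_less)
    \<comment> \<open>The single scale \<open>1/2\<close> is enough: the cover lemma only requires
      diameters below 1.\<close>
    have "(INF U\<in>delta_covers (1/2) F. \<Sum>i. diam_pow \<tau> (U i)) \<le> hausdorff_measure \<tau> F"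
      unfolding hausdorff_measure_def by (intro SUP_upper) auto
    also have "\<dots> < ennreal (m / K)" using H m_pos K by simp
    finally obtain U where U: "U \<in> delta_covers (1/2) F" "(\<Sum>i. diam_pow \<tau> (U i)) < ennreal (m / K)"
      by (auto simp: INF_less_iff)
    have Ub: "bounded (U i)" "diameter (U i) < 1" for i
      using U(1) unfolding delta_covers_def by (auto intro: le_less_trans[of _ "1/2"])
    have "\<forall>i. \<exists>V\<in>sets (product_law p). {b \<in> regular_seqs p t \<epsilon> C. coding f \<omega> b \<in> U i} \<subseteq> V \<and>
      emeasure (product_law p) V \<le> ennreal K * diam_pow \<tau> (U i)"
      unfolding K_def by (intro allI regular_cover_diam_pow supp C t Ub \<tau> \<tau>t)
    from choice[OF this[unfolded Bex_def]] obtain V where V: "\<And>i. V i \<in> sets (product_law p)"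
      "\<And>i. {b \<in> regular_seqs p t \<epsilon> C. coding f \<omega> b \<in> U i} \<subseteq> V i"
      "\<And>i. emeasure (product_law p) (V i) \<le> ennreal K * diam_pow \<tau> (U i)"
      by blast
    have "ennreal m \<le> emeasure (product_law p) (\<Union>i. V i)"
      unfolding m[symmetric]
    proof (rule emeasure_mono_AE)
      show "AE b in product_law p. b \<in> regular_seqs p t \<epsilon> C \<longrightarrow> b \<in> (\<Union>i. V i)"
        using AE
      proof eventually_elim
        case (elim b)
        then have "coding f \<omega> b \<in> (\<Union>i. U i)" using U(1) unfolding delta_covers_def by blast
        then show ?case using V(2) by fastforce
      qed
    qed (use V(1) in auto)
    also have "\<dots> \<le> (\<Sum>i. emeasure (product_law p) (V i))"
      using V(1) by (intro emeasure_subadditive_countably) auto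
    also have "\<dots> \<le> (\<Sum>i. ennreal K * diam_pow \<tau> (U i))"
      using V(3) by (intro suminf_le) auto
    also have "\<dots> = ennreal K * (\<Sum>i. diam_pow \<tau> (U i))"
      by simp
    also have "\<dots> < ennreal K * ennreal (m / K)"
      using U(2) K by (intro ennreal_mult_strict_left_mono) auto
    also have "\<dots> = ennreal m"
      using K m_pos by (simp flip: ennreal_mult)
    finally show False by simp
  qed
qed

end

section \<open>Digit frequencies\<close>

text \<open>Diagonal argument: \<open>\<theta> k\<close> is the largest \<open>j\<close> whose
  property has set in by time \<open>k\<close>. Taking \<open>h j\<close> at least \<open>j\<close>
  makes the maximum range over a finite set, and the inserted 0 keeps that set nonempty for small
  \<open>k\<close>.\<close>

lemma slow_diagonal:
  fixes P :: "nat \<Rightarrow> nat \<Rightarrow> bool"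
  assumes "\<And>j. eventually (P j) sequentially"
  obtains \<theta> where "mono \<theta>" "filterlim \<theta> at_top sequentially" "\<forall>\<^sub>F k in sequentially. P (\<theta> k) k"
proof -
  have "\<forall>j. \<exists>n. \<forall>k\<ge>n. P j k"
    using assms by (simp add: eventually_sequentially)
  then obtain n where n: "\<And>j k. n j \<le> k \<Longrightarrow> P j k" by metis
  define h where "h j = max j (n j)" for j
  define \<theta> where "\<theta> k = Max (insert 0 {j. h j \<le> k})" for k
  have fin: "finite (insert 0 {j. h j \<le> k})" for k
    by (rule finite_subset[of _ "{..k}"]) (auto simp: h_def)
  show thesis
  proof (rule that)
    show "mono \<theta>"
      unfolding mono_def \<theta>_def using fin by (intro allI impI Max_mono) auto
    show "filterlim \<theta> at_top sequentially"
      unfolding filterlim_at_top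
    proof
      fix j
      have "j \<le> \<theta> k" if "h j \<le> k" for k
        unfolding \<theta>_def using fin that by (intro Max_ge) auto
      then show "\<forall>\<^sub>F k in sequentially. j \<le> \<theta> k"
        unfolding eventually_sequentially by blast
    qed
    show "\<forall>\<^sub>F k in sequentially. P (\<theta> k) k"
      unfolding eventually_sequentially
    proof (intro exI allI impI)
      fix k assume k: "h 0 \<le> k"
      have "\<theta> k \<in> insert 0 {j. h j \<le> k}" unfolding \<theta>_def using fin by (intro Max_in) auto
      then have "h (\<theta> k) \<le> k" using k by auto
      then show "P (\<theta> k) k" by (intro n) (simp add: h_def)
    qed
  qed
qed

lemma sum_if_eq_card:
  fixes n :: nat
  shows "(\<Sum>k<n. if P k then c else 0 :: real) = c * real (card {k. k < n \<and> P k})"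
proof -
  have "{k. k < n \<and> P k} = {..<n} \<inter> {k. P k}" by auto
  then show ?thesis by (subst sum.If_cases) (simp_all add: mult.commute)
qed

locale gls_freq = gls_fibre S B f \<omega>
  for S :: "'s set" and B :: "'s \<Rightarrow> nat set" and f :: "'s \<Rightarrow> nat \<Rightarrow> real \<Rightarrow> real" and \<omega> :: "nat \<Rightarrow> 's" +
  fixes \<alpha> :: "'s \<times> nat \<Rightarrow> real"
  assumes frequency_vector: "frequency_vector S B \<alpha>"
    and positive_marginals: "s \<in> S \<Longrightarrow> \<exists>b\<in>B s. 0 < \<alpha> (s, b)"
begin

abbreviation D :: "('s \<times> nat) set" where "D \<equiv> digits S B"
abbreviation Dm :: "nat \<Rightarrow> ('s \<times> nat) set" where "Dm \<equiv> digits_upto S B"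
abbreviation E :: "(nat \<Rightarrow> nat) set" where "E \<equiv> freq_seqs S B \<omega> \<alpha>"
abbreviation lnN :: "'s \<times> nat \<Rightarrow> real" where "lnN d \<equiv> ln (N (fst d) (snd d))"
abbreviation dig :: "(nat \<Rightarrow> nat) \<Rightarrow> nat \<Rightarrow> 's \<times> nat" where "dig b k \<equiv> (\<omega> k, b k)"

lemma Dm_def': "Dm m = Sigma S (\<lambda>s. B s \<inter> {..m})"
  by (auto simp: digits_upto_def digits_def)

lemma finite_Dm: "finite (Dm m)"
  unfolding Dm_def' using finite_S by auto

lemma Dm_subset: "Dm m \<subseteq> D"
  by (auto simp: digits_upto_def)

lemma Dm_mono: "m \<le> n \<Longrightarrow> Dm m \<subseteq> Dm n"
  by (auto simp: digits_upto_def)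

lemma dig_in_Dm: "b \<in> index_seqs B \<omega> \<Longrightarrow> dig b k \<in> Dm m \<longleftrightarrow> b k \<le> m"
  using omega_in by (auto simp: digits_upto_def digits_def index_seqs_def)

lemma \<alpha>_nonneg: "d \<in> D \<Longrightarrow> 0 \<le> \<alpha> d"
  using frequency_vector by (simp add: frequency_vector_def)

lemma \<alpha>_has_sum: "(\<alpha> has_sum 1) D"
  using frequency_vector by (simp add: frequency_vector_def)

lemma lnN_pos: "d \<in> D \<Longrightarrow> 0 < lnN d"
  using ln_N_pos by (auto simp: digits_def)

lemma filterlim_Dm: "filterlim Dm (finite_subsets_at_top D) sequentially"
proof (rule filterlim_finite_subsets_at_top[THEN iffD2, rule_format])
  fix X assume X: "finite X \<and> X \<subseteq> D"
  define m where "m = Max (insert 0 (snd ` X))"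
  have "X \<subseteq> Dm n" if "m \<le> n" for n
  proof
    fix d assume d: "d \<in> X"
    then have "snd d \<le> m" unfolding m_def using X by (intro Max_ge) auto
    then show "d \<in> Dm n" using d X that by (cases d) (auto simp: digits_upto_def)
  qed
  then show "\<forall>\<^sub>F n in sequentially. finite (Dm n) \<and> X \<subseteq> Dm n \<and> Dm n \<subseteq> D"
    using finite_Dm Dm_subset by (auto simp: eventually_sequentially)
qed

lemma sum_Dm_tendsto: "(g has_sum x) D \<Longrightarrow> (\<lambda>m. \<Sum>d\<in>Dm m. g d) \<longlonglongrightarrow> x"
  unfolding has_sum_def by (rule filterlim_compose[OF _ filterlim_Dm])

lemma sum_\<alpha>_le_1: "G \<subseteq> D \<Longrightarrow> finite G \<Longrightarrow> sum \<alpha> G \<le> 1"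
  by (rule has_sum_mono2[OF has_sum_finite \<alpha>_has_sum]) (auto intro: \<alpha>_nonneg)

section \<open>Averages along sequences with prescribed frequencies\<close>

lemma E_index: "b \<in> E \<Longrightarrow> b \<in> index_seqs B \<omega>"
  by (simp add: freq_seqs_def)

text \<open>Convergence of each digit frequency separately does not control averages over infinitely
  many digits. For \<open>X\<close> constant off a finite set it does, since \<open>X - K\<close>
  then involves finitely many digits only. All later averages are brought to this form.\<close>

lemma digit_average_tendsto:
  assumes b: "b \<in> E" and G: "finite G" "G \<subseteq> D" and X: "\<And>d. d \<in> D \<Longrightarrow> d \<notin> G \<Longrightarrow> X d = K"
  shows "(\<lambda>n. (\<Sum>k<n. X (dig b k)) / real n) \<longlonglongrightarrow> (\<Sum>d\<in>G. \<alpha> d * X d) + K * (1 - sum \<alpha> G)"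
proof -
  have inD: "dig b k \<in> D" for k
    using E_index[OF b] omega_in by (auto simp: digits_def index_seqs_def)
  have eq: "(\<Sum>k<n. X (dig b k)) = (\<Sum>d\<in>G. (X d - K) * real (card {k. k < n \<and> dig b k = d})) + K * real n" for n
  proof -
    have "(\<Sum>k<n. X (dig b k)) = (\<Sum>k<n. (\<Sum>d\<in>G. if dig b k = d then X d - K else 0) + K)"
      using X inD G by (intro sum.cong) (auto simp: sum.delta')
    also have "\<dots> = (\<Sum>d\<in>G. \<Sum>k<n. if dig b k = d then X d - K else 0) + K * real n"
      by (simp add: sum.distrib mult.commute) (rule sum.swap)
    finally show ?thesis by (simp only: sum_if_eq_card)
  qed
  have "(\<lambda>n. (\<Sum>d\<in>G. (X d - K) * (real (card {k. k < n \<and> dig b k = d}) / real n)) + K) \<longlonglongrightarrow>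
      (\<Sum>d\<in>G. (X d - K) * \<alpha> d) + K"
    using b G by (intro tendsto_intros) (auto simp: freq_seqs_def)
  also have "(\<Sum>d\<in>G. (X d - K) * \<alpha> d) + K = (\<Sum>d\<in>G. \<alpha> d * X d) + K * (1 - sum \<alpha> G)"
    by (simp add: algebra_simps sum_subtractf sum_distrib_left)
  finally show ?thesis
  proof (rule Lim_transform_eventually)
    show "\<forall>\<^sub>F n in sequentially. (\<Sum>d\<in>G. (X d - K) * (real (card {k. k < n \<and> dig b k = d}) / real n)) + K
        = (\<Sum>k<n. X (dig b k)) / real n"
      using eventually_gt_at_top[of 0]
      by eventually_elim (unfold eq, simp add: add_divide_distrib sum_divide_distrib)
  qed
qed

lemma outside_density:
  assumes b: "b \<in> E" and G: "finite G" "G \<subseteq> D"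
  shows "(\<lambda>n. real (card {k. k < n \<and> dig b k \<notin> G}) / real n) \<longlonglongrightarrow> 1 - sum \<alpha> G"
  using digit_average_tendsto[OF assms, of "\<lambda>d. if d \<notin> G then 1 else 0" 1]
  by (simp add: sum_if_eq_card)

text \<open>Since \<open>\<alpha>\<close> has total mass 1, digits outside \<open>Dm m\<close> have
  small density for large \<open>m\<close>, and from some position on \<open>\<theta>\<close> is at
  least \<open>m\<close>.\<close>

lemma large_digits_density_0:
  assumes b: "b \<in> E" and \<theta>: "filterlim \<theta> at_top sequentially"
  shows "(\<lambda>n. real (card {k. k < n \<and> b k > \<theta> k}) / real n) \<longlonglongrightarrow> 0"
proof (rule LIMSEQ_I)
  fix r :: real assume r: "0 < r"
  have "\<forall>\<^sub>F m in sequentially. 1 - r / 2 < sum \<alpha> (Dm m)"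
    using order_tendstoD(1)[OF sum_Dm_tendsto[OF \<alpha>_has_sum], of "1 - r / 2"] r by simp
  then obtain m where "1 - r / 2 < sum \<alpha> (Dm m)" by (auto simp: eventually_sequentially)
  then have m: "1 - sum \<alpha> (Dm m) < r / 2" by simp
  obtain k0 where k0: "\<And>k. k0 \<le> k \<Longrightarrow> m \<le> \<theta> k"
    using \<theta> by (auto simp: filterlim_at_top eventually_sequentially)
  have "\<forall>\<^sub>F n in sequentially. real (card {k. k < n \<and> dig b k \<notin> Dm m}) / real n < r / 2"
    using order_tendstoD(2)[OF outside_density[OF b finite_Dm Dm_subset] m] .
  moreover have "\<forall>\<^sub>F n in sequentially. real k0 / real n < r / 2"
    using order_tendstoD(2)[OF lim_const_over_n[of "real k0"], of "r / 2"] r by simp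
  ultimately have "\<forall>\<^sub>F n in sequentially. norm (real (card {k. k < n \<and> b k > \<theta> k}) / real n - 0) < r"
    using eventually_gt_at_top[of 0]
  proof eventually_elim
    case (elim n)
    have "{k. k < n \<and> b k > \<theta> k} \<subseteq> {..<k0} \<union> {k. k < n \<and> dig b k \<notin> Dm m}"
      using k0 dig_in_Dm[OF E_index[OF b]] by (force simp: not_le)
    then have "card {k. k < n \<and> b k > \<theta> k} \<le> card ({..<k0} \<union> {k. k < n \<and> dig b k \<notin> Dm m})"
      by (intro card_mono) auto
    also have "\<dots> \<le> k0 + card {k. k < n \<and> dig b k \<notin> Dm m}"
      using card_Un_le[of "{..<k0}" "{k. k < n \<and> dig b k \<notin> Dm m}"] by simp
    finally have "real (card {k. k < n \<and> b k > \<theta> k}) / real n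
        \<le> real k0 / real n + real (card {k. k < n \<and> dig b k \<notin> Dm m}) / real n"
      using elim by (simp add: divide_right_mono flip: add_divide_distrib of_nat_add)
    also have "\<dots> < r / 2 + r / 2" using elim by (intro add_strict_mono)
    finally show ?case by simp
  qed
  then show "\<exists>no. \<forall>n\<ge>no. norm (real (card {k. k < n \<and> b k > \<theta> k}) / real n - 0) < r"
    by (simp add: eventually_sequentially)
qed

text \<open>The count of any digit changes by at most the number of altered positions.\<close>

lemma density_0_change:
  assumes b: "b \<in> E" and b': "b' \<in> index_seqs B \<omega>"
    and d0: "(\<lambda>n. real (card {k. k < n \<and> b k \<noteq> b' k}) / real n) \<longlonglongrightarrow> 0"
  shows "b' \<in> E"
proof -
  have "(\<lambda>n. real (card {k. k < n \<and> dig b' k = d}) / real n) \<longlonglongrightarrow> \<alpha> d" if d: "d \<in> D" for d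
  proof (rule Lim_transform)
    show "(\<lambda>n. real (card {k. k < n \<and> dig b k = d}) / real n) \<longlonglongrightarrow> \<alpha> d"
      using b d by (simp add: freq_seqs_def)
    show "(\<lambda>n. real (card {k. k < n \<and> dig b' k = d}) / real n - real (card {k. k < n \<and> dig b k = d}) / real n) \<longlonglongrightarrow> 0"
    proof (rule Lim_null_comparison[OF always_eventually d0], rule allI)
      fix n
      have le: "card {k. k < n \<and> dig x k = d} \<le> card {k. k < n \<and> dig y k = d} + card {k. k < n \<and> b k \<noteq> b' k}"
        if "{x, y} = {b, b'}" for x y
      proof -
        have "{k. k < n \<and> dig x k = d} \<subseteq> {k. k < n \<and> dig y k = d} \<union> {k. k < n \<and> b k \<noteq> b' k}"
          using that by (auto simp: doubleton_eq_iff)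
        then have "card {k. k < n \<and> dig x k = d} \<le> card ({k. k < n \<and> dig y k = d} \<union> {k. k < n \<and> b k \<noteq> b' k})"
          by (intro card_mono) auto
        then show ?thesis using card_Un_le order_trans by blast
      qed
      have "\<bar>real (card {k. k < n \<and> dig b' k = d}) - real (card {k. k < n \<and> dig b k = d})\<bar>
          \<le> real (card {k. k < n \<and> b k \<noteq> b' k})"
        using le[of b b'] le[of b' b] by (auto simp: insert_commute)
      then show "norm (real (card {k. k < n \<and> dig b' k = d}) / real n - real (card {k. k < n \<and> dig b k = d}) / real n)
          \<le> real (card {k. k < n \<and> b k \<noteq> b' k}) / real n"
        by (simp add: divide_right_mono flip: diff_divide_distrib)
    qed
  qed
  then show ?thesis using b' by (simp add: freq_seqs_def)
qed

text \<open>The truncated Lyapunov exponent, which is the denominator in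
  \<open>fibre_dim\<close>.\<close>

definition lyap :: "nat \<Rightarrow> real" where "lyap m = (\<Sum>d\<in>Dm m. \<alpha> d * lnN d)"

text \<open>Replacing the digits above a slowly increasing threshold by \<open>1\<close> changes a set of positions of density
  zero, so it stays in \<open>E\<close>, and the growth of the digits and of their logarithmic averages is then
  controlled.\<close>

lemma exists_slow_seq:
  assumes b: "b \<in> E"
  obtains c where "c \<in> E" "\<forall>\<^sub>F k in sequentially. lnN (dig c k) \<le> real k powr (1 / 4)"
    "\<forall>M \<epsilon>. (\<forall>m. lyap m \<le> M) \<longrightarrow> 0 < \<epsilon> \<longrightarrow>
       (\<forall>\<^sub>F n in sequentially. (\<Sum>k<n. lnN (dig c k)) \<le> real n * (M + \<epsilon>))"
proof -
  note bi = E_index[OF b]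
  \<comment> \<open>The demands on a threshold \<open>j\<close> at time \<open>n\<close>. The
    exponent \<open>1/4\<close> makes the logarithms of the slow digits sum to order at most
    \<open>n powr (5/4)\<close>, below the order \<open>n powr (3/2)\<close> later reached on a
    sparse set of positions.\<close>
  define P where "P j n \<longleftrightarrow> (\<forall>d\<in>Dm j. lnN d \<le> real n powr (1 / 4)) \<and>
    (\<Sum>k<n. if b k \<le> j then lnN (dig b k) else 0) \<le> real n * (lyap j + 1 / (real j + 1))" for j n
  have powr_top: "filterlim (\<lambda>n. real n powr (1 / 4)) at_top sequentially"
    by (intro filterlim_compose[OF real_powr_at_top filterlim_real_sequentially]) simp
  have "eventually (P j) sequentially" for j
    unfolding P_def
  proof (rule eventually_conj)
    show "\<forall>\<^sub>F n in sequentially. \<forall>d\<in>Dm j. lnN d \<le> real n powr (1 / 4)"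
      using powr_top by (intro eventually_ball_finite finite_Dm) (simp add: filterlim_at_top)
    have "(\<lambda>n. (\<Sum>k<n. if dig b k \<in> Dm j then lnN (dig b k) else 0) / real n) \<longlonglongrightarrow>
        (\<Sum>d\<in>Dm j. \<alpha> d * (if d \<in> Dm j then lnN d else 0)) + 0 * (1 - sum \<alpha> (Dm j))"
      by (intro digit_average_tendsto b finite_Dm Dm_subset) auto
    then have "(\<lambda>n. (\<Sum>k<n. if b k \<le> j then lnN (dig b k) else 0) / real n) \<longlonglongrightarrow> lyap j"
      by (simp add: lyap_def dig_in_Dm[OF bi] cong: sum.cong)
    then have "\<forall>\<^sub>F n in sequentially. (\<Sum>k<n. if b k \<le> j then lnN (dig b k) else 0) / real n < lyap j + 1 / (real j + 1)"
      by (rule order_tendstoD) simp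
    then show "\<forall>\<^sub>F n in sequentially. (\<Sum>k<n. if b k \<le> j then lnN (dig b k) else 0) \<le> real n * (lyap j + 1 / (real j + 1))"
      using eventually_gt_at_top[of 0]
      by eventually_elim (simp add: divide_less_eq mult.commute less_imp_le)
  qed
  then obtain \<theta> where \<theta>: "mono \<theta>" "filterlim \<theta> at_top sequentially" "\<forall>\<^sub>F k in sequentially. P (\<theta> k) k"
    by (rule slow_diagonal)
  define c where "c k = (if b k \<le> \<theta> k then b k else 1)" for k
  have ci: "c \<in> index_seqs B \<omega>"
    using bi one_in_B[OF omega_in] by (auto simp: c_def index_seqs_def)
  have dens: "(\<lambda>n. real (card {k. k < n \<and> b k > \<theta> k}) / real n) \<longlonglongrightarrow> 0"
    by (rule large_digits_density_0[OF b \<theta>(2)])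
  have cE: "c \<in> E"
  proof (rule density_0_change[OF b ci])
    have le: "card {k. k < n \<and> b k \<noteq> c k} \<le> card {k. k < n \<and> b k > \<theta> k}" for n
      by (intro card_mono) (auto simp: c_def split: if_splits)
    show "(\<lambda>n. real (card {k. k < n \<and> b k \<noteq> c k}) / real n) \<longlonglongrightarrow> 0"
      by (rule Lim_null_comparison[OF always_eventually dens]) (simp add: divide_right_mono le)
  qed
  define c1 where "c1 = (\<Sum>s\<in>S. lnN (s, 1))"
  have c1: "lnN (\<omega> k, 1) \<le> c1" for k
    unfolding c1_def using finite_S omega_in one_in_B
    by (intro member_le_sum[of "\<omega> k" S "\<lambda>s. lnN (s, 1)"]) (auto intro!: less_imp_le ln_N_pos)
  have c1_pos: "0 < c1" using c1[of 0] ln_N_pos[OF omega_in one_in_B[OF omega_in], of 0] by simp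
  show thesis
  proof (rule that[OF cE])
    \<comment> \<open>From here on the replacement digit 1 is itself below the threshold.\<close>
    have "\<forall>\<^sub>F k in sequentially. 1 \<le> \<theta> k" using \<theta>(2) by (simp add: filterlim_at_top)
    then show "\<forall>\<^sub>F k in sequentially. lnN (dig c k) \<le> real k powr (1 / 4)"
      using \<theta>(3)
    proof eventually_elim
      case (elim k)
      then have "dig c k \<in> Dm (\<theta> k)" unfolding dig_in_Dm[OF ci] by (simp add: c_def)
      then show ?case using elim unfolding P_def by blast
    qed
    show "\<forall>M \<epsilon>. (\<forall>m. lyap m \<le> M) \<longrightarrow> 0 < \<epsilon> \<longrightarrow>
       (\<forall>\<^sub>F n in sequentially. (\<Sum>k<n. lnN (dig c k)) \<le> real n * (M + \<epsilon>))"
    proof (intro allI impI)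
      fix M \<epsilon> :: real assume "\<forall>m. lyap m \<le> M" and \<epsilon>: "0 < \<epsilon>"
      then have M: "\<And>m. lyap m \<le> M" by blast
      have "(\<lambda>k. 1 / (real (\<theta> k) + 1)) \<longlonglongrightarrow> 0"
      proof -
        have "(\<lambda>n. inverse (real (Suc n))) \<longlonglongrightarrow> 0" by (rule LIMSEQ_inverse_real_of_nat)
        from filterlim_compose[OF this \<theta>(2)] show ?thesis
          by (simp add: inverse_eq_divide add.commute)
      qed
      then have "\<forall>\<^sub>F k in sequentially. 1 / (real (\<theta> k) + 1) < \<epsilon> / 2"
        using \<epsilon> by (intro order_tendstoD) auto
      moreover have "\<forall>\<^sub>F n in sequentially. real (card {k. k < n \<and> b k > \<theta> k}) / real n < \<epsilon> / (2 * c1)"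
        using dens \<epsilon> c1_pos by (intro order_tendstoD) auto
      ultimately show "\<forall>\<^sub>F n in sequentially. (\<Sum>k<n. lnN (dig c k)) \<le> real n * (M + \<epsilon>)"
        using \<theta>(3) eventually_gt_at_top[of 0]
      proof eventually_elim
        case (elim n)
        \<comment> \<open>By monotonicity of \<open>\<theta>\<close>, every digit kept before
          \<open>n\<close> is at most \<open>\<theta> n\<close> and is counted by
          \<open>P (\<theta> n) n\<close>. Replaced digits cost at most \<open>c1\<close> each and
          have density zero.\<close>
        have "(\<Sum>k<n. lnN (dig c k)) \<le> (\<Sum>k<n. (if b k \<le> \<theta> n then lnN (dig b k) else 0) + (if b k > \<theta> k then c1 else 0))"
        proof (rule sum_mono)
          fix k assume "k \<in> {..<n}"
          then have "\<theta> k \<le> \<theta> n" using \<theta>(1) by (simp add: monoD)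
          moreover have "0 < lnN (dig b k)" using ln_N_pos[OF omega_in] bi by (simp add: index_seqs_def)
          ultimately show "lnN (dig c k) \<le> (if b k \<le> \<theta> n then lnN (dig b k) else 0) + (if b k > \<theta> k then c1 else 0)"
            using c1[of k] c1_pos by (auto simp: c_def)
        qed
        also have "\<dots> = (\<Sum>k<n. if b k \<le> \<theta> n then lnN (dig b k) else 0) + c1 * real (card {k. k < n \<and> b k > \<theta> k})"
          by (simp add: sum.distrib sum_if_eq_card)
        also have "\<dots> \<le> real n * (lyap (\<theta> n) + 1 / (real (\<theta> n) + 1)) + real n * (\<epsilon> / 2)"
          using elim c1_pos by (intro add_mono) (auto simp: P_def field_simps)
        also have "\<dots> \<le> real n * (M + \<epsilon> / 2) + real n * (\<epsilon> / 2)"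
          using elim M[of "\<theta> n"] by (intro add_mono mult_left_mono) auto
        also have "\<dots> = real n * (M + \<epsilon>)" by (simp add: algebra_simps)
        finally show ?case .
      qed
    qed
  qed
qed

end

section \<open>Upper bound\<close>

lemma sum_powers_le:
  fixes x :: real
  assumes x: "0 \<le> x" "x < 1" and L: "finite L" "\<And>n. n \<in> L \<Longrightarrow> n1 \<le> n"
  shows "(\<Sum>n\<in>L. x ^ n) \<le> x ^ n1 / (1 - x)"
proof -
  have inj: "inj_on (\<lambda>n. n - n1) L"
    using L(2) by (auto simp: inj_on_def) (metis le_add_diff_inverse)
  have "(\<Sum>n\<in>L. x ^ n) = (\<Sum>n\<in>L. x ^ n1 * x ^ (n - n1))"
    using L(2) by (intro sum.cong) (simp_all flip: power_add)
  also have "\<dots> = x ^ n1 * (\<Sum>j\<in>(\<lambda>n. n - n1) ` L. x ^ j)"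
    by (simp add: sum_distrib_left sum.reindex[OF inj])
  also have "\<dots> \<le> x ^ n1 * (\<Sum>j. x ^ j)"
    using x L(1) by (intro mult_left_mono sum_le_suminf summable_geometric) auto
  also have "\<dots> = x ^ n1 / (1 - x)"
    using x by (subst suminf_geometric) auto
  finally show ?thesis .
qed

context gls_freq
begin

text \<open>Enlarging \<open>W\<close> to all words with digits at most \<open>M\<close> gives a
  finite product set, over which the sum factorises into factors at most 1. The map \<open>h\<close>
  turns lists into the extensional functions that \<open>PiE\<close> consists of.\<close>

lemma sum_words_le_1:
  fixes q :: "'s \<times> nat \<Rightarrow> real"
  assumes q0: "\<And>d. d \<in> D \<Longrightarrow> 0 \<le> q d"
    and q1: "\<And>s A. s \<in> S \<Longrightarrow> finite A \<Longrightarrow> A \<subseteq> B s \<Longrightarrow> (\<Sum>b\<in>A. q (s, b)) \<le> 1"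
    and W: "finite W" "\<And>u. u \<in> W \<Longrightarrow> length u = n \<and> (\<forall>k<n. u ! k \<in> B (\<omega> k))"
  shows "(\<Sum>u\<in>W. \<Prod>k<n. q (\<omega> k, u ! k)) \<le> 1"
proof -
  define M where "M = Max (insert 0 (\<Union>u\<in>W. set u))"
  have M: "x \<le> M" if "u \<in> W" "x \<in> set u" for u x
    unfolding M_def using that W(1) by (intro Max_ge) auto
  define h where "h u = restrict ((!) u) {..<n}" for u :: "nat list"
  have inj: "inj_on h W"
  proof (rule inj_onI)
    fix u v assume uv: "u \<in> W" "v \<in> W" "h u = h v"
    show "u = v"
    proof (rule nth_equalityI)
      show "length u = length v" using uv W(2) by simp
      fix i assume "i < length u"
      then have "i < n" using uv W(2) by simp
      then show "u ! i = v ! i" using fun_cong[OF uv(3), of i] by (simp add: h_def)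
    qed
  qed
  define Q where "Q k = B (\<omega> k) \<inter> {..M}" for k
  have "(\<Sum>u\<in>W. \<Prod>k<n. q (\<omega> k, u ! k)) = (\<Sum>g\<in>h ` W. \<Prod>k<n. q (\<omega> k, g k))"
    unfolding sum.reindex[OF inj] by (simp add: h_def)
  also have "\<dots> \<le> (\<Sum>g\<in>PiE {..<n} Q. \<Prod>k<n. q (\<omega> k, g k))"
  proof (rule sum_mono2)
    show "finite (PiE {..<n} Q)" by (intro finite_PiE) (auto simp: Q_def)
    show "h ` W \<subseteq> PiE {..<n} Q"
    proof
      fix g assume "g \<in> h ` W"
      then obtain u where u: "u \<in> W" "g = h u" by blast
      show "g \<in> PiE {..<n} Q"
        unfolding u(2) h_def using W(2)[OF u(1)] M[OF u(1)] by (auto simp: Q_def)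
    qed
    show "0 \<le> (\<Prod>k<n. q (\<omega> k, g k))" if "g \<in> PiE {..<n} Q - h ` W" for g
      using that omega_in by (intro prod_nonneg ballI q0) (auto simp: digits_def Q_def)
  qed
  also have "\<dots> = (\<Prod>k<n. \<Sum>b\<in>Q k. q (\<omega> k, b))"
    by (subst prod_sum_PiE) (auto simp: Q_def)
  also have "\<dots> \<le> (\<Prod>k<n. 1)"
    using omega_in by (intro prod_mono conjI sum_nonneg q0 q1) (auto simp: digits_def Q_def)
  finally show ?thesis by simp
qed

text \<open>\<open>X\<close> compares the summand \<open>N powr -t\<close> with the sub-probability weight \<open>q\<close>: cylinders along which
  the sum of \<open>X\<close> is very negative have an exponentially small total contribution.\<close>

lemma hausdorff_measure_0:
  assumes t: "0 < t" and c: "0 < c"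
    and q0: "\<And>d. d \<in> D \<Longrightarrow> 0 \<le> q d"
    and q1: "\<And>s A. s \<in> S \<Longrightarrow> finite A \<Longrightarrow> A \<subseteq> B s \<Longrightarrow> (\<Sum>b\<in>A. q (s, b)) \<le> 1"
    and X: "\<And>d. d \<in> D \<Longrightarrow> N (fst d) (snd d) powr (- t) = q d * exp (X d)"
    and neg: "\<And>b. b \<in> E \<Longrightarrow> \<forall>\<^sub>F n in sequentially. (\<Sum>k<n. X (dig b k)) \<le> - c * real n"
  shows "hausdorff_measure t (freq_set S B f \<omega> \<alpha>) = 0"
proof -
  define x where "x = exp (- c)"
  have x: "0 \<le> x" "x < 1" using c by (auto simp: x_def)
  define J where "J u = cyl ((!) u) (length u)" for u :: "nat list"
  \<comment> \<open>Every sequence of \<open>E\<close> has a prefix in \<open>good n1\<close>. Words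
    are lists, a countable type, so the cover can be enumerated by \<open>to_nat\<close>.\<close>
  define good where "good n1 = {u. n1 \<le> length u \<and> (\<forall>k<length u. u ! k \<in> B (\<omega> k)) \<and>
    (\<Sum>k<length u. X (\<omega> k, u ! k)) \<le> - c * real (length u)}" for n1
  have adm: "admissible_upto ((!) u) (length u)" if "u \<in> good n1" for u n1
    using that by (auto simp: good_def admissible_upto_def)
  have J: "bounded (J u)" "diameter (J u) = len ((!) u) (length u)" "J u \<noteq> {}" if u: "u \<in> good n1" for u n1
  proof -
    obtain a where "J u = {a..a + len ((!) u) (length u)}"
      unfolding J_def using cyl_interval[OF adm[OF u]] by metis
    then show "bounded (J u)" "diameter (J u) = len ((!) u) (length u)" "J u \<noteq> {}"
      using len_pos[OF adm[OF u]] by auto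
  qed
  have len_t: "len ((!) u) (length u) powr t \<le> (\<Prod>k<length u. q (\<omega> k, u ! k)) * x ^ length u"
    if u: "u \<in> good n1" for u n1
  proof -
    have uD: "(\<omega> k, u ! k) \<in> D" if "k < length u" for k
      using u that omega_in by (auto simp: good_def digits_def)
    have "len ((!) u) (length u) powr t = (\<Prod>k<length u. N (\<omega> k) (u ! k) powr (- t))"
      unfolding len_def using uD N_pos
      by (subst prod_powr_distrib) (auto simp: digits_def powr_minus inverse_powr intro!: prod.cong less_imp_le)
    also have "\<dots> = (\<Prod>k<length u. q (\<omega> k, u ! k) * exp (X (\<omega> k, u ! k)))"
      using X[OF uD] by (intro prod.cong) auto
    also have "\<dots> = (\<Prod>k<length u. q (\<omega> k, u ! k)) * exp (\<Sum>k<length u. X (\<omega> k, u ! k))"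
      by (simp add: prod.distrib exp_sum)
    also have "\<dots> \<le> (\<Prod>k<length u. q (\<omega> k, u ! k)) * exp (- c * real (length u))"
      using u q0[OF uD] by (intro mult_left_mono prod_nonneg) (auto simp: good_def)
    also have "exp (- c * real (length u)) = x ^ length u"
      by (simp add: x_def mult.commute flip: exp_of_nat_mult)
    finally show ?thesis .
  qed
  \<comment> \<open>Grouping by length: words of length \<open>n\<close> carry total weight at most
    1, so they contribute at most \<open>x ^ n\<close>, and a geometric tail starting at
    \<open>n1\<close> remains.\<close>
  have fin_sum: "(\<Sum>u\<in>W. len ((!) u) (length u) powr t) \<le> x ^ n1 / (1 - x)"
    if W: "finite W" "W \<subseteq> good n1" for W n1
  proof -
    have "(\<Sum>u\<in>W. len ((!) u) (length u) powr t) \<le> (\<Sum>u\<in>W. (\<Prod>k<length u. q (\<omega> k, u ! k)) * x ^ length u)"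
      using W len_t by (intro sum_mono) auto
    also have "\<dots> = (\<Sum>n\<in>length ` W. \<Sum>u\<in>{u \<in> W. length u = n}. (\<Prod>k<length u. q (\<omega> k, u ! k)) * x ^ length u)"
      by (rule sum.image_gen[OF W(1)])
    also have "\<dots> = (\<Sum>n\<in>length ` W. (\<Sum>u\<in>{u \<in> W. length u = n}. \<Prod>k<n. q (\<omega> k, u ! k)) * x ^ n)"
      by (intro sum.cong) (auto simp: sum_distrib_right)
    also have "\<dots> \<le> (\<Sum>n\<in>length ` W. 1 * x ^ n)"
      using W x by (intro sum_mono mult_right_mono sum_words_le_1 q0 q1) (auto simp: good_def)
    also have "\<dots> \<le> x ^ n1 / (1 - x)"
      unfolding mult_1 using W x by (intro sum_powers_le) (auto simp: good_def)
    finally show ?thesis .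
  qed
  have small: "(INF U\<in>delta_covers \<delta> (freq_set S B f \<omega> \<alpha>). \<Sum>i. diam_pow t (U i)) \<le> 0 + ennreal e"
    if \<delta>: "0 < \<delta>" and e: "0 < e" for \<delta> e :: real
  proof -
    have "(\<lambda>n. x ^ n / (1 - x)) \<longlonglongrightarrow> 0 / (1 - x)"
      using x by (intro tendsto_intros LIMSEQ_power_zero) auto
    then have "\<forall>\<^sub>F n in sequentially. x ^ n / (1 - x) < e"
      using e by (intro order_tendstoD) auto
    moreover have "(\<lambda>n. max_ratio ^ n) \<longlonglongrightarrow> 0"
      using max_ratio_bounds by (intro LIMSEQ_power_zero) auto
    then have "\<forall>\<^sub>F n in sequentially. max_ratio ^ n < \<delta>"
      using \<delta> by (intro order_tendstoD) auto
    ultimately have "\<forall>\<^sub>F n in sequentially. x ^ n / (1 - x) < e \<and> max_ratio ^ n < \<delta>"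
      by eventually_elim simp
    then obtain n1 where n1: "x ^ n1 / (1 - x) < e" "max_ratio ^ n1 < \<delta>"
      by (auto simp: eventually_sequentially)
    \<comment> \<open>Indices that are not codes of good words receive the empty set, whose
      \<open>diam_pow\<close> is 0.\<close>
    define U where "U i = (if i \<in> to_nat ` good n1 then J (from_nat i) else {})" for i :: nat
    have U_good: "\<exists>u\<in>good n1. i = to_nat u \<and> U i = J u" if "i \<in> to_nat ` good n1" for i
      using that by (auto simp: U_def)
    have "U \<in> delta_covers \<delta> (freq_set S B f \<omega> \<alpha>)"
      unfolding delta_covers_def
    proof (intro CollectI conjI allI)
      show "freq_set S B f \<omega> \<alpha> \<subseteq> (\<Union>i. U i)"
        unfolding freq_set_def
      proof
        fix y assume "y \<in> coding f \<omega> ` E"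
        then obtain b where b: "b \<in> E" "y = coding f \<omega> b" by blast
        obtain n where n: "n1 \<le> n" "(\<Sum>k<n. X (dig b k)) \<le> - c * real n"
          using eventually_conj[OF neg[OF b(1)] eventually_ge_at_top[of n1]]
          by (auto simp: eventually_sequentially)
        define u where "u = map b [0..<n]"
        have "u \<in> good n1"
          using n E_index[OF b(1)] by (auto simp: good_def u_def index_seqs_def)
        moreover have "J u = cyl b n"
          unfolding J_def u_def using comp_maps_cong[of n "(!) (map b [0..<n])" b] by simp
        ultimately have "y \<in> U (to_nat u)"
          using coding_in_cyl[OF E_index[OF b(1)], of n] b(2) by (simp add: U_def)
        then show "y \<in> (\<Union>i. U i)" by blast
      qed
      fix i
      show "bounded (U i)" using U_good[of i] J by (cases "i \<in> to_nat ` good n1") (auto simp: U_def)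
      show "diameter (U i) \<le> \<delta>"
      proof (cases "i \<in> to_nat ` good n1")
        case True
        then obtain u where u: "u \<in> good n1" "U i = J u" using U_good by blast
        have "diameter (U i) \<le> max_ratio ^ length u"
          using u J(2) len_le[OF adm] by simp
        also have "\<dots> \<le> max_ratio ^ n1"
          using u max_ratio_bounds by (intro power_decreasing) (auto simp: good_def)
        finally show ?thesis using n1 by simp
      qed (use \<delta> in \<open>simp add: U_def\<close>)
    qed
    then have "(INF U\<in>delta_covers \<delta> (freq_set S B f \<omega> \<alpha>). \<Sum>i. diam_pow t (U i)) \<le> (\<Sum>i. diam_pow t (U i))"
      by (rule INF_lower)
    also have "\<dots> \<le> ennreal e"
      unfolding suminf_eq_SUP
    proof (rule SUP_least)
      fix m
      define W where "W = {u \<in> good n1. to_nat u < m}"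
      have "finite (to_nat ` W)"
        by (rule finite_subset[of _ "{..<m}"]) (auto simp: W_def)
      then have finW: "finite W"
        by (rule finite_imageD) (rule inj_on_subset[OF inj_to_nat subset_UNIV])
      have "(\<Sum>i<m. diam_pow t (U i)) = (\<Sum>i\<in>to_nat ` W. diam_pow t (U i))"
        by (intro sum.mono_neutral_right) (auto simp: W_def U_def diam_pow_def)
      also have "\<dots> = (\<Sum>u\<in>W. diam_pow t (U (to_nat u)))"
        by (subst sum.reindex) (simp_all add: inj_on_subset[OF inj_to_nat subset_UNIV])
      also have "\<dots> = (\<Sum>u\<in>W. ennreal (len ((!) u) (length u) powr t))"
        using t J by (intro sum.cong) (auto simp: W_def U_def diam_pow_def)
      also have "\<dots> = ennreal (\<Sum>u\<in>W. len ((!) u) (length u) powr t)"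
        by (intro sum_ennreal) auto
      also have "\<dots> \<le> ennreal e"
        using fin_sum[OF finW, of n1] n1 by (intro ennreal_leI) (auto simp: W_def)
      finally show "(\<Sum>i<m. diam_pow t (U i)) \<le> ennreal e" .
    qed
    finally show ?thesis by simp
  qed
  have "(INF U\<in>delta_covers \<delta> (freq_set S B f \<omega> \<alpha>). \<Sum>i. diam_pow t (U i)) \<le> 0" if "0 < \<delta>" for \<delta> :: real
    by (rule ennreal_le_epsilon) (rule small[OF that], assumption)
  then have "hausdorff_measure t (freq_set S B f \<omega> \<alpha>) \<le> 0"
    unfolding hausdorff_measure_def by (intro SUP_least) simp
  then show ?thesis by simp
qed

end

lemma filterlim_initial_segments:
  "filterlim (\<lambda>m. A \<inter> {..m}) (finite_subsets_at_top A) sequentially" for A :: "nat set"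
proof (rule filterlim_finite_subsets_at_top[THEN iffD2, rule_format])
  fix X assume X: "finite X \<and> X \<subseteq> A"
  have "X \<subseteq> A \<inter> {..n}" if "Max (insert 0 X) \<le> n" for n
    using X that by auto
  then show "\<forall>\<^sub>F n in sequentially. finite (A \<inter> {..n}) \<and> X \<subseteq> A \<inter> {..n} \<and> A \<inter> {..n} \<subseteq> A"
    unfolding eventually_sequentially by blast
qed

context gls_freq
begin

section \<open>Marginals, entropy, Lyapunov exponent and exponent of convergence\<close>

abbreviation marg :: "'s \<Rightarrow> real" where "marg \<equiv> marginal B \<alpha>"

lemma marg_has_sum: assumes "s \<in> S" shows "((\<lambda>b. \<alpha> (s, b)) has_sum marg s) (B s)"
proof -
  have "Pair s ` B s \<subseteq> D" using assms by (auto simp: digits_def)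
  moreover have "\<alpha> summable_on D" using \<alpha>_has_sum by (auto simp: summable_on_def)
  ultimately have "\<alpha> summable_on Pair s ` B s" using summable_on_subset_banach by blast
  then have "(\<alpha> \<circ> Pair s) summable_on B s"
    by (subst (asm) summable_on_reindex) (auto simp: inj_on_def)
  then show ?thesis unfolding marginal_def by (intro has_sum_infsum) (simp add: o_def)
qed

lemma sum_le_marg: "s \<in> S \<Longrightarrow> finite A \<Longrightarrow> A \<subseteq> B s \<Longrightarrow> (\<Sum>b\<in>A. \<alpha> (s, b)) \<le> marg s"
  by (rule has_sum_mono2[OF has_sum_finite marg_has_sum]) (auto intro!: \<alpha>_nonneg simp: digits_def)

lemma marg_pos: assumes "s \<in> S" shows "0 < marg s"
proof -
  obtain b where "b \<in> B s" "0 < \<alpha> (s, b)" using positive_marginals[OF assms] by blast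
  then show ?thesis using sum_le_marg[OF assms, of "{b}"] by simp
qed

definition marg_upto :: "nat \<Rightarrow> 's \<Rightarrow> real" where
  "marg_upto m s = (\<Sum>b\<in>B s \<inter> {..m}. \<alpha> (s, b))"

lemma marg_upto_tendsto: "s \<in> S \<Longrightarrow> (\<lambda>m. marg_upto m s) \<longlonglongrightarrow> marg s"
  using marg_has_sum[of s] unfolding has_sum_def marg_upto_def
  by (rule filterlim_compose[OF _ filterlim_initial_segments])

lemma sum_Dm_eq: "(\<Sum>d\<in>Dm m. g d) = (\<Sum>s\<in>S. \<Sum>b\<in>B s \<inter> {..m}. g (s, b))"
  unfolding Dm_def' using finite_S by (subst sum.Sigma) auto

lemma sum_Dm_marg:
  "(\<Sum>d\<in>Dm m. \<alpha> d * g (fst d)) = (\<Sum>s\<in>S. marg_upto m s * g s)"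
  by (simp add: sum_Dm_eq marg_upto_def sum_distrib_right)

lemma sum_Dm_marg_tendsto:
  "(\<lambda>m. \<Sum>d\<in>Dm m. \<alpha> d * g (fst d)) \<longlonglongrightarrow> (\<Sum>s\<in>S. marg s * g s)"
  unfolding sum_Dm_marg by (intro tendsto_intros marg_upto_tendsto)

text \<open>The numerator in \<open>fibre_dim\<close>, a truncation of the entropy of the digit
  conditional on the symbol. The marginals in it are not truncated, so \<open>num m\<close> is in
  general not the entropy of a truncated law; \<open>truncated_entropy_tendsto\<close> closes this
  gap.\<close>

definition num :: "nat \<Rightarrow> real" where
  "num m = (\<Sum>s\<in>S. marg s * ln (marg s)) - (\<Sum>d\<in>Dm m. \<alpha> d * ln (\<alpha> d))"

lemma fibre_dim_eq: "fibre_dim S B f \<alpha> = liminf (\<lambda>m. ereal (num m / lyap m))"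
  unfolding fibre_dim_def num_def lyap_def by (simp add: case_prod_beta)

lemma mono_lyap: "mono lyap"
  unfolding mono_def lyap_def
proof (intro allI impI sum_mono2 finite_Dm Dm_mono)
  fix m n d assume "d \<in> Dm n - Dm m"
  then have "d \<in> D" using Dm_subset by blast
  then show "0 \<le> \<alpha> d * lnN d" using \<alpha>_nonneg lnN_pos by (simp add: less_imp_le)
qed

lemma lyap_eventually_pos:
  obtains l where "0 < l" "\<forall>\<^sub>F m in sequentially. l \<le> lyap m"
proof -
  obtain s where s: "s \<in> S" using S_nonempty by blast
  then obtain b where b: "b \<in> B s" "0 < \<alpha> (s, b)" using positive_marginals by blast
  have d: "(s, b) \<in> D" using s b by (simp add: digits_def)
  have "\<alpha> (s, b) * lnN (s, b) \<le> lyap m" if "b \<le> m" for m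
  proof -
    have "0 \<le> \<alpha> d * lnN d" if "d \<in> Dm m" for d
      using subsetD[OF Dm_subset that] \<alpha>_nonneg lnN_pos by (simp add: less_imp_le)
    moreover have "(s, b) \<in> Dm m" using d that by (simp add: digits_upto_def)
    ultimately show ?thesis
      unfolding lyap_def by (intro member_le_sum[of "(s, b)" "Dm m" "\<lambda>d. \<alpha> d * lnN d"] finite_Dm) auto
  qed
  then show thesis
    using b lnN_pos[OF d] by (intro that[of "\<alpha> (s, b) * lnN (s, b)"]) (auto simp: eventually_sequentially)
qed

lemma powr_minus_1_summable: "s \<in> S \<Longrightarrow> (\<lambda>b. N s b powr (- 1)) summable_on B s"
proof -
  assume s: "s \<in> S"
  have "(\<lambda>b. inverse (N s b)) summable_on B s"
    using has_sum_inverse_N[OF s] by (auto simp only: summable_on_def)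
  moreover have "N s b powr (- 1) = inverse (N s b)" if "b \<in> B s" for b
    using N_pos[OF s that] by (simp add: powr_minus)
  ultimately show ?thesis by (simp cong: summable_on_cong)
qed

lemma conv_exponent_nonneg: "s \<in> S \<Longrightarrow> 0 \<le> conv_exponent B f s"
  unfolding conv_exponent_def using powr_minus_1_summable
  by (intro cInf_greatest) (auto intro!: exI[of _ 1])

lemma conv_exponent_le_max: "s \<in> S \<Longrightarrow> conv_exponent B f s \<le> max_conv_exponent S B f"
  unfolding max_conv_exponent_def using finite_S by auto

lemma max_conv_exponent_nonneg: "0 \<le> max_conv_exponent S B f"
  using conv_exponent_nonneg conv_exponent_le_max S_nonempty by (metis ex_in_conv order_trans)

text \<open>As every \<open>N\<close> exceeds 1, summability persists when the exponent grows. The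
  exponent 1 always qualifies because the ratios sum to 1, so the infimum is over a nonempty
  set.\<close>

lemma summable_above_exponent:
  assumes s: "s \<in> S" and t: "max_conv_exponent S B f < t"
  shows "(\<lambda>b. N s b powr (- t)) summable_on B s"
proof -
  have "conv_exponent B f s < t" using conv_exponent_le_max[OF s] t by simp
  moreover have "1 \<in> {t. 0 \<le> t \<and> (\<lambda>b. N s b powr (- t)) summable_on B s}"
    using powr_minus_1_summable[OF s] by (intro CollectI conjI) auto
  ultimately have "\<exists>t0\<in>{t. 0 \<le> t \<and> (\<lambda>b. N s b powr (- t)) summable_on B s}. t0 < t"
    unfolding conv_exponent_def by (intro cInf_lessD) blast+
  then obtain t0 where t0: "(\<lambda>b. N s b powr (- t0)) summable_on B s" "t0 < t" by blast
  show ?thesis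
    by (rule summable_on_comparison_test[OF t0(1)])
      (use t0(2) N_gt_1[OF s] in \<open>auto intro!: powr_mono less_imp_le\<close>)
qed

lemma weight_bound:
  assumes "max_conv_exponent S B f < t"
  obtains Z where "0 < Z" "\<And>s A. s \<in> S \<Longrightarrow> finite A \<Longrightarrow> A \<subseteq> B s \<Longrightarrow> (\<Sum>b\<in>A. N s b powr (- t)) \<le> Z"
proof -
  define z where "z s = infsum (\<lambda>b. N s b powr (- t)) (B s)" for s
  have z: "(\<Sum>b\<in>A. N s b powr (- t)) \<le> z s" if "s \<in> S" "finite A" "A \<subseteq> B s" for s A
    unfolding z_def using that summable_above_exponent[OF that(1) assms]
    by (intro finite_sum_le_infsum) auto
  have z0: "0 \<le> z s" if "s \<in> S" for s using z[OF that, of "{}"] by simp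
  have "z s \<le> (\<Sum>s\<in>S. z s) + 1" if "s \<in> S" for s
    using member_le_sum[of s S z] that z0 finite_S by fastforce
  moreover have "0 < (\<Sum>s\<in>S. z s) + 1" using sum_nonneg[of S z] z0 by fastforce
  ultimately show thesis using z by (intro that[of "(\<Sum>s\<in>S. z s) + 1"]) (auto intro: order_trans)
qed

text \<open>The weight \<open>q\<close> is almost the conditional frequency on the digits of \<open>Dm m\<close> that occur, and is
  proportional to \<open>N powr -t\<close> on all other digits, where \<open>X\<close> is therefore constant.\<close>

theorem hausdorff_dim_upper:
  "hausdorff_dim (freq_set S B f \<omega> \<alpha>) \<le> max (ereal (max_conv_exponent S B f)) (fibre_dim S B f \<alpha>)"
proof (rule ccontr)
  assume "\<not> ?thesis"
  then obtain t :: real where t: "max (ereal (max_conv_exponent S B f)) (fibre_dim S B f \<alpha>) < ereal t"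
    "ereal t < hausdorff_dim (freq_set S B f \<omega> \<alpha>)"
    using ereal_dense2 by (meson not_le)
  have t\<eta>: "max_conv_exponent S B f < t" and "fibre_dim S B f \<alpha> < ereal t" using t(1) by auto
  then obtain t' :: real where t': "fibre_dim S B f \<alpha> < ereal t'" "t' < t"
    using ereal_dense2 by (metis less_ereal.simps(1))
  have t_pos: "0 < t" using t\<eta> max_conv_exponent_nonneg by simp
  obtain l where l: "0 < l" "\<forall>\<^sub>F m in sequentially. l \<le> lyap m"
    by (rule lyap_eventually_pos)
  obtain Z where Z: "0 < Z" "\<And>s A. s \<in> S \<Longrightarrow> finite A \<Longrightarrow> A \<subseteq> B s \<Longrightarrow> (\<Sum>b\<in>A. N s b powr (- t)) \<le> Z"
    using weight_bound[OF t\<eta>] by blast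
  \<comment> \<open>The gap \<open>(t - t') * lyap m\<close> is at least \<open>4 * c\<close>. One
    \<open>c\<close> pays for the factor \<open>exp (- c)\<close> in \<open>q\<close>, one for the
    digits outside \<open>G\<close>, one for the truncated marginals, and one remains as decay
    rate.\<close>
  define c where "c = (t - t') * l / 4"
  have c: "0 < c" using t' l by (simp add: c_def)
  \<comment> \<open>Chosen so that \<open>exp (- c) + \<kappa> * Z = 1\<close>: the factor
    \<open>exp (- c)\<close> makes room for the weight of all other digits.\<close>
  define \<kappa> where "\<kappa> = (1 - exp (- c)) / Z"
  have \<kappa>: "0 < \<kappa>" using c Z by (simp add: \<kappa>_def)
  \<comment> \<open>A lower limit below \<open>t'\<close> yields the quotient bound only for
    infinitely many \<open>m\<close>; the remaining requirements hold eventually, so one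
    \<open>m\<close> meets all. It matters that \<open>\<kappa>\<close> does not depend on
    \<open>m\<close>: the term \<open>- ln \<kappa> * (1 - sum \<alpha> (Dm m))\<close> then tends
    to 0.\<close>
  have freq: "\<exists>\<^sub>F m in sequentially. num m / lyap m < t'"
  proof (rule ccontr)
    assume "\<not> ?thesis"
    then have "\<forall>\<^sub>F m in sequentially. ereal t' \<le> ereal (num m / lyap m)"
      by (simp add: not_frequently not_less)
    then have "ereal t' \<le> fibre_dim S B f \<alpha>"
      unfolding fibre_dim_eq by (rule Liminf_bounded)
    then show False using t' by simp
  qed
  have ev: "\<forall>\<^sub>F m in sequentially. l \<le> lyap m \<and> - ln \<kappa> * (1 - sum \<alpha> (Dm m)) < c \<and>
      (\<Sum>d\<in>Dm m. \<alpha> d * ln (marg (fst d))) < (\<Sum>s\<in>S. marg s * ln (marg s)) + c"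
  proof (intro eventually_conj l)
    have "(\<lambda>m. - ln \<kappa> * (1 - sum \<alpha> (Dm m))) \<longlonglongrightarrow> - ln \<kappa> * (1 - 1)"
      by (intro tendsto_intros sum_Dm_tendsto \<alpha>_has_sum)
    then show "\<forall>\<^sub>F m in sequentially. - ln \<kappa> * (1 - sum \<alpha> (Dm m)) < c"
      using c by (intro order_tendstoD) auto
    show "\<forall>\<^sub>F m in sequentially. (\<Sum>d\<in>Dm m. \<alpha> d * ln (marg (fst d))) < (\<Sum>s\<in>S. marg s * ln (marg s)) + c"
      using c by (intro order_tendstoD[OF sum_Dm_marg_tendsto]) auto
  qed
  obtain m where m: "num m / lyap m < t'" "l \<le> lyap m" "- ln \<kappa> * (1 - sum \<alpha> (Dm m)) < c"
      "(\<Sum>d\<in>Dm m. \<alpha> d * ln (marg (fst d))) < (\<Sum>s\<in>S. marg s * ln (marg s)) + c"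
    using frequently_eventually_frequently[OF freq ev] frequently_ex by blast
  \<comment> \<open>Digits of frequency 0 are left out, since \<open>q\<close> has to be positive
    for \<open>X\<close> to be defined through \<open>ln (q d)\<close>.\<close>
  define G where "G = {d \<in> Dm m. 0 < \<alpha> d}"
  have G: "finite G" "G \<subseteq> D" unfolding G_def using finite_Dm Dm_subset by auto
  have sum_G: "(\<Sum>d\<in>G. \<alpha> d * g d) = (\<Sum>d\<in>Dm m. \<alpha> d * g d)" for g
    unfolding G_def using finite_Dm \<alpha>_nonneg Dm_subset
    by (intro sum.mono_neutral_left) (force simp: not_less)+
  define q where "q d = (if d \<in> G then exp (- c) * \<alpha> d / marg (fst d) else \<kappa> * N (fst d) (snd d) powr (- t))" for d
  define X where "X d = - t * lnN d - ln (q d)" for d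
  have q_pos: "0 < q d" if "d \<in> D" for d
    using that \<kappa> N_pos[of "fst d" "snd d"] marg_pos[of "fst d"] by (auto simp: q_def G_def digits_def)
  have "hausdorff_measure t (freq_set S B f \<omega> \<alpha>) = 0"
  proof (rule hausdorff_measure_0[OF t_pos c])
    show "0 \<le> q d" if "d \<in> D" for d using q_pos[OF that] by simp
    show "N (fst d) (snd d) powr (- t) = q d * exp (X d)" if "d \<in> D" for d
      using q_pos[OF that] that N_pos[of "fst d" "snd d"]
      by (auto simp: X_def exp_diff powr_def digits_def)
    show "(\<Sum>b\<in>A. q (s, b)) \<le> 1" if A: "s \<in> S" "finite A" "A \<subseteq> B s" for s A
    proof -
      have "(\<Sum>b\<in>A. q (s, b)) \<le> (\<Sum>b\<in>A. exp (- c) / marg s * \<alpha> (s, b) + \<kappa> * N s b powr (- t))"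
      proof (rule sum_mono)
        fix b assume "b \<in> A"
        then have "0 \<le> \<alpha> (s, b)" using A by (intro \<alpha>_nonneg) (auto simp: digits_def)
        then show "q (s, b) \<le> exp (- c) / marg s * \<alpha> (s, b) + \<kappa> * N s b powr (- t)"
          using \<kappa> marg_pos[OF A(1)] by (auto simp: q_def)
      qed
      also have "\<dots> = exp (- c) / marg s * (\<Sum>b\<in>A. \<alpha> (s, b)) + \<kappa> * (\<Sum>b\<in>A. N s b powr (- t))"
        by (simp only: sum.distrib sum_distrib_left)
      also have "\<dots> \<le> exp (- c) / marg s * marg s + \<kappa> * Z"
        using \<kappa> marg_pos[OF A(1)] sum_le_marg[OF A] Z(2)[OF A] by (intro add_mono mult_left_mono) auto
      also have "\<dots> = 1" using marg_pos[OF A(1)] Z(1) by (simp add: \<kappa>_def)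
      finally show ?thesis .
    qed
    fix b assume b: "b \<in> E"
    have X_out: "X d = - ln \<kappa>" if "d \<in> D" "d \<notin> G" for d
      using that \<kappa> N_pos[of "fst d" "snd d"] by (auto simp: X_def q_def ln_mult ln_powr digits_def)
    have "(\<Sum>d\<in>G. \<alpha> d * X d) = (\<Sum>d\<in>G. \<alpha> d * (- t * lnN d + c - ln (\<alpha> d) + ln (marg (fst d))))"
    proof (intro sum.cong refl)
      fix d assume d: "d \<in> G"
      then have "0 < \<alpha> d" "0 < marg (fst d)" using G marg_pos[of "fst d"] by (auto simp: G_def digits_def)
      then show "\<alpha> d * X d = \<alpha> d * (- t * lnN d + c - ln (\<alpha> d) + ln (marg (fst d)))"
        using d by (simp add: X_def q_def ln_mult ln_div)
    qed
    also have "\<dots> = - t * lyap m + c * sum \<alpha> (Dm m) - (\<Sum>d\<in>Dm m. \<alpha> d * ln (\<alpha> d)) + (\<Sum>d\<in>Dm m. \<alpha> d * ln (marg (fst d)))"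
      unfolding sum_G by (simp add: lyap_def algebra_simps sum.distrib sum_subtractf sum_distrib_left sum_negf)
    also have "\<dots> + - ln \<kappa> * (1 - sum \<alpha> (Dm m)) < - t * lyap m + c + num m + c + c"
    proof -
      have "c * sum \<alpha> (Dm m) \<le> c * 1"
        using c by (intro mult_left_mono sum_\<alpha>_le_1 Dm_subset finite_Dm) auto
      then show ?thesis using m unfolding num_def by linarith
    qed
    also have "\<dots> \<le> - c"
    proof -
      have "num m < t' * lyap m" using m l by (simp add: divide_less_eq)
      moreover have "(t - t') * l \<le> (t - t') * lyap m" using m t' by (intro mult_left_mono) auto
      ultimately show ?thesis by (simp add: c_def algebra_simps)
    qed
    finally have lim: "(\<Sum>d\<in>G. \<alpha> d * X d) + - ln \<kappa> * (1 - sum \<alpha> G) < - c"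
      using sum_G[of "\<lambda>_. 1"] by simp
    have "\<forall>\<^sub>F n in sequentially. (\<Sum>k<n. X (dig b k)) / real n < - c"
      by (rule order_tendstoD(2)[OF digit_average_tendsto[OF b G X_out] lim])
    then show "\<forall>\<^sub>F n in sequentially. (\<Sum>k<n. X (dig b k)) \<le> - c * real n"
      using eventually_gt_at_top[of 0]
      by eventually_elim (simp add: divide_less_eq less_imp_le)
  qed
  then have "hausdorff_dim (freq_set S B f \<omega> \<alpha>) \<le> ereal t"
    unfolding hausdorff_dim_def using t_pos by (intro INF_lower) auto
  then show False using t(2) by simp
qed

section \<open>The case of infinite Lyapunov exponent\<close>

lemma lyap_at_top:
  assumes "(\<Sum>\<^sub>\<infinity>(s, b)\<in>D. ereal (\<alpha> (s, b) * ln (N s b))) = \<infinity>"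
  shows "filterlim lyap at_top sequentially"
proof (rule ccontr)
  assume "\<not> ?thesis"
  then obtain M where "\<not> (\<forall>\<^sub>F m in sequentially. M \<le> lyap m)"
    by (auto simp: filterlim_at_top)
  then have M: "lyap m \<le> M" for m
    using mono_lyap unfolding eventually_sequentially mono_def by (meson linear order_trans)
  have nonneg: "0 \<le> \<alpha> d * lnN d" if "d \<in> D" for d
    using that \<alpha>_nonneg lnN_pos by (simp add: less_imp_le)
  have fin: "(\<Sum>d\<in>A. \<alpha> d * lnN d) \<le> M" if A: "finite A" "A \<subseteq> D" for A
  proof -
    have "\<forall>\<^sub>F m in sequentially. finite (Dm m) \<and> A \<subseteq> Dm m \<and> Dm m \<subseteq> D"
      using filterlim_Dm[unfolded filterlim_finite_subsets_at_top, rule_format, of A] A by simp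
    then obtain m where "A \<subseteq> Dm m" by (auto simp: eventually_sequentially)
    then have "(\<Sum>d\<in>A. \<alpha> d * lnN d) \<le> lyap m"
      unfolding lyap_def using Dm_subset[of m] by (intro sum_mono2 finite_Dm nonneg) auto
    then show ?thesis using M order_trans by blast
  qed
  have "(\<lambda>d. \<alpha> d * lnN d) summable_on D"
    by (rule nonneg_bdd_above_summable_on) (use nonneg fin in \<open>auto intro!: bdd_aboveI2\<close>)
  then obtain x where "((\<lambda>d. \<alpha> d * lnN d) has_sum x) D" by (auto simp: summable_on_def)
  moreover have "sum (\<lambda>d. ereal (\<alpha> d * lnN d)) = (\<lambda>A. ereal (\<Sum>d\<in>A. \<alpha> d * lnN d))"
    by (intro ext) (rule sum_ereal)
  ultimately have "((\<lambda>d. ereal (\<alpha> d * lnN d)) has_sum ereal x) D"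
    unfolding has_sum_def by simp
  then have "(\<Sum>\<^sub>\<infinity>d\<in>D. ereal (\<alpha> d * lnN d)) = ereal x" by (rule infsumI)
  moreover have "(\<lambda>(s, b). ereal (\<alpha> (s, b) * ln (N s b))) = (\<lambda>d. ereal (\<alpha> d * lnN d))"
    by auto
  ultimately have "ereal x = \<infinity>" using assms by metis
  then show False by simp
qed

text \<open>Termwise, \<open>- a ln a - t a ln N = N powr -t * (- x ln x)\<close> for \<open>x = a N powr t\<close>.\<close>

lemma entropy_term_le:
  fixes a n t :: real
  assumes "0 \<le> a" "0 < n"
  shows "- (a * ln a) - t * (a * ln n) \<le> n powr (- t)"
proof (cases "a = 0")
  case False
  then have a: "0 < a" using assms by simp
  have "ln (n powr (- t) / a) \<le> n powr (- t) / a - 1"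
    using a assms by (intro ln_le_minus_one) auto
  also have "\<dots> \<le> n powr (- t) / a" by simp
  finally have "a * ln (n powr (- t) / a) \<le> n powr (- t)"
    using a by (simp add: field_simps)
  then show ?thesis using a assms by (simp add: ln_div ln_powr algebra_simps)
qed simp

text \<open>For \<open>t\<close> above the exponent the sums of \<open>N powr -t\<close> are
  bounded, so \<open>entropy_term_le\<close> bounds the entropy by \<open>t * lyap m\<close> plus a
  constant, and dividing by a divergent \<open>lyap m\<close> removes the constant.\<close>

lemma fibre_dim_le_exponent:
  assumes "filterlim lyap at_top sequentially"
  shows "fibre_dim S B f \<alpha> \<le> ereal (max_conv_exponent S B f)"
proof (rule ccontr)
  assume "\<not> ?thesis"
  then obtain u :: real where u: "ereal (max_conv_exponent S B f) < ereal u" "ereal u < fibre_dim S B f \<alpha>"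
    using ereal_dense2 by (meson not_le)
  then obtain t where t: "max_conv_exponent S B f < t" "t < u"
    using dense by auto
  obtain Z where Z: "\<And>s A. s \<in> S \<Longrightarrow> finite A \<Longrightarrow> A \<subseteq> B s \<Longrightarrow> (\<Sum>b\<in>A. N s b powr (- t)) \<le> Z"
    using weight_bound[OF t(1)] by blast
  define C where "C = (\<Sum>s\<in>S. marg s * ln (marg s)) + real (card S) * Z"
  have num_le: "num m \<le> t * lyap m + C" for m
  proof -
    have "(\<Sum>d\<in>Dm m. - (\<alpha> d * ln (\<alpha> d)) - t * (\<alpha> d * lnN d)) \<le> (\<Sum>d\<in>Dm m. N (fst d) (snd d) powr (- t))"
    proof (intro sum_mono entropy_term_le)
      fix d assume "d \<in> Dm m"
      then have "d \<in> D" using Dm_subset by blast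
      then show "0 \<le> \<alpha> d" "0 < N (fst d) (snd d)"
        using \<alpha>_nonneg N_pos by (auto simp: digits_def)
    qed
    also have "\<dots> \<le> (\<Sum>s\<in>S. Z)"
      unfolding sum_Dm_eq by (intro sum_mono) (simp add: Z)
    finally have "- (\<Sum>d\<in>Dm m. \<alpha> d * ln (\<alpha> d)) - t * lyap m \<le> real (card S) * Z"
      by (simp add: sum_subtractf sum_negf lyap_def sum_distrib_left)
    then show ?thesis by (simp add: num_def C_def)
  qed
  have "((\<lambda>m. C / lyap m) \<longlongrightarrow> 0) sequentially"
    by (rule tendsto_divide_0[OF tendsto_const]) (use assms in \<open>simp add: filterlim_at_top_imp_at_infinity\<close>)
  then have "\<forall>\<^sub>F m in sequentially. C / lyap m < u - t"
    using t by (intro order_tendstoD) auto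
  moreover have "\<forall>\<^sub>F m in sequentially. 1 \<le> lyap m"
    using assms by (simp add: filterlim_at_top)
  ultimately have "\<forall>\<^sub>F m in sequentially. ereal (num m / lyap m) \<le> ereal u"
  proof eventually_elim
    case (elim m)
    have "num m / lyap m \<le> (t * lyap m + C) / lyap m"
      using num_le elim by (intro divide_right_mono) auto
    also have "\<dots> = t + C / lyap m" using elim by (simp add: add_divide_distrib)
    also have "\<dots> \<le> u" using elim by simp
    finally show ?case by simp
  qed
  then have "fibre_dim S B f \<alpha> \<le> liminf (\<lambda>m::nat. ereal u)"
    unfolding fibre_dim_eq by (rule Liminf_mono)
  then show False using u(2) by (simp add: Liminf_const)
qed

end

section \<open>Lower bound by the exponent of convergence\<close>

text \<open>\<open>K\<close> collects the elements of \<open>P\<close> whose rank in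
  \<open>P\<close> is a perfect square, about \<open>sqrt n\<close> of them below \<open>n\<close>
  at most. An element is at least its rank, so their sum dominates the sum of the squares below
  \<open>a * n\<close>, of order \<open>n powr (3/2)\<close>.\<close>

lemma sparse_subset:
  fixes P :: "nat set" and a :: real
  assumes a: "0 < a" and dens: "\<forall>\<^sub>F n in sequentially. a * real n \<le> real (card (P \<inter> {..<n}))"
  obtains K where "K \<subseteq> P" "(\<lambda>n. real (card (K \<inter> {..<n})) / real n) \<longlonglongrightarrow> 0"
    "\<And>C. \<forall>\<^sub>F n in sequentially. C * real n powr (5 / 4) \<le> real (\<Sum>k\<in>K \<inter> {..<n}. k)"
proof -
  define r where "r n = card (P \<inter> {..<n})" for n
  have r_Suc: "r (Suc n) = (if n \<in> P then Suc (r n) else r n)" for n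
    by (auto simp: r_def lessThan_Suc Int_insert_right)
  have r_0: "r 0 = 0" by (simp add: r_def)
  have r_mono: "mono r" by (rule monoI) (auto simp: r_def intro!: card_mono)
  have r_le: "r n \<le> n" for n
    by (induction n) (auto simp: r_0 r_Suc)
  have r_less: "r k < r n" if "k \<in> P" "k < n" for k n
    using monoD[OF r_mono, of "Suc k" n] that r_Suc[of k] by simp
  have r_onto: "\<exists>k\<in>P. k < n \<and> r k = v" if "v < r n" for v n
    using that
  proof (induction n)
    case (Suc n)
    then show ?case
      by (cases "v < r n"; cases "n \<in> P") (auto simp: r_Suc intro: less_SucI)
  qed (simp add: r_0)
  define K where "K = {k \<in> P. \<exists>i. r k = i\<^sup>2}"
  have inj: "inj_on r (K \<inter> {..<n})" for n
    using r_less by (intro linorder_inj_onI) (force simp: K_def)+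
  have img: "r ` (K \<inter> {..<n}) = (\<lambda>i. i\<^sup>2) ` {i. i\<^sup>2 < r n}" for n
  proof (intro equalityI subsetI)
    fix v assume "v \<in> r ` (K \<inter> {..<n})"
    then show "v \<in> (\<lambda>i. i\<^sup>2) ` {i. i\<^sup>2 < r n}" using r_less by (force simp: K_def)
  next
    fix v assume "v \<in> (\<lambda>i. i\<^sup>2) ` {i. i\<^sup>2 < r n}"
    then obtain i where i: "v = i\<^sup>2" "v < r n" by auto
    then obtain k where "k \<in> P" "k < n" "r k = v" using r_onto by blast
    then show "v \<in> r ` (K \<inter> {..<n})" using i by (force simp: K_def)
  qed
  have inj2: "inj_on (\<lambda>i::nat. i\<^sup>2) A" for A
    by (auto simp: inj_on_def power2_eq_iff_nonneg)
  have sq_fin: "finite {i::nat. i\<^sup>2 < m}" for m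
  proof (rule finite_subset[of _ "{..<m}"])
    have "i \<le> i\<^sup>2" for i :: nat by (simp add: power2_eq_square)
    then show "{i::nat. i\<^sup>2 < m} \<subseteq> {..<m}" using le_less_trans by blast
  qed simp
  have "(\<lambda>n. real (card (K \<inter> {..<n})) / real n) \<longlonglongrightarrow> 0"
  proof (rule Lim_null_comparison)
    show "(\<lambda>n. (sqrt (real n) + 1) / real n) \<longlonglongrightarrow> 0" by real_asymp
    have "real (card (K \<inter> {..<n})) \<le> sqrt (real n) + 1" for n
    proof -
      have "card (K \<inter> {..<n}) = card {i. i\<^sup>2 < r n}"
        using card_image[OF inj, of n] card_image[OF inj2, of "{i. i\<^sup>2 < r n}"] img[of n] by simp
      also have "\<dots> \<le> card {..<nat \<lceil>sqrt (real n)\<rceil>}"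
      proof (intro card_mono subsetI)
        fix i assume "i \<in> {i. i\<^sup>2 < r n}"
        then have "i\<^sup>2 < n" using r_le[of n] by simp
        then have "real i < sqrt (real n)"
          by (intro real_less_rsqrt) (simp flip: of_nat_power)
        then show "i \<in> {..<nat \<lceil>sqrt (real n)\<rceil>}" by (simp add: nat_less_iff less_ceiling_iff zless_nat_eq_int_zless)
      qed auto
      finally have "card (K \<inter> {..<n}) \<le> nat \<lceil>sqrt (real n)\<rceil>" by simp
      then have "real (card (K \<inter> {..<n})) \<le> real (nat \<lceil>sqrt (real n)\<rceil>)" by (rule of_nat_mono)
      also have "\<dots> \<le> sqrt (real n) + 1"
        using of_int_ceiling_le_add_one[of "sqrt (real n)"] by simp
      finally show ?thesis .
    qed
    then show "\<forall>\<^sub>F n in sequentially. norm (real (card (K \<inter> {..<n})) / real n) \<le> (sqrt (real n) + 1) / real n"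
      by (intro always_eventually allI) (simp add: divide_right_mono)
  qed
  moreover have "\<forall>\<^sub>F n in sequentially. C * real n powr (5 / 4) \<le> real (\<Sum>k\<in>K \<inter> {..<n}. k)" for C
  proof -
    have sq_sum: "(real m - 1) ^ 3 \<le> 3 * real (\<Sum>i<m. i\<^sup>2)" for m
    proof (induction m)
      case (Suc m)
      have "real m ^ 3 \<le> (real m - 1) ^ 3 + 3 * (real m)\<^sup>2" if "m \<noteq> 0"
        using that by (simp add: power3_eq_cube power2_eq_square algebra_simps)
      then show ?case using Suc by (cases "m = 0") (simp_all add: algebra_simps)
    qed simp
    \<comment> \<open>Rounding the square root down loses 1 and \<open>sq_sum\<close> loses another
      1, hence the 2. The condition \<open>4 \<le> r n\<close> makes the base nonnegative, so that
      cubing is monotone.\<close>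
    have *: "(sqrt (real (r n)) - 2) ^ 3 \<le> 3 * real (\<Sum>k\<in>K \<inter> {..<n}. k)" if "4 \<le> r n" for n
    proof -
      define m where "m = nat \<lfloor>sqrt (real (r n))\<rfloor>"
      have m: "real m \<le> sqrt (real (r n))" "sqrt (real (r n)) \<le> real m + 1"
        unfolding m_def by (auto simp: less_imp_le)
      have "2 \<le> sqrt (real (r n))" using that by (intro real_le_rsqrt) simp
      then have "(sqrt (real (r n)) - 2) ^ 3 \<le> (real m - 1) ^ 3"
        using m by (intro power_mono) auto
      also have "\<dots> \<le> 3 * real (\<Sum>i<m. i\<^sup>2)" by (rule sq_sum)
      also have "(\<Sum>i<m. i\<^sup>2) \<le> (\<Sum>i\<in>{i. i\<^sup>2 < r n}. i\<^sup>2)"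
      proof (intro sum_mono2 sq_fin subsetI)
        fix i assume "i \<in> {..<m}"
        then have "real i < sqrt (real (r n))" using m by simp
        then have "(real i)\<^sup>2 < (sqrt (real (r n)))\<^sup>2" by (intro power_strict_mono) auto
        then have "real (i\<^sup>2) < real (r n)" by simp
        then show "i \<in> {i. i\<^sup>2 < r n}" by (simp only: of_nat_less_iff mem_Collect_eq)
      qed auto
      also have "\<dots> = (\<Sum>k\<in>K \<inter> {..<n}. r k)"
        using sum.reindex[OF inj, of "\<lambda>v. v" n] sum.reindex[OF inj2, of "\<lambda>v. v" "{i. i\<^sup>2 < r n}"] img[of n] by simp
      also have "\<dots> \<le> (\<Sum>k\<in>K \<inter> {..<n}. k)" by (intro sum_mono r_le)
      finally show ?thesis by simp
    qed
    have "\<forall>\<^sub>F n in sequentially. 3 * (C * real n powr (5 / 4)) \<le> (sqrt (a * real n) - 2) ^ 3"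
      using a by real_asymp
    moreover have "\<forall>\<^sub>F n in sequentially. 4 \<le> a * real n" using a by real_asymp
    ultimately show ?thesis using dens
    proof eventually_elim
      case (elim n)
      then have r4: "a * real n \<le> real (r n)" "4 \<le> r n" by (auto simp: r_def)
      have "2 \<le> sqrt (a * real n)" using elim by (intro real_le_rsqrt) simp
      then have "(sqrt (a * real n) - 2) ^ 3 \<le> (sqrt (real (r n)) - 2) ^ 3"
        using r4 by (intro power_mono) auto
      then show ?case using *[OF r4(2)] elim by simp
    qed
  qed
  ultimately show thesis by (intro that[of K]) (auto simp: K_def)
qed

context gls_freq
begin

text \<open>Finite index sets have exponent 0, so \<open>B s\<close> is infinite. If the limit were
  at most \<open>t\<close>, then \<open>N\<close> would grow so fast that the series converges at an
  exponent still below \<open>conv_exponent\<close>. Hence the limit exceeds \<open>t\<close>; the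
  constant \<open>C\<close> covers the finitely many early indices.\<close>

lemma ln_N_growth:
  assumes s: "s \<in> S" and t: "0 < t" "t < conv_exponent B f s"
    and conv: "B s = {1..} \<longrightarrow> convergent (\<lambda>n. ln (real n) / ln (N s n))"
  obtains C where "B s = {1..}" "\<And>b. 1 \<le> b \<Longrightarrow> t * ln (N s b) \<le> ln (real b) + C"
proof -
  have below: "\<not> (\<lambda>b. N s b powr (- u)) summable_on B s" if "0 \<le> u" "u < conv_exponent B f s" for u
  proof
    assume "(\<lambda>b. N s b powr (- u)) summable_on B s"
    then have "u \<in> {t. 0 \<le> t \<and> (\<lambda>b. N s b powr (- t)) summable_on B s}" using that(1) by simp
    then have "conv_exponent B f s \<le> u"
      unfolding conv_exponent_def by (rule cInf_lower) (rule bdd_belowI[of _ 0], simp)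
    then show False using that(2) by simp
  qed
  have B: "B s = {1..}"
  proof (rule ccontr)
    assume "B s \<noteq> {1..}"
    then have "finite (B s)" using B_cases[OF s] finite_atLeastAtMost by metis
    then show False using below[of t] t by simp
  qed
  have N1: "1 < N s n" if "1 \<le> n" for n using N_gt_1[OF s, of n] B that by simp
  obtain L where L: "(\<lambda>n. ln (real n) / ln (N s n)) \<longlonglongrightarrow> L"
    using conv B by (auto simp: convergent_def)
  have "t < L"
  proof (rule ccontr)
    assume "\<not> t < L"
    \<comment> \<open>Two intermediate exponents: \<open>t1\<close> absorbs the convergence to the
      limit, and \<open>t2 / t1 > 1\<close> makes the comparison series converge.\<close>
    obtain t1 where t1: "t < t1" "t1 < conv_exponent B f s" using dense[OF t(2)] by blast
    obtain t2 where t2: "t1 < t2" "t2 < conv_exponent B f s" using dense[OF t1(2)] by blast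
    have "\<forall>\<^sub>F n in sequentially. ln (real n) / ln (N s n) < t1"
      using \<open>\<not> t < L\<close> t1 by (intro order_tendstoD[OF L]) auto
    then have "\<forall>\<^sub>F n in sequentially. norm (N s n powr (- t2)) \<le> real n powr (- (t2 / t1))"
      using eventually_ge_at_top[of 1]
    proof eventually_elim
      case (elim n)
      then have "ln (real n) < t1 * ln (N s n)" using N1[of n] by (simp add: divide_less_eq)
      then have "(t2 / t1) * ln (real n) \<le> (t2 / t1) * (t1 * ln (N s n))"
        using t t1 t2 by (intro mult_left_mono) auto
      also have "\<dots> = t2 * ln (N s n)" using t t1 by simp
      finally show ?case using elim N1[of n] by (simp add: powr_def)
    qed
    moreover have "summable (\<lambda>n. real n powr (- (t2 / t1)))"
      using t t1 t2 by (simp add: summable_real_powr_iff)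
    ultimately have "summable (\<lambda>n. N s n powr (- t2))"
      by (rule summable_comparison_test_ev)
    then have "(\<lambda>n. N s n powr (- t2)) summable_on UNIV"
      by (subst summable_on_UNIV_nonneg_real_iff) auto
    then have "(\<lambda>n. N s n powr (- t2)) summable_on B s"
      by (rule summable_on_subset_banach) simp
    then show False using below[of t2] t t1 t2 by simp
  qed
  then have "\<forall>\<^sub>F n in sequentially. t < ln (real n) / ln (N s n)"
    by (rule order_tendstoD[OF L])
  then obtain n0 where n0: "\<And>n. n0 \<le> n \<Longrightarrow> t < ln (real n) / ln (N s n)"
    by (auto simp: eventually_sequentially)
  define n1 where "n1 = max 1 n0"
  have "t * ln (N s b) \<le> ln (real b) + t * ln (N s n1)" if b: "1 \<le> b" for b
  proof (cases "n1 \<le> b")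
    case True
    then have "t * ln (N s b) < ln (real b)"
      using n0[of b] N1[OF b] by (simp add: n1_def less_divide_eq)
    moreover have "0 \<le> t * ln (N s n1)" using t N1[of n1] by (simp add: n1_def)
    ultimately show ?thesis by simp
  next
    case False
    then have "N s b \<le> N s n1" using b B by (intro N_mono[OF s]) auto
    then have "t * ln (N s b) \<le> t * ln (N s n1)" using N1[OF b] t by (intro mult_left_mono) auto
    moreover have "0 \<le> ln (real b)" using b by simp
    ultimately show ?thesis by simp
  qed
  then show thesis by (rule that[OF B])
qed

lemma len_eq_exp:
  assumes "b \<in> index_seqs B \<omega>"
  shows "len b n = exp (- (\<Sum>k<n. lnN (dig b k)))"
proof -
  have "len b n = (\<Prod>k<n. exp (- lnN (dig b k)))"
    unfolding len_def using assms N_pos[OF omega_in]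
    by (intro prod.cong) (auto simp: exp_minus index_seqs_def)
  then show ?thesis by (simp add: exp_sum sum_negf[symmetric])
qed

text \<open>On a set \<open>K\<close> of positions of density zero, all with the symbol \<open>s\<close> of maximal exponent, the digits
  of a slow sequence are replaced by digits uniform on \<open>{2^k+1..2^(k+1)}\<close>. Although sparse, these
  positions determine the size of the cylinders, since the logarithms \<open>k ln 2\<close> over \<open>K \<inter> {..<n}\<close> sum to
  order \<open>n powr (3/2)\<close>; the limit hypothesis makes the mass comparable to a power of the size.\<close>

theorem exponent_le_hausdorff_dim:
  assumes conv: "\<forall>s\<in>S. B s = {1..} \<longrightarrow> convergent (\<lambda>n. ln (real n) / ln (N s n))"
    and E: "E \<noteq> {}"
  shows "ereal (max_conv_exponent S B f) \<le> hausdorff_dim (freq_set S B f \<omega> \<alpha>)"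
proof (rule ccontr)
  assume "\<not> ?thesis"
  then obtain u :: real where u: "hausdorff_dim (freq_set S B f \<omega> \<alpha>) < ereal u" "ereal u < ereal (max_conv_exponent S B f)"
    using ereal_dense2 by (meson not_le)
  have "0 \<le> hausdorff_dim (freq_set S B f \<omega> \<alpha>)"
    unfolding hausdorff_dim_def by (intro INF_greatest) auto
  then have "ereal 0 < ereal u" using u(1) by (metis le_less_trans zero_ereal_def)
  then have u0: "0 < u" by simp
  have "max_conv_exponent S B f \<in> conv_exponent B f ` S"
    unfolding max_conv_exponent_def using finite_S S_nonempty by (intro Max_in) auto
  then obtain s where s: "s \<in> S" "u < conv_exponent B f s" using u(2) by auto
  obtain t where t: "u < t" "t < conv_exponent B f s" using dense[OF s(2)] by blast
  have t0: "0 < t" using u0 t by simp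
  obtain C0 where C0: "B s = {1..}" "\<And>b. 1 \<le> b \<Longrightarrow> t * ln (N s b) \<le> ln (real b) + C0"
    using ln_N_growth[OF s(1) t0 t(2)] conv s(1) by blast
  obtain b0 where "b0 \<in> E" using E by blast
  then obtain c where c: "c \<in> E" "\<forall>\<^sub>F k in sequentially. lnN (dig c k) \<le> real k powr (1 / 4)"
    by (rule exists_slow_seq)
  note ci = E_index[OF c(1)]
  obtain d where d: "d \<in> D" "fst d = s" "0 < \<alpha> d"
    using positive_marginals[OF s(1)] s(1) by (auto simp: digits_def)
  define P where "P = {k. dig c k = d}"
  have "(\<lambda>n. real (card {k. k < n \<and> dig c k = d}) / real n) \<longlonglongrightarrow> \<alpha> d"
    using c(1) d(1) by (simp add: freq_seqs_def)
  then have "\<forall>\<^sub>F n in sequentially. \<alpha> d / 2 < real (card {k. k < n \<and> dig c k = d}) / real n"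
    using d by (intro order_tendstoD) auto
  then have dens: "\<forall>\<^sub>F n in sequentially. \<alpha> d / 2 * real n \<le> real (card (P \<inter> {..<n}))"
    using eventually_gt_at_top[of 0]
  proof eventually_elim
    case (elim n)
    have "P \<inter> {..<n} = {k. k < n \<and> dig c k = d}" by (auto simp: P_def)
    then show ?case using elim by (simp add: field_simps)
  qed
  obtain K where K: "K \<subseteq> P" "(\<lambda>n. real (card (K \<inter> {..<n})) / real n) \<longlonglongrightarrow> 0"
    "\<And>C. \<forall>\<^sub>F n in sequentially. C * real n powr (5 / 4) \<le> real (\<Sum>k\<in>K \<inter> {..<n}. k)"
    by (rule sparse_subset[OF _ dens]) (use d in auto)
  have \<omega>K: "\<omega> k = s" if "k \<in> K" for k using that K(1) d(2) by (auto simp: P_def)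
  \<comment> \<open>The block has \<open>2 ^ k\<close> elements, so a redrawn digit has probability
    exactly \<open>2 powr -k\<close>. Its \<open>N\<close> is at least \<open>2 ^ k\<close> by
    \<open>N_ge\<close> and at most a constant times \<open>2 powr (k / t)\<close> by
    \<open>ln_N_growth\<close>.\<close>
  define p where "p k = (if k \<in> K then pmf_of_set {2 ^ k<..2 * 2 ^ k} else return_pmf (c k))" for k
  have fin: "finite {2 ^ k<..2 * 2 ^ k :: nat}" "{2 ^ k<..2 * 2 ^ k :: nat} \<noteq> {}" for k by auto
  have supp: "set_pmf (p k) \<subseteq> B (\<omega> k)" for k
    using ci C0(1) \<omega>K fin by (auto simp: p_def index_seqs_def)
  \<comment> \<open>\<open>W n\<close> will be minus the logarithm of the mass of a cylinder, and
    \<open>R n\<close> bounds the share of the positions outside \<open>K\<close> in minus the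
    logarithm of its length.\<close>
  define W where "W n = ln 2 * real (\<Sum>k\<in>K \<inter> {..<n}. k)" for n
  define R where "R n = (\<Sum>k<n. lnN (dig c k))" for n
  define C1 where "C1 = (ln 2 + \<bar>C0\<bar>) / t"
  have C1: "0 < C1" unfolding C1_def using t0 by (intro divide_pos_pos add_pos_nonneg) auto
  \<comment> \<open>The exponent obtained is \<open>t1 - \<epsilon> = u\<close>, while
    \<open>t1 < t\<close> leaves the fraction \<open>1 - t1 / t\<close> of \<open>W n\<close> to
    absorb the terms of order \<open>n powr (5/4)\<close>.\<close>
  define t1 where "t1 = (u + t) / 2"
  define \<epsilon> where "\<epsilon> = (t - u) / 2"
  have t1: "0 < t1" "0 < \<epsilon>" "t1 < t" "t1 - \<epsilon> = u"
    using u0 t by (auto simp: t1_def \<epsilon>_def field_simps)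
  have W_large: "\<forall>\<^sub>F n in sequentially. C * real n powr (5 / 4) \<le> W n" for C
    using K(3)[of "C / ln 2"] by eventually_elim (simp add: W_def field_simps)
  obtain k0 where k0: "\<And>k. k0 \<le> k \<Longrightarrow> lnN (dig c k) \<le> real k powr (1 / 4)"
    using c(2) by (auto simp: eventually_sequentially)
  have R_le: "R n \<le> R k0 + real n powr (5 / 4)" for n
  proof -
    have c0: "0 \<le> lnN (dig c k)" for k
      using ln_N_pos[OF omega_in] ci by (simp add: index_seqs_def less_imp_le)
    have "R n \<le> (\<Sum>k<n. (if k < k0 then lnN (dig c k) else 0) + real n powr (1 / 4))"
      unfolding R_def
    proof (rule sum_mono)
      fix k assume "k \<in> {..<n}"
      then have "real k powr (1 / 4) \<le> real n powr (1 / 4)" by (intro powr_mono2) auto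
      then show "lnN (dig c k) \<le> (if k < k0 then lnN (dig c k) else 0) + real n powr (1 / 4)"
        using k0[of k] by auto
    qed
    also have "\<dots> = (\<Sum>k\<in>{..<n} \<inter> {k. k < k0}. lnN (dig c k)) + real n * real n powr (1 / 4)"
      by (simp add: sum.distrib sum.If_cases)
    also have "\<dots> \<le> R k0 + real n powr (5 / 4)"
      unfolding R_def using c0 by (intro add_mono sum_mono2) (auto simp: powr_mult_base)
    finally show ?thesis .
  qed
  \<comment> \<open>The first inequality compares mass and length; the other two bound the next
    digit, at a position in \<open>K\<close> and outside \<open>K\<close> respectively.\<close>
  have ineqs: "\<forall>\<^sub>F n in sequentially.
      (t1 / t) * W n + t1 * (C1 * real n + R n) \<le> W n \<and> C1 * (real n + 1) \<le> \<epsilon> * W n \<and>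
      real n powr (1 / 4) \<le> \<epsilon> * W n"
    using W_large[of "(t1 * (C1 + \<bar>R k0\<bar> + 1)) / (1 - t1 / t)"] W_large[of "2 * C1 / \<epsilon>"]
      W_large[of "1 / \<epsilon>"] eventually_ge_at_top[of 1]
  proof eventually_elim
    case (elim n)
    have n1: "1 \<le> real n powr (5 / 4)" using elim by (intro ge_one_powr_ge_zero) auto
    have n2: "real n \<le> real n powr (5 / 4)" using elim powr_mono[of 1 "5/4" "real n"] by simp
    have n3: "real n powr (1 / 4) \<le> real n powr (5 / 4)" using elim by (intro powr_mono) auto
    have tt: "0 < 1 - t1 / t" using t1 t0 by simp
    have "C1 * real n + R n \<le> C1 * real n powr (5 / 4) + (\<bar>R k0\<bar> * real n powr (5 / 4) + real n powr (5 / 4))"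
    proof -
      have "C1 * real n \<le> C1 * real n powr (5 / 4)" using C1 n2 by (intro mult_left_mono) auto
      moreover have "\<bar>R k0\<bar> * 1 \<le> \<bar>R k0\<bar> * real n powr (5 / 4)" using n1 by (intro mult_left_mono) auto
      ultimately show ?thesis using R_le[of n] by linarith
    qed
    then have "t1 * (C1 * real n + R n) \<le> t1 * (C1 * real n powr (5 / 4) + (\<bar>R k0\<bar> * real n powr (5 / 4) + real n powr (5 / 4)))"
      using t1 by (intro mult_left_mono) auto
    also have "\<dots> = (1 - t1 / t) * ((t1 * (C1 + \<bar>R k0\<bar> + 1)) / (1 - t1 / t) * real n powr (5 / 4))"
    proof -
      have "(1 - t1 / t) * (x / (1 - t1 / t) * y) = x * y" for x y using tt t1(3) by auto
      then show ?thesis by (simp only: distrib_left distrib_right mult.assoc mult_1)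
    qed
    also have "\<dots> \<le> (1 - t1 / t) * W n"
      using elim(1) tt by (intro mult_left_mono) auto
    finally have 1: "(t1 / t) * W n + t1 * (C1 * real n + R n) \<le> W n" by (simp add: algebra_simps)
    have "C1 * (real n + 1) \<le> C1 * (2 * real n powr (5 / 4))"
      using C1 n1 n2 by (intro mult_left_mono) auto
    also have "\<dots> = \<epsilon> * (2 * C1 / \<epsilon> * real n powr (5 / 4))" using t1 by simp
    also have "\<dots> \<le> \<epsilon> * W n" using elim(2) t1 by (intro mult_left_mono) auto
    finally have 2: "C1 * (real n + 1) \<le> \<epsilon> * W n" .
    have "real n powr (1 / 4) \<le> \<epsilon> * (1 / \<epsilon> * real n powr (5 / 4))" using n3 t1 by simp
    also have "\<dots> \<le> \<epsilon> * W n" using elim(3) t1 by (intro mult_left_mono) auto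
    finally show ?case using 1 2 by simp
  qed
  have "ereal (t1 - \<epsilon>) \<le> hausdorff_dim (freq_set S B f \<omega> \<alpha>)"
  proof (rule mass_distribution[OF supp t1(1,2)])
    show "AE b in product_law p. coding f \<omega> b \<in> freq_set S B f \<omega> \<alpha> \<and>
       (\<forall>\<^sub>F n in sequentially. cyl_mass p b n \<le> len b n powr t1 \<and> len b n powr \<epsilon> * N (\<omega> n) (b n) \<le> 1)"
      using AE_in_support
    proof eventually_elim
      case (elim b)
      have bi: "b \<in> index_seqs B \<omega>" using elim supp by (auto simp: index_seqs_def)
      have b_off: "b k = c k" if "k \<notin> K" for k using elim that by (auto simp: p_def dest: spec[of _ k])
      have b_on: "2 ^ k < b k" "b k \<le> 2 * 2 ^ k" if "k \<in> K" for k
        using elim[rule_format, of k] that fin[of k] by (auto simp: p_def)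
      have "b \<in> E"
      proof (rule density_0_change[OF c(1) bi])
        have "card {k. k < n \<and> c k \<noteq> b k} \<le> card (K \<inter> {..<n})" for n
          by (intro card_mono) (auto, metis b_off)
        then show "(\<lambda>n. real (card {k. k < n \<and> c k \<noteq> b k}) / real n) \<longlonglongrightarrow> 0"
          by (intro Lim_null_comparison[OF always_eventually K(2)]) (simp add: divide_right_mono)
      qed
      then have F: "coding f \<omega> b \<in> freq_set S B f \<omega> \<alpha>" by (simp add: freq_set_def)
      have lnN_nonneg: "0 \<le> lnN (dig b k)" for k
        using ln_N_pos[OF omega_in] bi by (simp add: index_seqs_def less_imp_le)
      have on_le: "lnN (dig b k) \<le> real k * ln 2 / t + C1" if "k \<in> K" for k
      proof -
        have "1 \<le> b k" using b_on[OF that] by simp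
        then have 1: "t * ln (N s (b k)) \<le> ln (real (b k)) + C0" by (rule C0(2))
        have "real (b k) \<le> real (2 * 2 ^ k)" using b_on[OF that] by (simp only: of_nat_le_iff)
        then have "ln (real (b k)) \<le> ln (real (2 * 2 ^ k))" using \<open>1 \<le> b k\<close> by (intro ln_mono) auto
        also have "\<dots> = ln 2 + real k * ln 2" by (simp add: ln_mult ln_realpow)
        finally have "t * ln (N s (b k)) \<le> real k * ln 2 + (ln 2 + \<bar>C0\<bar>)" using 1 by linarith
        then have "ln (N s (b k)) \<le> (real k * ln 2 + (ln 2 + \<bar>C0\<bar>)) / t"
          using t0 by (simp add: le_divide_eq mult.commute)
        then show ?thesis using \<omega>K[OF that] by (simp add: C1_def add_divide_distrib)
      qed
      have on_ge: "real k * ln 2 \<le> lnN (dig b k)" if "k \<in> K" for k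
      proof -
        have "real (2 ^ k) \<le> real (b k)" using b_on[OF that] by (simp only: of_nat_le_iff)
        also have "\<dots> \<le> N s (b k)"
          using b_on[OF that] C0(1) s(1) by (intro N_ge) auto
        finally have "ln (2 ^ k) \<le> ln (N s (b k))" by (intro ln_mono) auto
        then show ?thesis using \<omega>K[OF that] by (simp add: ln_realpow)
      qed
      define \<Lambda> where "\<Lambda> n = (\<Sum>k<n. lnN (dig b k))" for n
      have \<Lambda>_ge: "W n \<le> \<Lambda> n" for n
      proof -
        have "W n = (\<Sum>k\<in>K \<inter> {..<n}. real k * ln 2)"
          by (simp add: W_def sum_distrib_left mult.commute)
        also have "\<dots> \<le> (\<Sum>k\<in>K \<inter> {..<n}. lnN (dig b k))" using on_ge by (intro sum_mono) auto
        also have "\<dots> \<le> \<Lambda> n" unfolding \<Lambda>_def using lnN_nonneg by (intro sum_mono2) auto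
        finally show ?thesis .
      qed
      have \<Lambda>_le: "\<Lambda> n \<le> W n / t + (C1 * real n + R n)" for n
      proof -
        have "\<Lambda> n \<le> (\<Sum>k<n. (if k \<in> K then real k * ln 2 / t else 0) + (C1 + lnN (dig c k)))"
          unfolding \<Lambda>_def
        proof (rule sum_mono)
          fix k
          have "0 \<le> lnN (dig c k)" using ln_N_pos[OF omega_in] ci by (simp add: index_seqs_def less_imp_le)
          then show "lnN (dig b k) \<le> (if k \<in> K then real k * ln 2 / t else 0) + (C1 + lnN (dig c k))"
            using on_le[of k] b_off[of k] C1 by auto
        qed
        also have "\<dots> = (\<Sum>k\<in>K \<inter> {..<n}. real k * ln 2 / t) + (C1 * real n + R n)"
          by (simp add: sum.distrib sum.If_cases R_def Int_commute mult.commute)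
        also have "(\<Sum>k\<in>K \<inter> {..<n}. real k * ln 2 / t) = W n / t"
          by (simp add: W_def sum_distrib_left sum_divide_distrib mult.commute)
        finally show ?thesis .
      qed
      have mass: "cyl_mass p b n = exp (- W n)" for n
      proof -
        have "cyl_mass p b n = (\<Prod>k<n. if k \<in> K then exp (- (real k * ln 2)) else 1)"
          unfolding cyl_mass_def
        proof (rule prod.cong[OF refl])
          fix k
          show "pmf (p k) (b k) = (if k \<in> K then exp (- (real k * ln 2)) else 1)"
          proof (cases "k \<in> K")
            case True
            have "exp (- (real k * ln 2)) = 1 / 2 ^ k"
              by (simp add: exp_minus exp_of_nat_mult inverse_eq_divide)
            then show ?thesis using True b_on[OF True] fin[of k] by (simp add: p_def)
          qed (simp add: p_def b_off)
        qed
        also have "\<dots> = (\<Prod>k\<in>K \<inter> {..<n}. exp (- (real k * ln 2)))"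
          by (simp add: prod.If_cases Int_commute)
        also have "\<dots> = exp (- W n)"
          by (simp add: exp_sum[symmetric] W_def sum_distrib_left sum_negf mult.commute)
        finally show ?thesis .
      qed
      have len: "len b n powr x = exp (- (x * \<Lambda> n))" for n x
        using len_eq_exp[OF bi] by (simp add: \<Lambda>_def powr_def)
      have "\<forall>\<^sub>F n in sequentially. cyl_mass p b n \<le> len b n powr t1 \<and> len b n powr \<epsilon> * N (\<omega> n) (b n) \<le> 1"
        using ineqs eventually_ge_at_top[of k0]
      proof eventually_elim
        case (elim n)
        have "t1 * \<Lambda> n \<le> t1 * (W n / t + (C1 * real n + R n))"
          using \<Lambda>_le t1 by (intro mult_left_mono) auto
        also have "\<dots> \<le> W n" using elim by (simp add: algebra_simps)
        finally have 1: "cyl_mass p b n \<le> len b n powr t1" unfolding mass len by simp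
        have "lnN (dig b n) \<le> \<epsilon> * W n"
        proof (cases "n \<in> K")
          case True
          have "real n * (ln 2 / t) \<le> real n * C1"
            unfolding C1_def using t0 by (intro mult_left_mono divide_right_mono) auto
          then show ?thesis using on_le[OF True] elim by (simp add: algebra_simps)
        next
          case False
          then show ?thesis using k0[of n] elim by (simp add: b_off)
        qed
        also have "\<dots> \<le> \<epsilon> * \<Lambda> n" using \<Lambda>_ge t1 by (intro mult_left_mono) auto
        finally have 2: "lnN (dig b n) \<le> \<epsilon> * \<Lambda> n" .
        have "N (\<omega> n) (b n) = exp (lnN (dig b n))"
          using N_pos[OF omega_in, of "b n" n] bi by (simp add: index_seqs_def)
        also have "\<dots> \<le> exp (\<epsilon> * \<Lambda> n)" using 2 by (simp only: exp_le_cancel_iff)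
        finally have "N (\<omega> n) (b n) \<le> exp (\<epsilon> * \<Lambda> n)" .
        then have "len b n powr \<epsilon> * N (\<omega> n) (b n) \<le> exp (- (\<epsilon> * \<Lambda> n)) * exp (\<epsilon> * \<Lambda> n)"
          unfolding len by (intro mult_left_mono) auto
        then show ?case using 1 by (simp flip: exp_add)
      qed
      then show ?case using F by simp
    qed
  qed
  then show False using u(1) t1(4) by simp
qed

end

section \<open>Lower bound by the fibre dimension\<close>

lemma indep_vars_product_pmf:
  "prob_space.indep_vars (PiM UNIV (\<lambda>k. measure_pmf (p k))) (\<lambda>k. measure_pmf (p k)) (\<lambda>k b. b k) UNIV"
proof -
  interpret prob_space "PiM UNIV (\<lambda>k. measure_pmf (p k))"
    by (intro prob_space_PiM measure_pmf.prob_space_axioms)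
  show ?thesis
    by (subst indep_vars_iff_distr_eq_PiM')
      (simp_all add: distr_PiM_component[OF measure_pmf.prob_space_axioms] distr_id restrict_UNIV)
qed

text \<open>The indicators are independent but not identically distributed, since \<open>p\<close>
  and \<open>A\<close> vary with the position. They are bounded by 1, so Hoeffding's inequality
  gives exponentially small, hence summable, deviation probabilities, and Borel-Cantelli applies for
  each tolerance \<open>1 / (j + 1)\<close>.\<close>

lemma strong_law_counts:
  fixes p :: "nat \<Rightarrow> 'a pmf" and A :: "nat \<Rightarrow> 'a set"
  shows "AE b in PiM UNIV (\<lambda>k. measure_pmf (p k)).
    (\<lambda>n. (real (card {k. k < n \<and> b k \<in> A k}) - (\<Sum>k<n. measure (p k) (A k))) / real n) \<longlonglongrightarrow> 0"
proof -
  define M where "M = PiM UNIV (\<lambda>k. measure_pmf (p k))"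
  interpret prob_space M
    unfolding M_def by (intro prob_space_PiM measure_pmf.prob_space_axioms)
  define X where "X k b = (indicator (A k) (b k) :: real)" for k and b :: "nat \<Rightarrow> 'a"
  have indep: "indep_vars (\<lambda>_. borel) X UNIV"
    unfolding X_def M_def
    by (rule prob_space.indep_vars_compose2[OF _ indep_vars_product_pmf])
      (auto intro: prob_space_PiM measure_pmf.prob_space_axioms)
  have X_meas [measurable]: "X k \<in> borel_measurable M" for k
    using indep by (simp add: indep_vars_def)
  have EX: "expectation (X k) = measure (p k) (A k)" for k
  proof -
    have c: "(\<lambda>b. b k) \<in> measurable M (measure_pmf (p k))"
      unfolding M_def by (rule measurable_component_singleton) simp
    have "expectation (X k) = integral\<^sup>L (distr M (measure_pmf (p k)) (\<lambda>b. b k)) (indicator (A k))"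
      unfolding X_def by (subst integral_distr[OF c]) auto
    also have "distr M (measure_pmf (p k)) (\<lambda>b. b k) = measure_pmf (p k)"
      unfolding M_def by (rule distr_PiM_component) (auto intro: measure_pmf.prob_space_axioms)
    finally show ?thesis by simp
  qed
  define Y where "Y n b = (\<Sum>k<n. X k b) - (\<Sum>k<n. measure (p k) (A k))" for n b
  have Y_meas [measurable]: "Y n \<in> borel_measurable M" for n
    unfolding Y_def by measurable
  have prob_le: "prob {b \<in> space M. \<epsilon> * real n \<le> \<bar>Y n b\<bar>} \<le> 2 * exp (- 2 * \<epsilon>\<^sup>2) ^ n"
    if "0 < \<epsilon>" for \<epsilon> n
  proof (cases "n = 0")
    case True
    have "prob {b \<in> space M. \<epsilon> * real n \<le> \<bar>Y n b\<bar>} \<le> 1" by (rule prob_le_1)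
    also have "\<dots> \<le> 2 * exp (- 2 * \<epsilon>\<^sup>2) ^ n" using True by simp
    finally show ?thesis .
  next
    case False
    interpret H: Hoeffding_ineq M "{..<n}" X "\<lambda>_. 0" "\<lambda>_. 1" "\<Sum>k<n. expectation (X k)"
      by unfold_locales (use indep_vars_subset[OF indep] in \<open>auto simp: X_def indicator_def\<close>)
    have "prob {b \<in> space M. \<epsilon> * real n \<le> \<bar>Y n b\<bar>}
        \<le> 2 * exp (- 2 * (\<epsilon> * real n)\<^sup>2 / (\<Sum>k<n. (1 - 0)\<^sup>2))"
      unfolding Y_def EX[symmetric] using that False by (intro H.Hoeffding_ineq_abs_ge) auto
    also have "- 2 * (\<epsilon> * real n)\<^sup>2 / (\<Sum>k<n. (1 - 0)\<^sup>2) = real n * (- 2 * \<epsilon>\<^sup>2)"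
      using False by (simp add: power2_eq_square)
    also have "2 * exp (real n * (- 2 * \<epsilon>\<^sup>2)) = 2 * exp (- 2 * \<epsilon>\<^sup>2) ^ n"
      by (simp only: exp_of_nat_mult)
    finally show ?thesis .
  qed
  have dev: "AE b in M. \<forall>\<^sub>F n in sequentially. \<bar>Y n b\<bar> < \<epsilon> * real n" if "0 < \<epsilon>" for \<epsilon> :: real
  proof -
    have "AE b in M. \<forall>\<^sub>F n in sequentially. b \<in> space M - {b \<in> space M. \<epsilon> * real n \<le> \<bar>Y n b\<bar>}"
    proof (rule borel_cantelli_AE1)
      have "summable (\<lambda>n. exp (- 2 * \<epsilon>\<^sup>2) ^ n)"
        using that by (intro summable_geometric) simp
      then have "summable (\<lambda>n. 2 * exp (- 2 * \<epsilon>\<^sup>2) ^ n)" by (rule summable_mult)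
      then show "summable (\<lambda>n. prob {b \<in> space M. \<epsilon> * real n \<le> \<bar>Y n b\<bar>})"
        by (rule summable_comparison_test[rotated]) (use prob_le[OF that] in auto)
    qed (auto simp: less_top[symmetric])
    then show ?thesis by eventually_elim (auto elim: eventually_mono)
  qed
  have "AE b in M. \<forall>\<^sub>F n in sequentially. \<bar>Y n b\<bar> < 1 / real (Suc j) * real n" for j
    by (rule dev) simp
  then have "AE b in M. \<forall>j. \<forall>\<^sub>F n in sequentially. \<bar>Y n b\<bar> < 1 / real (Suc j) * real n"
    by (simp add: AE_all_countable)
  then have "AE b in M. (\<lambda>n. Y n b / real n) \<longlonglongrightarrow> 0"
  proof eventually_elim
    case (elim b)
    show ?case
    proof (rule LIMSEQ_I)
      fix r :: real assume "0 < r"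
      then obtain j where j: "1 / real (Suc j) < r" using nat_approx_posE by blast
      have "\<forall>\<^sub>F n in sequentially. norm (Y n b / real n - 0) < r"
        using elim[rule_format, of j] eventually_gt_at_top[of 0]
      proof eventually_elim
        case (elim n)
        have "\<bar>Y n b\<bar> / real n < 1 / real (Suc j)"
          using elim by (simp add: divide_less_eq)
        then show ?case using j by simp
      qed
      then show "\<exists>no. \<forall>n\<ge>no. norm (Y n b / real n - 0) < r"
        by (simp add: eventually_sequentially)
    qed
  qed
  moreover have "(\<Sum>k<n. X k b) = real (card {k. k < n \<and> b k \<in> A k})" for n b
  proof -
    have "(\<Sum>k<n. X k b) = (\<Sum>k<n. if b k \<in> A k then 1 else 0)"
      by (intro sum.cong) (auto simp: X_def)
    then show ?thesis by (simp only: sum_if_eq_card mult_1)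
  qed
  ultimately show ?thesis unfolding M_def[symmetric] by (simp add: Y_def)
qed

context gls_freq
begin

section \<open>Redrawing the digits up to a bound\<close>

definition cond_weight :: "nat \<Rightarrow> 's \<Rightarrow> nat \<Rightarrow> real" where
  "cond_weight m s b = (if b \<in> B s \<and> b \<le> m then \<alpha> (s, b) / marg_upto m s else 0)"

text \<open>The law of a digit given its symbol and given that it is at most \<open>m\<close>. It is
  meaningful only when \<open>marg_upto m s\<close> is positive, which holds for all large
  \<open>m\<close>.\<close>

definition cond_pmf :: "nat \<Rightarrow> 's \<Rightarrow> nat pmf" where
  "cond_pmf m s = embed_pmf (cond_weight m s)"

lemma pmf_cond_pmf:
  assumes s: "s \<in> S" and pos: "0 < marg_upto m s"
  shows "pmf (cond_pmf m s) b = cond_weight m s b"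
  unfolding cond_pmf_def
proof (rule pmf_embed_pmf)
  have nonneg: "0 \<le> \<alpha> (s, b)" if "b \<in> B s" for b
    using that s \<alpha>_nonneg by (simp add: digits_def)
  then show cw: "0 \<le> cond_weight m s b" for b
    using pos by (simp add: cond_weight_def)
  have "(\<integral>\<^sup>+ b. ennreal (cond_weight m s b) \<partial>count_space UNIV)
      = (\<Sum>b\<in>B s \<inter> {..m}. ennreal (cond_weight m s b))"
    by (rule nn_integral_count_space') (auto simp: cond_weight_def)
  also have "\<dots> = ennreal (\<Sum>b\<in>B s \<inter> {..m}. cond_weight m s b)"
    using cw by (intro sum_ennreal) auto
  also have "(\<Sum>b\<in>B s \<inter> {..m}. cond_weight m s b) = (\<Sum>b\<in>B s \<inter> {..m}. \<alpha> (s, b) / marg_upto m s)"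
    by (intro sum.cong) (auto simp: cond_weight_def)
  also have "\<dots> = 1"
    using pos by (simp add: marg_upto_def flip: sum_divide_distrib)
  finally show "(\<integral>\<^sup>+ b. ennreal (cond_weight m s b) \<partial>count_space UNIV) = 1" by simp
qed

text \<open>Only the digits up to \<open>m\<close> of the reference sequence \<open>c\<close> are redrawn, so that a finite alphabet
  suffices and the frequencies of the digits above \<open>m\<close> are those of \<open>c\<close>.\<close>

lemma AE_redrawn_in_E:
  assumes c: "c \<in> E" and pos: "\<And>s. s \<in> S \<Longrightarrow> 0 < marg_upto m s"
    and p: "\<And>k. p k = (if c k \<le> m then cond_pmf m (\<omega> k) else return_pmf (c k))"
  shows "AE b in product_law p. b \<in> E"
proof -
  note ci = E_index[OF c]
  have supp: "b k \<in> B (\<omega> k) \<and> (b k \<le> m \<longleftrightarrow> c k \<le> m) \<and> (m < c k \<longrightarrow> b k = c k)" if "b k \<in> set_pmf (p k)" for b k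
  proof (cases "c k \<le> m")
    case True
    then show ?thesis
      using that by (auto simp: p set_pmf_iff pmf_cond_pmf[OF omega_in pos[OF omega_in]] cond_weight_def split: if_splits)
  next
    case False
    then show ?thesis using that ci by (auto simp: p index_seqs_def)
  qed
  \<comment> \<open>The event that position \<open>k\<close> carries \<open>d\<close>, empty where
    the symbol is wrong; this puts counts of \<open>d\<close> into the form of the strong
    law.\<close>
  define A where "A d k = (if \<omega> k = fst d then {snd d} else {})" for d :: "'s \<times> nat" and k :: nat
  \<comment> \<open>Positions where \<open>c\<close> has the symbol of \<open>d\<close> and a digit
    at most \<open>m\<close> have density \<open>marg_upto m (fst d)\<close>, which cancels the
    normalisation of the conditional law.\<close>
  have meas: "(\<lambda>n. (\<Sum>k<n. measure (p k) (A d k)) / real n) \<longlonglongrightarrow> \<alpha> d" if d: "d \<in> Dm m" for d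
  proof -
    have dS: "fst d \<in> S" "snd d \<in> B (fst d)" "snd d \<le> m" using d by (auto simp: digits_upto_def digits_def)
    define G where "G = {e \<in> Dm m. fst e = fst d}"
    have G: "finite G" "G \<subseteq> D" using finite_Dm Dm_subset by (auto simp: G_def)
    define X where "X e = (if e \<in> G then \<alpha> d / marg_upto m (fst d) else 0)" for e
    have "measure (p k) (A d k) = X (dig c k)" for k
    proof (cases "\<omega> k = fst d")
      case True
      then have "dig c k \<in> G \<longleftrightarrow> c k \<le> m" using dig_in_Dm[OF ci, of k m] by (simp add: G_def)
      then show ?thesis
        using dS True by (auto simp: A_def X_def p measure_pmf_single pmf_cond_pmf[OF dS(1) pos[OF dS(1)]] cond_weight_def)
    qed (simp add: A_def X_def G_def)
    moreover have "(\<lambda>n. (\<Sum>k<n. X (dig c k)) / real n) \<longlonglongrightarrow> (\<Sum>e\<in>G. \<alpha> e * X e) + 0 * (1 - sum \<alpha> G)"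
      by (intro digit_average_tendsto c G) (simp add: X_def)
    moreover have "(\<Sum>e\<in>G. \<alpha> e * X e) = \<alpha> d"
    proof -
      have "(\<Sum>e\<in>G. \<alpha> e * X e) = (\<Sum>e\<in>G. \<alpha> e) * (\<alpha> d / marg_upto m (fst d))"
        unfolding sum_distrib_right by (intro sum.cong) (auto simp: X_def)
      also have "(\<Sum>e\<in>G. \<alpha> e) = marg_upto m (fst d)"
      proof -
        have G_eq: "G = Pair (fst d) ` (B (fst d) \<inter> {..m})"
          using dS by (auto simp: G_def Dm_def')
        show ?thesis
          unfolding G_eq by (subst sum.reindex) (auto simp: marg_upto_def inj_on_def)
      qed
      finally show ?thesis using pos[OF dS(1)] by simp
    qed
    ultimately show ?thesis by simp
  qed
  have "AE b in product_law p. \<forall>d\<in>Dm m.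
     (\<lambda>n. (real (card {k. k < n \<and> b k \<in> A d k}) - (\<Sum>k<n. measure (p k) (A d k))) / real n) \<longlonglongrightarrow> 0"
    by (intro AE_finite_allI finite_Dm strong_law_counts)
  then show ?thesis using AE_in_support
  proof eventually_elim
    case (elim b)
    have sb: "b k \<in> B (\<omega> k)" "b k \<le> m \<longleftrightarrow> c k \<le> m" "m < c k \<Longrightarrow> b k = c k" for k
      using supp elim(2) by blast+
    have "(\<lambda>n. real (card {k. k < n \<and> dig b k = d}) / real n) \<longlonglongrightarrow> \<alpha> d" if d: "d \<in> D" for d
    proof (cases "d \<in> Dm m")
      case True
      have "b k \<in> A d k \<longleftrightarrow> dig b k = d" for k by (cases d) (auto simp: A_def)
      then have "(\<lambda>n. (real (card {k. k < n \<and> dig b k = d}) - (\<Sum>k<n. measure (p k) (A d k))) / real n) \<longlonglongrightarrow> 0"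
        using bspec[OF elim(1) True] by simp
      then have "(\<lambda>n. (real (card {k. k < n \<and> dig b k = d}) - (\<Sum>k<n. measure (p k) (A d k))) / real n
          + (\<Sum>k<n. measure (p k) (A d k)) / real n) \<longlonglongrightarrow> 0 + \<alpha> d"
        by (rule tendsto_add[OF _ meas[OF True]])
      then show ?thesis by (simp add: diff_divide_distrib)
    next
      case False
      then have "m < snd d" using d by (cases d) (auto simp: digits_upto_def)
      \<comment> \<open>Redrawn digits stay at most \<open>m\<close>, so digits above
        \<open>m\<close> sit at the same positions in \<open>b\<close> and \<open>c\<close>.\<close>
      have "dig b k = d \<longleftrightarrow> dig c k = d" for k
        using sb[of k] \<open>m < snd d\<close> by (cases "c k \<le> m") auto
      then show ?thesis using c d by (simp add: freq_seqs_def)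
    qed
    then show ?case using sb(1) by (simp add: freq_seqs_def index_seqs_def)
  qed
qed

text \<open>The two expressions share the digit terms. What remains is a sum over the finitely many
  symbols of \<open>x ln x\<close> at truncated and full marginals, and continuity at the positive
  full marginals gives the limit.\<close>

lemma truncated_entropy_tendsto:
  "(\<lambda>m. (\<Sum>d\<in>Dm m. \<alpha> d * (ln (marg_upto m (fst d)) - ln (\<alpha> d))) - num m) \<longlonglongrightarrow> 0"
proof -
  have "(\<lambda>m. (\<Sum>s\<in>S. marg_upto m s * ln (marg_upto m s)) - (\<Sum>s\<in>S. marg s * ln (marg s))) \<longlonglongrightarrow>
      (\<Sum>s\<in>S. marg s * ln (marg s)) - (\<Sum>s\<in>S. marg s * ln (marg s))"
    by (intro tendsto_intros marg_upto_tendsto) (use marg_pos in \<open>auto simp: less_le\<close>)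
  moreover have "(\<Sum>d\<in>Dm m. \<alpha> d * (ln (marg_upto m (fst d)) - ln (\<alpha> d))) - num m
      = (\<Sum>s\<in>S. marg_upto m s * ln (marg_upto m s)) - (\<Sum>s\<in>S. marg s * ln (marg s))" for m
    using sum_Dm_marg[where m = m and g = "\<lambda>s. ln (marg_upto m s)"]
    by (simp add: num_def right_diff_distrib sum_subtractf)
  ultimately show ?thesis by simp
qed

text \<open>After redrawing, minus the logarithm of the mass grows like \<open>n * h m\<close>, and
  minus the logarithm of the length is asymptotically at most \<open>n * L\<close>, where
  \<open>L\<close> is the limit of \<open>lyap\<close>. A finite \<open>L\<close> is what keeps the
  digits above \<open>m\<close>, inherited from the slow sequence, at a total cost of about
  \<open>n * (L - lyap m)\<close>.\<close>

theorem fibre_dim_le_hausdorff_dim: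
  assumes E: "E \<noteq> {}" and bdd: "\<And>m. lyap m \<le> M"
  shows "fibre_dim S B f \<alpha> \<le> hausdorff_dim (freq_set S B f \<omega> \<alpha>)"
proof (rule ccontr)
  assume "\<not> ?thesis"
  then obtain u :: real where u: "hausdorff_dim (freq_set S B f \<omega> \<alpha>) < ereal u" "ereal u < fibre_dim S B f \<alpha>"
    using ereal_dense2 by (meson not_le)
  obtain v :: real where v: "ereal u < ereal v" "ereal v < fibre_dim S B f \<alpha>"
    using ereal_dense2[OF u(2)] by blast
  have "0 \<le> hausdorff_dim (freq_set S B f \<omega> \<alpha>)"
    unfolding hausdorff_dim_def by (intro INF_greatest) auto
  then have "ereal 0 < ereal u" using u(1) by (metis le_less_trans zero_ereal_def)
  then have u0: "0 < u" "u < v" using v by auto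
  obtain l where l: "0 < l" "\<forall>\<^sub>F m in sequentially. l \<le> lyap m"
    by (rule lyap_eventually_pos)
  obtain L where L: "lyap \<longlonglongrightarrow> L" "\<And>m. lyap m \<le> L"
    using incseq_convergent[OF mono_lyap, of M] bdd by auto
  have L0: "0 < L"
    using l eventually_sequentially L(2) by (metis le_refl less_le_trans)
  define t1 where "t1 = (u + v) / 2"
  define \<epsilon> where "\<epsilon> = (v - u) / 2"
  have t1: "0 < t1" "0 < \<epsilon>" "t1 < v" "t1 - \<epsilon> = u"
    using u0 by (auto simp: t1_def \<epsilon>_def field_simps)
  \<comment> \<open>Chosen to give \<open>t1 * (L + \<delta>) = v * L - 4 * \<delta>\<close>. Two
    \<open>\<delta>\<close> are lost when \<open>h m\<close> replaces \<open>v * L\<close>, one more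
    in the average of \<open>Y\<close>.\<close>
  define \<delta> where "\<delta> = (v - t1) * L / (t1 + 4)"
  have \<delta>: "0 < \<delta>" using t1 L0 by (simp add: \<delta>_def)
  have "\<delta> * (t1 + 4) = (v - t1) * L" using t1 by (simp add: \<delta>_def)
  then have key: "t1 * (L + \<delta>) \<le> v * L - 3 * \<delta>" using \<delta> by (simp add: algebra_simps)
  define h where "h m = (\<Sum>d\<in>Dm m. \<alpha> d * (ln (marg_upto m (fst d)) - ln (\<alpha> d)))" for m
  have "\<forall>\<^sub>F m in sequentially. v * L - 2 * \<delta> < h m \<and> (\<forall>s\<in>S. 0 < marg_upto m s)"
  proof (rule eventually_conj)
    have "\<forall>\<^sub>F m in sequentially. ereal v < ereal (num m / lyap m)"
      using v(2) unfolding fibre_dim_eq by (rule less_LiminfD)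
    moreover have "\<forall>\<^sub>F m in sequentially. v * L - \<delta> < v * lyap m"
      using \<delta> by (intro order_tendstoD[OF tendsto_mult[OF tendsto_const L(1)]]) auto
    moreover have "\<forall>\<^sub>F m in sequentially. - \<delta> < h m - num m"
      unfolding h_def using \<delta> by (intro order_tendstoD[OF truncated_entropy_tendsto]) auto
    ultimately show "\<forall>\<^sub>F m in sequentially. v * L - 2 * \<delta> < h m"
      using l(2)
    proof eventually_elim
      case (elim m)
      then have "v * lyap m < num m" using l(1) by (simp add: less_divide_eq)
      then show ?case using elim by linarith
    qed
    show "\<forall>\<^sub>F m in sequentially. \<forall>s\<in>S. 0 < marg_upto m s"
      using finite_S marg_pos by (intro eventually_ball_finite ballI order_tendstoD[OF marg_upto_tendsto]) auto
  qed
  then obtain m where m: "v * L - 2 * \<delta> < h m" "\<And>s. s \<in> S \<Longrightarrow> 0 < marg_upto m s"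
    by (auto simp: eventually_sequentially)
  obtain b0 where "b0 \<in> E" using E by blast
  then obtain c where c: "c \<in> E" "\<forall>\<^sub>F k in sequentially. lnN (dig c k) \<le> real k powr (1 / 4)"
    "\<forall>M \<epsilon>. (\<forall>m. lyap m \<le> M) \<longrightarrow> 0 < \<epsilon> \<longrightarrow>
       (\<forall>\<^sub>F n in sequentially. (\<Sum>k<n. lnN (dig c k)) \<le> real n * (M + \<epsilon>))"
    by (rule exists_slow_seq)
  note ci = E_index[OF c(1)]
  define p where "p k = (if c k \<le> m then cond_pmf m (\<omega> k) else return_pmf (c k))" for k
  note pmf_p = pmf_cond_pmf[OF omega_in m(2)[OF omega_in]]
  have supp_p: "b \<in> B (\<omega> k) \<and> (b \<le> m \<longleftrightarrow> c k \<le> m) \<and> (m < c k \<longrightarrow> b = c k) \<and> (c k \<le> m \<longrightarrow> 0 < \<alpha> (\<omega> k, b))"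
    if "b \<in> set_pmf (p k)" for b k
  proof (cases "c k \<le> m")
    case True
    then have "b \<in> B (\<omega> k)" "b \<le> m" "\<alpha> (\<omega> k, b) \<noteq> 0"
      using that by (auto simp: p_def set_pmf_iff pmf_p cond_weight_def split: if_splits)
    moreover have "0 \<le> \<alpha> (\<omega> k, b)" using \<open>b \<in> B (\<omega> k)\<close> omega_in \<alpha>_nonneg by (simp add: digits_def)
    ultimately show ?thesis using True by simp
  next
    case False
    then show ?thesis using that ci by (auto simp: p_def index_seqs_def)
  qed
  have supp: "set_pmf (p k) \<subseteq> B (\<omega> k)" for k using supp_p by blast
  \<comment> \<open>Both functions vanish off \<open>Dm m\<close>, so their averages are determined
    by the frequencies; \<open>Y\<close> is minus the logarithm of the probability of a redrawn
    digit.\<close>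
  define Xm where "Xm d = (if d \<in> Dm m then lnN d else 0)" for d
  define Y where "Y d = (if d \<in> Dm m then ln (marg_upto m (fst d)) - ln (\<alpha> d) else 0)" for d
  have Xm_lim: "(\<lambda>n. (\<Sum>k<n. Xm (dig b k)) / real n) \<longlonglongrightarrow> lyap m" if "b \<in> E" for b
    using digit_average_tendsto[OF that finite_Dm[of m] Dm_subset, where X = Xm and K = 0]
    by (simp add: Xm_def lyap_def cong: sum.cong)
  have Y_lim: "(\<lambda>n. (\<Sum>k<n. Y (dig b k)) / real n) \<longlonglongrightarrow> h m" if "b \<in> E" for b
    using digit_average_tendsto[OF that finite_Dm[of m] Dm_subset, where X = Y and K = 0]
    by (simp add: Y_def h_def cong: sum.cong)
  define c2 where "c2 = (\<Sum>d\<in>Dm m. lnN d)"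
  have c2: "lnN d \<le> c2" if "d \<in> Dm m" for d
    unfolding c2_def using that lnN_pos Dm_subset[of m]
    by (intro member_le_sum[of d "Dm m" "\<lambda>d. lnN d"] finite_Dm) (auto intro!: less_imp_le)
  \<comment> \<open>The next digit has logarithm at most \<open>c2\<close> if redrawn and at most
    \<open>n powr (1/4)\<close> otherwise, while minus the logarithm of the length grows at least
    linearly.\<close>
  have rate: "\<forall>\<^sub>F n in sequentially. \<bar>c2\<bar> + real n powr (1 / 4) \<le> \<epsilon> * (real n * (- ln max_ratio))"
  proof -
    define c3 where "c3 = \<epsilon> * (- ln max_ratio)"
    have "0 < c3" unfolding c3_def using t1 max_ratio_bounds by (intro mult_pos_pos) auto
    then have "\<forall>\<^sub>F n in sequentially. \<bar>c2\<bar> + real n powr (1 / 4) \<le> c3 * real n"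
      by real_asymp
    then show ?thesis by (simp add: c3_def mult_ac)
  qed
  have "ereal (t1 - \<epsilon>) \<le> hausdorff_dim (freq_set S B f \<omega> \<alpha>)"
  proof (rule mass_distribution[OF supp t1(1,2)])
    have "AE b in product_law p. b \<in> E"
      by (rule AE_redrawn_in_E[OF c(1) m(2)]) (simp_all add: p_def)
    then show "AE b in product_law p. coding f \<omega> b \<in> freq_set S B f \<omega> \<alpha> \<and>
       (\<forall>\<^sub>F n in sequentially. cyl_mass p b n \<le> len b n powr t1 \<and> len b n powr \<epsilon> * N (\<omega> n) (b n) \<le> 1)"
      using AE_in_support
    proof eventually_elim
      case (elim b)
      note bi = E_index[OF elim(1)]
      have sb: "b k \<le> m \<longleftrightarrow> c k \<le> m" "m < c k \<Longrightarrow> b k = c k" "c k \<le> m \<Longrightarrow> 0 < \<alpha> (dig b k)" for k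
        using supp_p elim(2) by blast+
      define \<Lambda> where "\<Lambda> n = (\<Sum>k<n. lnN (dig b k))" for n
      have len: "len b n powr x = exp (- (x * \<Lambda> n))" for n x
        using len_eq_exp[OF bi] by (simp add: \<Lambda>_def powr_def)
      have \<Lambda>_ge: "real n * (- ln max_ratio) \<le> \<Lambda> n" for n
      proof -
        have "exp (- \<Lambda> n) \<le> max_ratio ^ n"
          using len_le[OF index_seqs_admissible[OF bi]] len_eq_exp[OF bi] by (simp add: \<Lambda>_def)
        then have "ln (exp (- \<Lambda> n)) \<le> ln (max_ratio ^ n)" by (intro ln_mono) auto
        then show ?thesis using max_ratio_bounds by (simp add: ln_realpow)
      qed
      have mass: "cyl_mass p b n = exp (- (\<Sum>k<n. Y (dig b k)))" for n
      proof -
        have "pmf (p k) (b k) = exp (- Y (dig b k))" for k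
        proof (cases "c k \<le> m")
          case True
          then have "dig b k \<in> Dm m" using dig_in_Dm[OF bi] sb by simp
          moreover have "b k \<in> B (\<omega> k)" using bi by (simp add: index_seqs_def)
          ultimately show ?thesis
            using True sb(1,3)[of k] m(2)[OF omega_in]
            by (simp add: p_def pmf_p cond_weight_def Y_def exp_diff)
        next
          case False
          then have "dig b k \<notin> Dm m" using dig_in_Dm[OF bi, of k m] sb(1)[of k] by simp
          then show ?thesis using False sb(2)[of k] by (simp add: p_def Y_def)
        qed
        then show ?thesis by (simp add: cyl_mass_def exp_sum sum_negf[symmetric])
      qed
      \<comment> \<open>Digits above \<open>m\<close> are common to \<open>b\<close> and
        \<open>c\<close>, so their contribution is read off from \<open>c\<close> as total minus
        small digits. The averages of \<open>Xm\<close> along \<open>b\<close> and \<open>c\<close>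
        have the same limit and cancel, leaving at most \<open>L\<close>, with three errors of
        \<open>\<delta> / 3\<close>.\<close>
      have \<Lambda>_eq: "\<Lambda> n = (\<Sum>k<n. Xm (dig b k)) + ((\<Sum>k<n. lnN (dig c k)) - (\<Sum>k<n. Xm (dig c k)))" for n
      proof -
        have "lnN (dig b k) = Xm (dig b k) + (lnN (dig c k) - Xm (dig c k))" for k
          using sb[of k] dig_in_Dm[OF bi] dig_in_Dm[OF ci] by (cases "c k \<le> m") (auto simp: Xm_def)
        then show ?thesis by (simp add: \<Lambda>_def sum.distrib sum_subtractf)
      qed
      have "\<forall>\<^sub>F n in sequentially. (\<Sum>k<n. Xm (dig b k)) / real n < lyap m + \<delta> / 3"
        "\<forall>\<^sub>F n in sequentially. lyap m - \<delta> / 3 < (\<Sum>k<n. Xm (dig c k)) / real n"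
        "\<forall>\<^sub>F n in sequentially. h m - \<delta> < (\<Sum>k<n. Y (dig b k)) / real n"
        using \<delta> Xm_lim[OF elim(1)] Xm_lim[OF c(1)] Y_lim[OF elim(1)] by (auto intro: order_tendstoD)
      moreover have "\<forall>\<^sub>F n in sequentially. (\<Sum>k<n. lnN (dig c k)) \<le> real n * (L + \<delta> / 3)"
        using \<delta> L(2) by (intro c(3)[rule_format]) auto
      ultimately have "\<forall>\<^sub>F n in sequentially. cyl_mass p b n \<le> len b n powr t1 \<and> len b n powr \<epsilon> * N (\<omega> n) (b n) \<le> 1"
        using rate c(2) eventually_gt_at_top[of 0]
      proof eventually_elim
        case (elim n)
        have n: "0 < real n" using elim by simp
        have "\<Lambda> n \<le> real n * (lyap m + \<delta> / 3) + (real n * (L + \<delta> / 3) - real n * (lyap m - \<delta> / 3))"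
          unfolding \<Lambda>_eq using elim n by (intro add_mono diff_mono) (auto simp: field_simps)
        also have "\<dots> = real n * (L + \<delta>)" by (simp add: algebra_simps)
        finally have "t1 * \<Lambda> n \<le> t1 * (real n * (L + \<delta>))" using t1 by (intro mult_left_mono) auto
        also have "\<dots> = real n * (t1 * (L + \<delta>))" by simp
        also have "\<dots> \<le> real n * (h m - \<delta>)" using key m(1) n by (intro mult_left_mono) auto
        also have "\<dots> \<le> (\<Sum>k<n. Y (dig b k))" using elim n by (simp add: less_divide_eq mult.commute)
        finally have 1: "cyl_mass p b n \<le> len b n powr t1" unfolding mass len by simp
        have "lnN (dig b n) \<le> \<bar>c2\<bar> + real n powr (1 / 4)"
        proof (cases "c n \<le> m")
          case True
          then have "dig b n \<in> Dm m" using dig_in_Dm[OF bi] sb by simp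
          then have "lnN (dig b n) \<le> c2" by (rule c2)
          moreover have "0 \<le> real n powr (1 / 4)" by simp
          ultimately show ?thesis by linarith
        next
          case False
          then show ?thesis using sb(2)[of n] elim by simp
        qed
        also have "\<dots> \<le> \<epsilon> * (real n * (- ln max_ratio))" using elim by simp
        also have "\<dots> \<le> \<epsilon> * \<Lambda> n" using \<Lambda>_ge t1 by (intro mult_left_mono) auto
        finally have 2: "lnN (dig b n) \<le> \<epsilon> * \<Lambda> n" .
        have "N (\<omega> n) (b n) = exp (lnN (dig b n))"
          using N_pos[OF omega_in, of "b n" n] bi by (simp add: index_seqs_def)
        also have "\<dots> \<le> exp (\<epsilon> * \<Lambda> n)" using 2 by (simp only: exp_le_cancel_iff)
        finally have "len b n powr \<epsilon> * N (\<omega> n) (b n) \<le> exp (- (\<epsilon> * \<Lambda> n)) * exp (\<epsilon> * \<Lambda> n)"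
          unfolding len by (intro mult_left_mono) auto
        then show ?case using 1 by (simp flip: exp_add)
      qed
      then show ?case using elim(1) by (simp add: freq_set_def)
    qed
  qed
  then show False using u(1) t1(4) by simp
qed

end

theorem theorem1p3:
  fixes S :: "'s set"
    and B :: "'s \<Rightarrow> nat set"
    and f :: "'s \<Rightarrow> nat \<Rightarrow> real \<Rightarrow> real"
    and \<alpha> :: "'s \<times> nat \<Rightarrow> real"
    and \<omega> :: "nat \<Rightarrow> 's"
  assumes "GLS_collection S B f"
    and "frequency_vector S B \<alpha>"
    and "\<forall>s\<in>S. \<exists>b\<in>B s. \<alpha> (s, b) > 0"
    and "\<omega> \<in> admissible_seqs S B f \<alpha>"
    and "\<forall>s\<in>S. B s = {1..} \<longrightarrow> convergent (\<lambda>n. ln (real n) / ln (inv_ratio f s n))"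
  shows "hausdorff_dim (freq_set S B f \<omega> \<alpha>)
           = max (ereal (max_conv_exponent S B f)) (fibre_dim S B f \<alpha>) \<and>
         ((\<Sum>\<^sub>\<infinity>(s, b)\<in>digits S B. ereal (\<alpha> (s, b) * ln (inv_ratio f s b))) = \<infinity> \<longrightarrow>
           hausdorff_dim (freq_set S B f \<omega> \<alpha>) = ereal (max_conv_exponent S B f))"
proof -
  interpret gls_freq S B f \<omega> \<alpha>
    using assms by unfold_locales (auto simp: admissible_seqs_def)
  have E: "E \<noteq> {}" using assms(4) by (auto simp: admissible_seqs_def freq_set_def)
  have lower: "ereal (max_conv_exponent S B f) \<le> hausdorff_dim (freq_set S B f \<omega> \<alpha>)"
    by (rule exponent_le_hausdorff_dim[OF assms(5) E])
  have fibre: "fibre_dim S B f \<alpha> \<le> hausdorff_dim (freq_set S B f \<omega> \<alpha>)"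
  proof (cases "\<exists>M. \<forall>m. lyap m \<le> M")
    case True
    then show ?thesis using fibre_dim_le_hausdorff_dim[OF E] by blast
  next
    case False
    have "filterlim lyap at_top sequentially"
      unfolding filterlim_at_top eventually_sequentially
      using False monoD[OF mono_lyap] by (meson linear order_trans)
    then show ?thesis using fibre_dim_le_exponent lower order_trans by blast
  qed
  have eq: "hausdorff_dim (freq_set S B f \<omega> \<alpha>) = max (ereal (max_conv_exponent S B f)) (fibre_dim S B f \<alpha>)"
    using hausdorff_dim_upper lower fibre by (intro antisym) auto
  moreover have "fibre_dim S B f \<alpha> \<le> ereal (max_conv_exponent S B f)"
    if "(\<Sum>\<^sub>\<infinity>(s, b)\<in>D. ereal (\<alpha> (s, b) * ln (N s b))) = \<infinity>"
    using that by (intro fibre_dim_le_exponent lyap_at_top)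
  ultimately show ?thesis by (auto simp: max_def)
qed

end
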